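(* Let $d\ge 1$, $b>0$, $R>0$ and $\mathcal J=[-R,\infty)$. Let $f_{ij}:\mathbb R^d\to\mathbb R$ and $g_{ij}:\mathcal J\times\mathbb R^d\to\mathbb R$, $1\le i,j\le d$, be bounded measurable functions, and suppose there is a constant $\alpha_0>-1$ such that $g_{ij}(z,x)\ge\alpha_0$ for all $1\le i,j\le d$, all $z\in\mathcal J$ and all $x\in\mathbb R^d$. Suppose that $f_{ij}(x)\ge 0$ for all $i\ne j$ and all $x\in\mathbb R^d$. Let $\phi_i:[-b,0]\to\mathbb R$, $i=1,\dots,d$, be deterministic measurable functions with $\phi_i(0)\ge 0$ for $i=1,\dots,d$. Let $\tilde N_1,\dots,\tilde N_d$ be the compensated Poisson random measures described in the context. Then the system of stochastic delay differential equations $$dS_i(t)=\sum_{j=1}^d f_{ij}(S(t-b))\,S_j(t)\,dt+S_i(t-)\sum_{j=1}^d\int_{\mathcal J}g_{ij}(z,S(t-b))\,\tilde N_j(dz,dt),\quad t>0,\ i=1,\dots,d,$$ $$S_i(t)=\phi_i(t),\quad t\in[-b,0],\ i=1,\dots,d,$$ where $S(t)=(S_1(t),\dots,S_d(t))^T$, admits a unique pathwise solution, and this solution satisfies, almost surely, $S_i(t)\ge 0$ for all $i=1,\dots,d$ and all $t>0$.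
   Context: For $j=1,\dots,d$, $Z_j(t)=\sum_{k=1}^{N_j(t)}Y_{j,k}$ is a compound Poisson process, where $N_1,\dots,N_d$ are independent Poisson processes, the $Y_{j,k}$ ($k\ge1$) are i.i.d. random variables, and the family $(N_\ell)_\ell$ is independent of the family $(Y_{j,k})_{j,k}$. All jumps of all $Z_j$ lie in $\mathcal J=[-R,\infty)$. The Poisson random measure of $Z_j$ is $N_j(t,U)=\sum_{0\le s\le t,\ \Delta Z_j(s)\ne0}\mathbf 1_U(\Delta Z_j(s))$, where $\Delta Z_j(s)=Z_j(s)-Z_j(s-)$ and $U$ is a Borel subset of $\mathbb R\setminus\{0\}$ whose closure does not contain $0$. Its Lévy measure is $\nu_j(U)=\mathbb E[N_j(1,U)]$, and its compensated measure is $\tilde N_j(dt,dz)=N_j(dt,dz)-\nu_j(dz)\,dt$. A solution is a càdlàg (on $[0,\infty)$) adapted process satisfying the integrated equation. Uniqueness means that any two solutions agree almost surely for all $t$. *)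

theory Defs
  imports "HOL-Probability.Probability"
begin

section \<open>Paths and their jumps\<close>

text \<open>Processes are indexed by \<^typ>\<open>real\<close>; only the relevant times (\<open>t \<ge> 0\<close> for the driving
  processes and \<open>t \<ge> -b\<close> for the solutions) ever matter.\<close>

definition cadlag :: "(real \<Rightarrow> 'b::topological_space) \<Rightarrow> bool" where
  "cadlag x \<longleftrightarrow> (\<forall>t\<ge>0. (x \<longlongrightarrow> x t) (at_right t)) \<and> (\<forall>t>0. \<exists>l. (x \<longlongrightarrow> l) (at_left t))"

definition left_lim :: "(real \<Rightarrow> 'b::t2_space) \<Rightarrow> real \<Rightarrow> 'b" where
  "left_lim x t = Lim (at_left t) x"

definition jump :: "(real \<Rightarrow> real) \<Rightarrow> real \<Rightarrow> real" where
  "jump x t = x t - left_lim x t"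

text \<open>The Poisson random measure of a path \<open>x\<close>: for Borel \<open>U\<close>, the mass of \<open>{0..t} \<times> U\<close> is the
  number of times \<open>s \<le> t\<close> with \<open>0 \<noteq> jump x s \<in> U\<close>.  There is no jump at time \<open>0\<close>, by the usual
  convention \<open>x(0-) = x(0)\<close>.\<close>

definition jump_measure :: "(real \<Rightarrow> real) \<Rightarrow> (real \<times> real) measure" where
  "jump_measure x = distr (count_space {s. 0 < s \<and> jump x s \<noteq> 0}) borel (\<lambda>s. (s, jump x s))"

lemma emeasure_jump_measure:
  assumes "U \<in> sets borel"
  shows "emeasure (jump_measure x) ({0..t} \<times> U) =
    emeasure (count_space UNIV) {s. 0 < s \<and> s \<le> t \<and> jump x s \<noteq> 0 \<and> jump x s \<in> U}"
proof -
  have m: "{0..t} \<times> U \<in> sets borel"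
    using assms by (metis atLeastAtMost_borel borel_prod pair_measureI)
  let ?A = "{s. 0 < s \<and> s \<le> t \<and> jump x s \<noteq> 0 \<and> jump x s \<in> U}"
  have "emeasure (jump_measure x) ({0..t} \<times> U) =
      emeasure (count_space {s. 0 < s \<and> jump x s \<noteq> 0})
        ((\<lambda>s. (s, jump x s)) -` ({0..t} \<times> U) \<inter> {s. 0 < s \<and> jump x s \<noteq> 0})"
    unfolding jump_measure_def using m by (subst emeasure_distr) auto
  also have "(\<lambda>s. (s, jump x s)) -` ({0..t} \<times> U) \<inter> {s. 0 < s \<and> jump x s \<noteq> 0} = ?A"
    by auto
  also have "emeasure (count_space {s. 0 < s \<and> jump x s \<noteq> 0}) ?A = emeasure (count_space UNIV) ?A"
    by (cases "finite ?A") (subst (1 2) emeasure_count_space; auto)+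
  finally show ?thesis .
qed


section \<open>Compound Poisson processes\<close>

definition poisson_process :: "'a measure \<Rightarrow> real \<Rightarrow> (real \<Rightarrow> 'a \<Rightarrow> nat) \<Rightarrow> bool" where
  "poisson_process M r N \<longleftrightarrow>
     0 < r \<and>
     (\<forall>t\<ge>0. N t \<in> measurable M (count_space UNIV)) \<and>
     (\<forall>\<omega>\<in>space M. N 0 \<omega> = 0 \<and> mono_on {0..} (\<lambda>t. N t \<omega>) \<and> cadlag (\<lambda>t. N t \<omega>)) \<and>
     (\<forall>s\<ge>0. \<forall>t>s. distr M (count_space UNIV) (\<lambda>\<omega>. N t \<omega> - N s \<omega>) =
        measure_pmf (poisson_pmf (r * (t - s)))) \<and>
     (\<forall>(\<tau>::nat \<Rightarrow> real) n. 0 \<le> \<tau> 0 \<and> mono \<tau> \<longrightarrow>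
        prob_space.indep_vars M (\<lambda>_. count_space UNIV)
          (\<lambda>k \<omega>. N (\<tau> (Suc k)) \<omega> - N (\<tau> k) \<omega>) {..<n})"

definition compound :: "(real \<Rightarrow> 'a \<Rightarrow> nat) \<Rightarrow> (nat \<Rightarrow> 'a \<Rightarrow> real) \<Rightarrow> real \<Rightarrow> 'a \<Rightarrow> real" where
  "compound N Y t \<omega> = (\<Sum>k = 1..N t \<omega>. Y k \<omega>)"

definition iid :: "'a measure \<Rightarrow> (nat \<Rightarrow> 'a \<Rightarrow> real) \<Rightarrow> bool" where
  "iid M Y \<longleftrightarrow>
     prob_space.indep_vars M (\<lambda>_. borel) Y {1..} \<and>
     (\<forall>k\<ge>1. distr M borel (Y k) = distr M borel (Y 1))"

text \<open>Mutual independence of the family of processes \<open>N j\<close>, each viewed as a random element of the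
  path space with its product \<open>\<sigma>\<close>-algebra, and independence of the whole family \<open>(N j)\<^sub>j\<close> from the
  whole family \<open>(Y j k)\<^sub>j\<^sub>,\<^sub>k\<close>.\<close>

definition independent_processes :: "'a measure \<Rightarrow> ('d \<Rightarrow> real \<Rightarrow> 'a \<Rightarrow> nat) \<Rightarrow> bool" where
  "independent_processes M N \<longleftrightarrow>
     prob_space.indep_vars M (\<lambda>_. \<Pi>\<^sub>M t\<in>{0..}. count_space UNIV) (\<lambda>j \<omega>. \<lambda>t\<in>{0..}. N j t \<omega>) UNIV"

definition independent_of_marks ::
    "'a measure \<Rightarrow> ('d \<Rightarrow> real \<Rightarrow> 'a \<Rightarrow> nat) \<Rightarrow> ('d \<Rightarrow> nat \<Rightarrow> 'a \<Rightarrow> real) \<Rightarrow> bool" where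
  "independent_of_marks M N Y \<longleftrightarrow>
     prob_space.indep_var M
       (\<Pi>\<^sub>M p\<in>UNIV \<times> {0..}. count_space UNIV) (\<lambda>\<omega>. \<lambda>p\<in>UNIV \<times> {0..}. N (fst p) (snd p) \<omega>)
       (\<Pi>\<^sub>M p\<in>UNIV \<times> {1..}. borel) (\<lambda>\<omega>. \<lambda>p\<in>UNIV \<times> {1..}. Y (fst p) (snd p) \<omega>)"

text \<open>\<open>\<nu>(U) = E[N(1,U)]\<close>.  Only nonzero jumps are counted, so the formula makes sense for every Borel
  set \<open>U\<close>; the resulting measure gives no mass to \<open>{0}\<close> and is determined by the sets whose closure
  does not contain \<open>0\<close>.\<close>

definition levy_measure :: "'a measure \<Rightarrow> (real \<Rightarrow> 'a \<Rightarrow> real) \<Rightarrow> real measure" where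
  "levy_measure M Z = measure_of UNIV (sets borel)
     (\<lambda>U. \<integral>\<^sup>+ \<omega>. emeasure (jump_measure (\<lambda>t. Z t \<omega>)) ({0..1} \<times> U) \<partial>M)"


section \<open>Pathwise integrals with respect to the compensated measure\<close>

text \<open>The compensated measure \<open>N(dt,dz) - \<nu>(dz) dt\<close> is a signed measure along every path, since a
  compound Poisson path has finitely many jumps on bounded time intervals and \<open>\<nu>\<close> is finite; \<open>x\<close> is
  the path of the driving process.\<close>

definition comp_integrable ::
    "(real \<Rightarrow> real) \<Rightarrow> real measure \<Rightarrow> (real \<times> real) set \<Rightarrow> (real \<times> real \<Rightarrow> real) \<Rightarrow> bool" where
  "comp_integrable x \<nu> A h \<longleftrightarrow>
     set_integrable (jump_measure x) A h \<and> set_integrable (lborel \<Otimes>\<^sub>M \<nu>) A h"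

definition comp_integral ::
    "(real \<Rightarrow> real) \<Rightarrow> real measure \<Rightarrow> (real \<times> real) set \<Rightarrow> (real \<times> real \<Rightarrow> real) \<Rightarrow> real" where
  "comp_integral x \<nu> A h =
     set_lebesgue_integral (jump_measure x) A h - set_lebesgue_integral (lborel \<Otimes>\<^sub>M \<nu>) A h"


section \<open>The delay equation\<close>

text \<open>The integrand \<open>S\<^sub>i(s-) g\<^sub>i\<^sub>j(z, S(s-b))\<close> of the jump term, along the path \<open>x\<close> of \<open>S\<close>.\<close>

definition jump_coeff ::
    "real \<Rightarrow> (real \<Rightarrow> real^'d \<Rightarrow> real) \<Rightarrow> (real \<Rightarrow> real^'d) \<Rightarrow> 'd \<Rightarrow> real \<times> real \<Rightarrow> real" where
  "jump_coeff b gij x i = (\<lambda>(s, z). left_lim x s $ i * gij z (x (s - b)))"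

definition sdde_solution ::
    "'a measure \<Rightarrow> (real \<Rightarrow> 'a measure) \<Rightarrow> ('d::finite \<Rightarrow> real \<Rightarrow> 'a \<Rightarrow> real) \<Rightarrow> real set \<Rightarrow> real \<Rightarrow>
     ('d \<Rightarrow> 'd \<Rightarrow> real^'d \<Rightarrow> real) \<Rightarrow> ('d \<Rightarrow> 'd \<Rightarrow> real \<Rightarrow> real^'d \<Rightarrow> real) \<Rightarrow> ('d \<Rightarrow> real \<Rightarrow> real) \<Rightarrow>
     (real \<Rightarrow> 'a \<Rightarrow> real^'d) \<Rightarrow> bool" where
  "sdde_solution M F Z J b f g \<phi> S \<longleftrightarrow>
     (\<forall>t\<ge>0. S t \<in> borel_measurable (F t)) \<and>
     (AE \<omega> in M.
        cadlag (\<lambda>t. S t \<omega>) \<and>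
        (\<forall>t\<in>{-b..0}. \<forall>i. S t \<omega> $ i = \<phi> i t) \<and>
        (\<forall>t>0. \<forall>i.
           (\<forall>j. set_integrable lborel {0..t} (\<lambda>s. f i j (S (s - b) \<omega>) * S s \<omega> $ j)) \<and>
           (\<forall>j. comp_integrable (\<lambda>s. Z j s \<omega>) (levy_measure M (Z j)) ({0<..t} \<times> J)
                  (jump_coeff b (g i j) (\<lambda>s. S s \<omega>) i)) \<and>
           S t \<omega> $ i = \<phi> i 0
             + (\<Sum>j\<in>UNIV. set_lebesgue_integral lborel {0..t} (\<lambda>s. f i j (S (s - b) \<omega>) * S s \<omega> $ j))
             + (\<Sum>j\<in>UNIV. comp_integral (\<lambda>s. Z j s \<omega>) (levy_measure M (Z j)) ({0<..t} \<times> J)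
                  (jump_coeff b (g i j) (\<lambda>s. S s \<omega>) i))))"

end

theory Submission
  imports Defs
begin

text \<open>Every driving path is a step function, and the Levy measures are finite, so the equation
  can be solved path by path. On \<open>[0, T]\<close> the delayed values \<open>S(s - b)\<close> are known from the previous
  stage of the method of steps, and the left limits \<open>L(t) = S(t-)\<close> solve a linear impulsive system
  \<open>L\<^sub>i(t) = \<phi>\<^sub>i(0) + \<integral>\<^sub>0\<^sup>t \<Sum>\<^sub>j A\<^sub>i\<^sub>j L\<^sub>j ds + \<Sum>\<^sub>s\<^sub><\<^sub>t \<gamma>\<^sub>i(s) L\<^sub>i(s)\<close> with bounded coefficients and locally finitely many
  impulses. Picard iteration converges in an exponentially weighted norm and produces progressively
  measurable limits. Since independent Poisson processes almost surely never jump simultaneously,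
  \<open>1 + \<gamma>\<^sub>i \<ge> min 1 (1 + \<alpha>\<^sub>0) > 0\<close>; the off-diagonal drift being nonnegative, solutions with nonnegative
  initial values stay nonnegative. Applied to the difference of two solutions and to its negative, the
  same fact gives uniqueness.\<close>


section \<open>Linear impulsive systems: nonnegativity and uniqueness\<close>

text \<open>Passing to left limits makes the system explicit at impulses: the impulse at
  \<open>s\<close> multiplies a value determined by times before \<open>s\<close>, and the solution
  itself is recovered from \<open>L\<close> by the factor 1 + \<gamma> at impulse times. Under
  \<open>ds\<close> both paths may be exchanged, since they differ at finitely many times of a
  bounded interval. The sign is obtained from a minimum argument, not from a solution formula:
  nonnegative off-diagonal drift keeps the smallest component from being pulled below zero, whatever
  the sign of the diagonal. This matters because compensation puts terms of either sign on the
  diagonal. Adaptedness shapes the existence proof. \<open>F\<close> is not assumed complete, so the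
  solution is constructed for every \<omega>, and each stage must be jointly measurable in time and
  \<omega>. Integrals and limits preserve this; the delicate ingredient is a sum over random jump
  times, which is reduced to counting increments of the driving path on finer and finer
  grids.\<close>

lemma set_integrable_bounded_interval:
  fixes h :: "real \<Rightarrow> real"
  assumes "h \<in> borel_measurable borel" "\<And>s. s \<in> {a..c} \<Longrightarrow> \<bar>h s\<bar> \<le> B"
  shows "set_integrable lborel {a..c} h"
proof (rule set_integrable_bound)
  show "set_integrable lborel {a..c} (\<lambda>_. B)"
    by (intro borel_integrable_atLeastAtMost') (rule continuous_on_const)
  show "set_borel_measurable lborel {a..c} h"
    unfolding set_borel_measurable_def using assms(1) by measurable
  show "AE x in lborel. x \<in> {a..c} \<longrightarrow> norm (h x) \<le> norm B"
    using assms(2) by (intro AE_I2) force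
qed

lemma continuous_on_indefinite_lborel_integral:
  fixes h :: "real \<Rightarrow> real"
  assumes "set_integrable lborel {a..c} h"
  shows "continuous_on {a..c} (\<lambda>t. LINT s:{a..t}|lborel. h s)"
proof -
  have "continuous_on {a..c} (\<lambda>t. integral {a..t} h)"
    by (intro indefinite_integral_continuous_1 set_borel_integral_eq_integral(1) assms)
  moreover have "(LINT s:{a..t}|lborel. h s) = integral {a..t} h" if "t \<in> {a..c}" for t
    using that by (intro set_borel_integral_eq_integral(2) set_integrable_subset[OF assms]) auto
  ultimately show ?thesis
    by (subst continuous_on_cong[OF refl, of _ _ "\<lambda>t. integral {a..t} h"]) auto
qed

text \<open>The lower bound is asked for on the half-open \<open>{s<..t}\<close> because the minimum
  argument below supplies it only strictly after the last time at which a component was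
  nonnegative.\<close>

lemma lborel_integral_increment_ge:
  fixes h :: "real \<Rightarrow> real"
  assumes int: "set_integrable lborel {a..t} h" and "a \<le> s" "s \<le> t"
    and ge: "\<And>u. u \<in> {s<..t} \<Longrightarrow> c \<le> h u"
  shows "c * (t - s) \<le> (LINT u:{a..t}|lborel. h u) - (LINT u:{a..s}|lborel. h u)"
proof -
  have un: "{a..t} = {a..s} \<union> {s<..t}" using assms by auto
  have i1: "set_integrable lborel {a..s} h" "set_integrable lborel {s<..t} h"
    using assms by (auto intro!: set_integrable_subset[OF int])
  have "(LINT u:{a..t}|lborel. h u) = (LINT u:{a..s}|lborel. h u) + (LINT u:{s<..t}|lborel. h u)"
    unfolding un using i1 by (intro set_integral_Un) auto
  moreover have "(LINT u:{s<..t}|lborel. c) \<le> (LINT u:{s<..t}|lborel. h u)"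
  proof (rule set_integral_mono)
    have "set_integrable lborel {s..t} (\<lambda>_. c)"
      by (intro borel_integrable_atLeastAtMost') (rule continuous_on_const)
    then show "set_integrable lborel {s<..t} (\<lambda>_. c)"
      by (rule set_integrable_subset) auto
  qed (use i1 ge in auto)
  moreover have "(LINT u:{s<..t}|lborel. c) = c * (t - s)"
    using \<open>s \<le> t\<close> by (simp add: set_lebesgue_integral_def)
  ultimately show ?thesis by simp
qed

lemma lborel_integral_singleton [simp]:
  fixes h :: "real \<Rightarrow> real"
  shows "(LINT u:{a}|lborel. h u) = 0"
proof -
  have "(LINT u:{a}|lborel. h u) = (LINT u:{}|lborel. h u)"
    by (rule set_integral_discrete_difference[where X="{a}"]) auto
  then show ?thesis by (simp add: set_lebesgue_integral_def)
qed

lemma finite_gap_right: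
  fixes D :: "real set"
  assumes "finite (D \<inter> {0<..<T})" "0 \<le> \<tau>" "\<tau> < T"
  obtains e where "\<tau> < e" "e \<le> T" "D \<inter> {\<tau><..<e} = {}"
proof -
  let ?Q = "insert T (D \<inter> {\<tau><..<T})"
  have "finite (D \<inter> {\<tau><..<T})"
    by (rule finite_subset[OF _ assms(1)]) (use assms in auto)
  then have f: "finite ?Q" by simp
  have 1: "\<tau> < Min ?Q" using f assms by (subst Min_gr_iff) auto
  have 2: "Min ?Q \<le> T" using f by simp
  have "D \<inter> {\<tau><..<Min ?Q} = {}"
  proof (rule ccontr)
    assume "D \<inter> {\<tau><..<Min ?Q} \<noteq> {}"
    then obtain x where "x \<in> D" "\<tau> < x" "x < Min ?Q" by auto
    then have "x \<in> ?Q" using 2 by auto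
    then show False using f \<open>x < Min ?Q\<close> by (meson Min_le not_less)
  qed
  with 1 2 that show ?thesis by blast
qed

lemma finite_gap_left:
  fixes D :: "real set"
  assumes "finite (D \<inter> {0<..<T})" "0 < \<tau>" "\<tau> \<le> T"
  obtains e where "0 \<le> e" "e < \<tau>" "D \<inter> {e<..<\<tau>} = {}"
proof -
  let ?Q = "insert 0 (D \<inter> {0<..<\<tau>})"
  have "finite (D \<inter> {0<..<\<tau>})"
    by (rule finite_subset[OF _ assms(1)]) (use assms in auto)
  then have f: "finite ?Q" by simp
  have 1: "Max ?Q < \<tau>" using f assms by (subst Max_less_iff) auto
  have 2: "0 \<le> Max ?Q" using f by simp
  have "D \<inter> {Max ?Q<..<\<tau>} = {}"
  proof (rule ccontr)
    assume "D \<inter> {Max ?Q<..<\<tau>} \<noteq> {}"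
    then obtain x where "x \<in> D" "x < \<tau>" "Max ?Q < x" by auto
    then have "x \<in> ?Q" using 2 by auto
    then show False using f \<open>Max ?Q < x\<close> by (meson Max_ge not_less)
  qed
  with 1 2 that show ?thesis by blast
qed

text \<open>\<open>L\<close> stands for a path of left limits, hence the strict upper end in
  \<open>{0<..<t}\<close>: an impulse at \<open>t\<close> acts only after \<open>t\<close>.
  Integrability is required of the row sum alone; differences of solutions inherit exactly
  this.\<close>

definition impulsive_solution ::
  "('d::finite \<Rightarrow> 'd \<Rightarrow> real \<Rightarrow> real) \<Rightarrow> ('d \<Rightarrow> real \<Rightarrow> real) \<Rightarrow> real set \<Rightarrow> ('d \<Rightarrow> real) \<Rightarrow> real \<Rightarrow>
    ('d \<Rightarrow> real \<Rightarrow> real) \<Rightarrow> bool" where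
  "impulsive_solution A \<gamma> D p T L \<longleftrightarrow> (\<forall>i. set_integrable lborel {0..T} (\<lambda>s. \<Sum>j\<in>UNIV. A i j s * L j s) \<and>
    (\<forall>t\<in>{0..T}. L i t = p i + (LINT s:{0..t}|lborel. \<Sum>j\<in>UNIV. A i j s * L j s)
       + (\<Sum>s\<in>D \<inter> {0<..<t}. \<gamma> i s * L i s)))"

text \<open>Let \<tau> be the infimum of the times with a negative component. Left continuity gives
  \<open>L\<close> \<ge> 0 at \<tau>, and the impulse there multiplies by a factor \<ge> 0, so the
  right limit is \<ge> 0 too. On a short impulse-free interval after \<tau> let \<open>m\<close> be
  the least value of all components. If \<open>m\<close> < 0, the component attaining it falls from
  a value \<ge> 0 to \<open>m\<close> at a speed of order |m|, which takes longer than the interval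
  allows.\<close>

lemma impulsive_solution_nonneg:
  fixes A :: "'d::finite \<Rightarrow> 'd \<Rightarrow> real \<Rightarrow> real"
  assumes sol: "impulsive_solution A \<gamma> D p T L"
    and fin: "finite (D \<inter> {0<..<T})"
    and K: "\<And>i j s. s \<in> {0..T} \<Longrightarrow> \<bar>A i j s\<bar> \<le> K"
    and A0: "\<And>i j s. i \<noteq> j \<Longrightarrow> s \<in> {0..T} \<Longrightarrow> 0 \<le> A i j s"
    and g0: "\<And>i s. s \<in> D \<Longrightarrow> s \<in> {0<..<T} \<Longrightarrow> 0 \<le> 1 + \<gamma> i s"
    and p0: "\<And>i. 0 \<le> p i"
    and "t \<in> {0..T}"
  shows "0 \<le> L i t"
proof (rule ccontr)
  assume neg: "\<not> 0 \<le> L i t"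
  define H where "H = (\<lambda>i s. \<Sum>j\<in>UNIV. A i j s * L j s)"
  define I where "I i t = (LINT s:{0..t}|lborel. H i s)" for i t
  have int: "set_integrable lborel {0..T} (H i)" for i
    using sol by (simp add: impulsive_solution_def H_def)
  have eq: "L i t = p i + I i t + (\<Sum>s\<in>D \<inter> {0<..<t}. \<gamma> i s * L i s)" if "t \<in> {0..T}" for i t
    using sol that by (simp add: impulsive_solution_def H_def I_def)
  have contI: "continuous_on {0..T} (I i)" for i
    unfolding I_def using continuous_on_indefinite_lborel_integral[OF int] by simp
  define B where "B = {t \<in> {0..T}. \<exists>i. L i t < 0}"
  define \<tau> where "\<tau> = Inf B"
  have "t \<in> B" using neg assms(7) unfolding B_def by (auto simp: not_le)
  then have B: "B \<noteq> {}" "bdd_below B" unfolding B_def by (auto intro!: bdd_belowI[of _ 0])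
  have \<tau>0: "0 \<le> \<tau>" unfolding \<tau>_def using B by (intro cInf_greatest) (auto simp: B_def)
  obtain b0 where b0: "b0 \<in> B" using B by auto
  have \<tau>T: "\<tau> \<le> T" using cInf_lower[OF b0 B(2)] b0 by (auto simp: \<tau>_def B_def)
  have before: "0 \<le> L j s" if "0 \<le> s" "s < \<tau>" for j s
  proof (rule ccontr)
    assume "\<not> 0 \<le> L j s"
    then have "s \<in> B" using that \<tau>T by (auto simp: B_def not_le)
    then have "\<tau> \<le> s" unfolding \<tau>_def by (intro cInf_lower B)
    with that show False by simp
  qed
  \<comment> \<open>On an impulse-free gap before \<tau> the path moves only by increments of the
    continuous function \<open>I j\<close>, so nonnegativity passes to the left limit, which is the
    value at \<tau>.\<close>
  have at: "0 \<le> L j \<tau>" for j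
  proof (cases "\<tau> = 0")
    case True
    then show ?thesis using eq[of 0 j] p0[of j] \<tau>T \<tau>0 by (simp add: I_def)
  next
    case False
    then have "0 < \<tau>" using \<tau>0 by simp
    from finite_gap_left[OF fin this \<tau>T] obtain e where e: "0 \<le> e" "e < \<tau>" "D \<inter> {e<..<\<tau>} = {}" .
    have jump: "L j \<tau> = L j s + (I j \<tau> - I j s)" if "s \<in> {e<..<\<tau>}" for s
    proof -
      have "D \<inter> {0<..<\<tau>} = D \<inter> {0<..<s}" using that e by force
      then show ?thesis using eq[of s j] eq[of \<tau> j] that e \<tau>T by simp
    qed
    have tend: "(I j \<longlongrightarrow> I j \<tau>) (at_left \<tau>)"
    proof -
      have "(I j \<longlongrightarrow> I j \<tau>) (at \<tau> within {0..\<tau>})"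
        using contI[of j] \<tau>T \<tau>0 by (meson atLeastAtMost_iff atLeastatMost_subset_iff continuous_on_def
              continuous_on_subset order_refl)
      then show ?thesis using \<open>0 < \<tau>\<close> by (simp add: at_within_Icc_at_left)
    qed
    have "((\<lambda>s. I j \<tau> - I j s) \<longlongrightarrow> I j \<tau> - I j \<tau>) (at_left \<tau>)"
      by (intro tendsto_intros tend)
    moreover have "\<forall>\<^sub>F s in at_left \<tau>. I j \<tau> - I j s \<le> L j \<tau>"
      using eventually_at_left_real[OF e(2)]
    proof eventually_elim
      case (elim s)
      have "0 \<le> L j s" using elim e before by auto
      then show ?case using jump[OF elim] by simp
    qed
    ultimately have "I j \<tau> - I j \<tau> \<le> L j \<tau>"
      by (intro tendsto_upperbound) auto
    then show ?thesis by simp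
  qed
  have "\<tau> \<notin> B" using at by (auto simp: B_def not_less)
  then have "\<tau> \<noteq> T" using b0 cInf_lower[OF b0 B(2)] unfolding \<tau>_def[symmetric] by (auto simp: B_def)
  then have "\<tau> < T" using \<tau>T by simp
  from finite_gap_right[OF fin \<tau>0 this] obtain e where e: "\<tau> < e" "e \<le> T" "D \<inter> {\<tau><..<e} = {}" .
  \<comment> \<open>The \<open>+ 1\<close> keeps \<open>C\<close> positive when \<open>K\<close> =
    0; an interval of length 1/(2C) then lets the drift act with total weight at most 1/2.\<close>
  define C where "C = real CARD('d) * \<bar>K\<bar> + 1"
  have C1: "1 \<le> C" unfolding C_def by simp
  define t1 where "t1 = min e (\<tau> + 1 / (2 * C))"
  have t1: "\<tau> < t1" "t1 \<le> T" "t1 \<le> e" "t1 - \<tau> \<le> 1 / (2 * C)"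
    using e C1 unfolding t1_def by auto
  \<comment> \<open>\<open>V\<close> agrees with \<open>L\<close> after \<tau> but already includes
    the impulse at \<tau>, so it is continuous on the closed interval and attains its minimum
    there.\<close>
  define V where "V i t = p i + (\<Sum>s\<in>D \<inter> {0<..\<tau>}. \<gamma> i s * L i s) + I i t" for i t
  have LV: "L i t = V i t" if "t \<in> {\<tau><..t1}" for i t
  proof -
    have "D \<inter> {0<..<t} = D \<inter> {0<..\<tau>}" using that e t1 by force
    then show ?thesis using eq[of t i] that t1 \<tau>0 by (simp add: V_def)
  qed
  have V\<tau>: "0 \<le> V i \<tau>" for i
  proof (cases "\<tau> \<in> D \<and> 0 < \<tau>")
    case True
    then have *: "D \<inter> {0<..\<tau>} = insert \<tau> (D \<inter> {0<..<\<tau>})" by auto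
    have "finite (D \<inter> {0<..<\<tau>})" by (rule finite_subset[OF _ fin]) (use \<tau>T in auto)
    then have "V i \<tau> = (1 + \<gamma> i \<tau>) * L i \<tau>"
      using eq[of \<tau> i] \<tau>0 \<tau>T unfolding V_def * by (simp add: algebra_simps)
    then show ?thesis using g0[of \<tau> i] True \<open>\<tau> < T\<close> at[of i] by simp
  next
    case False
    have "x < \<tau>" if "x \<in> D" "0 < x" "x \<le> \<tau>" for x
      using False that by (cases "x = \<tau>") auto
    then have *: "D \<inter> {0<..\<tau>} = D \<inter> {0<..<\<tau>}" by auto
    show ?thesis using eq[of \<tau> i] at[of i] \<tau>0 \<tau>T unfolding V_def * by simp
  qed
  have contV: "continuous_on {\<tau>..t1} (V i)" for i
    unfolding V_def
    by (intro continuous_intros continuous_on_subset[OF contI[of i]]) (use \<tau>0 t1 in auto)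
  have "\<exists>u\<in>{\<tau>..t1}. \<forall>v\<in>{\<tau>..t1}. V i u \<le> V i v" for i
    using t1 by (intro continuous_attains_inf contV) auto
  then obtain u where u: "\<And>i. u i \<in> {\<tau>..t1}" "\<And>i v. v \<in> {\<tau>..t1} \<Longrightarrow> V i (u i) \<le> V i v"
    by metis
  define m where "m = Min (range (\<lambda>i. V i (u i)))"
  have "m \<in> range (\<lambda>i. V i (u i))" unfolding m_def by (intro Min_in) auto
  then obtain k where k: "m = V k (u k)" by auto
  have mle: "m \<le> V i v" if "v \<in> {\<tau>..t1}" for i v
  proof -
    have "m \<le> V i (u i)" unfolding m_def by (intro Min_le) auto
    then show ?thesis using u(2)[OF that, of i] by simp
  qed
  have "0 \<le> m"
  proof (rule ccontr)
    assume "\<not> 0 \<le> m"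
    then have m: "m < 0" by simp
    \<comment> \<open>Restarting from the last time \<sigma> with \<open>V k\<close> \<ge> 0
      confines \<open>V k\<close> to the range from \<open>m\<close> to 0 up to \<open>u k\<close>.
      This bounds |L k| by |m| and so controls the diagonal term, whose coefficient may have either
      sign.\<close>
    define Q where "Q = {s \<in> {\<tau>..u k}. 0 \<le> V k s}"
    have "closed Q" unfolding Q_def
      by (intro continuous_closed_preimage[of _ "V k" "{0..}", unfolded vimage_def Int_def, simplified]
            continuous_closed_preimage[of "{\<tau>..u k}" "V k" "{0..}"]
            continuous_on_subset[OF contV])
         (use u(1)[of k] in \<open>auto simp: Q_def[symmetric]\<close>)
    moreover have Qne: "Q \<noteq> {}" "bdd_above Q"
      using V\<tau>[of k] u(1)[of k] unfolding Q_def by (auto intro!: bdd_aboveI[of _ "u k"] exI[of _ \<tau>])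
    ultimately have "Sup Q \<in> Q" by (intro closed_contains_Sup)
    define \<sigma> where "\<sigma> = Sup Q"
    have \<sigma>: "\<sigma> \<in> {\<tau>..u k}" "0 \<le> V k \<sigma>" using \<open>Sup Q \<in> Q\<close> unfolding \<sigma>_def Q_def by auto
    have after: "V k s < 0" if "s \<in> {\<sigma><..u k}" for s
    proof (rule ccontr)
      assume "\<not> V k s < 0"
      then have "s \<in> Q" using that \<sigma> unfolding Q_def by auto
      then have "s \<le> \<sigma>" unfolding \<sigma>_def using Qne by (intro cSup_upper)
      with that show False by simp
    qed
    have Hge: "real CARD('d) * \<bar>K\<bar> * m \<le> H k s" if s: "s \<in> {\<sigma><..u k}" for s
    proof -
      have s1: "s \<in> {\<tau><..t1}" "s \<in> {0..T}" using s \<sigma> u(1)[of k] \<tau>0 t1 by auto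
      \<comment> \<open>For \<open>j = k\<close> the absolute value of \<open>L k s\<close> is at
        most |m|. For \<open>j \<noteq> k\<close> only \<open>L j s\<close> \<ge> \<open>m\<close>
        is known, and here the sign of \<open>A k j s\<close> is essential.\<close>
      have "\<bar>K\<bar> * m \<le> A k j s * L j s" for j
      proof (cases "j = k")
        case True
        have "\<bar>A k j s * L j s\<bar> \<le> \<bar>K\<bar> * \<bar>m\<bar>"
          unfolding abs_mult
        proof (rule mult_mono)
          show "\<bar>L j s\<bar> \<le> \<bar>m\<bar>" using after[OF s] mle[of s k] s1 LV[of s k] True m by auto
        qed (use K[OF s1(2), of k j] in auto)
        then show ?thesis using m by (simp add: abs_le_iff)
      next
        case False
        have "\<bar>K\<bar> * m \<le> A k j s * m"
          using m K[OF s1(2), of k j] by (intro mult_right_mono_neg) auto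
        also have "\<dots> \<le> A k j s * L j s"
          using A0[of k j s] False s1 mle[of s j] LV[of s j] by (intro mult_left_mono) auto
        finally show ?thesis .
      qed
      then have "(\<Sum>j\<in>(UNIV::'d set). \<bar>K\<bar> * m) \<le> H k s"
        unfolding H_def by (intro sum_mono)
      then show ?thesis by simp
    qed
    \<comment> \<open>The drift can lower \<open>V k\<close> by at most |m|/2 between \<sigma> and
      \<open>u k\<close>, yet \<open>V k\<close> drops there from a value \<ge> 0 down to
      \<open>m\<close>.\<close>
    have "real CARD('d) * \<bar>K\<bar> * m * (u k - \<sigma>) \<le> I k (u k) - I k \<sigma>"
      unfolding I_def
      by (rule lborel_integral_increment_ge)
         (use \<sigma> u(1)[of k] \<tau>0 t1 Hge in \<open>auto intro!: set_integrable_subset[OF int]\<close>)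
    also have "\<dots> = m - V k \<sigma>" unfolding k V_def by simp
    also have "\<dots> \<le> m" using \<sigma> by simp
    finally have 1: "real CARD('d) * \<bar>K\<bar> * m * (u k - \<sigma>) \<le> m" .
    have "real CARD('d) * \<bar>K\<bar> * (u k - \<sigma>) \<le> C * (1 / (2 * C))"
      unfolding C_def[symmetric]
      by (intro mult_mono) (use \<sigma> u(1)[of k] t1 C1 in \<open>auto simp: C_def\<close>)
    also have "\<dots> = 1/2" using C1 by simp
    finally have "m * (real CARD('d) * \<bar>K\<bar> * (u k - \<sigma>)) \<ge> m * (1/2)"
      using m by (intro mult_left_mono_neg) auto
    with 1 have "m * (1/2) \<le> m" by (simp add: algebra_simps)
    with m show False by simp
  qed
  obtain c where c: "c \<in> B" "c < t1"
    using cInf_lessD[OF B(1), of t1] t1 unfolding \<tau>_def[symmetric] by auto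
  then obtain i where i: "L i c < 0" by (auto simp: B_def)
  have "\<tau> \<le> c" unfolding \<tau>_def by (intro cInf_lower B c)
  with \<open>\<tau> \<notin> B\<close> c have "c \<in> {\<tau><..t1}" by (cases "\<tau> = c") auto
  then have "0 \<le> L i c" using LV[of c i] mle[of c i] \<open>0 \<le> m\<close> by auto
  with i show False by simp
qed

lemma impulsive_solution_unique:
  fixes A :: "'d::finite \<Rightarrow> 'd \<Rightarrow> real \<Rightarrow> real"
  assumes sol: "impulsive_solution A \<gamma> D p T L" "impulsive_solution A \<gamma> D p T L'"
    and fin: "finite (D \<inter> {0<..<T})"
    and K: "\<And>i j s. s \<in> {0..T} \<Longrightarrow> \<bar>A i j s\<bar> \<le> K"
    and A0: "\<And>i j s. i \<noteq> j \<Longrightarrow> s \<in> {0..T} \<Longrightarrow> 0 \<le> A i j s"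
    and g0: "\<And>i s. s \<in> D \<Longrightarrow> s \<in> {0<..<T} \<Longrightarrow> 0 \<le> 1 + \<gamma> i s"
    and t: "t \<in> {0..T}"
  shows "L i t = L' i t"
proof -
  have eqX: "X i t = p i + (LINT s:{0..t}|lborel. \<Sum>j\<in>UNIV. A i j s * X j s) + (\<Sum>s\<in>D \<inter> {0<..<t}. \<gamma> i s * X i s)"
    if "impulsive_solution A \<gamma> D p T X" "t \<in> {0..T}" for X i t
    using that unfolding impulsive_solution_def by blast
  have diff: "impulsive_solution A \<gamma> D (\<lambda>_. 0) T (\<lambda>i s. X i s - X' i s)"
    if X: "impulsive_solution A \<gamma> D p T X" "impulsive_solution A \<gamma> D p T X'" for X X'
    unfolding impulsive_solution_def
  proof (intro allI conjI ballI)
    fix i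
    have i: "set_integrable lborel {0..T} (\<lambda>s. \<Sum>j\<in>UNIV. A i j s * X j s)"
        "set_integrable lborel {0..T} (\<lambda>s. \<Sum>j\<in>UNIV. A i j s * X' j s)"
      using X by (auto simp: impulsive_solution_def)
    have eq: "(\<lambda>s. \<Sum>j\<in>UNIV. A i j s * (X j s - X' j s)) =
        (\<lambda>s. (\<Sum>j\<in>UNIV. A i j s * X j s) - (\<Sum>j\<in>UNIV. A i j s * X' j s))"
      by (simp add: right_diff_distrib sum_subtractf)
    show "set_integrable lborel {0..T} (\<lambda>s. \<Sum>j\<in>UNIV. A i j s * (X j s - X' j s))"
      unfolding eq using i by (rule set_integral_diff(1))
    fix t assume t: "t \<in> {0..T}"
    have "(LINT s:{0..t}|lborel. \<Sum>j\<in>UNIV. A i j s * (X j s - X' j s)) =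
      (LINT s:{0..t}|lborel. \<Sum>j\<in>UNIV. A i j s * X j s) - (LINT s:{0..t}|lborel. \<Sum>j\<in>UNIV. A i j s * X' j s)"
      unfolding eq using t by (intro set_integral_diff(2) set_integrable_subset[OF i(1)] set_integrable_subset[OF i(2)]) auto
    then show "X i t - X' i t = 0 + (LINT s:{0..t}|lborel. \<Sum>j\<in>UNIV. A i j s * (X j s - X' j s))
       + (\<Sum>s\<in>D \<inter> {0<..<t}. \<gamma> i s * (X i s - X' i s))"
      using eqX[OF X(1) t, of i] eqX[OF X(2) t, of i] by (simp add: right_diff_distrib sum_subtractf)
  qed
  have "0 \<le> L i t - L' i t"
    by (rule impulsive_solution_nonneg[OF diff[OF sol] fin]) (use K A0 g0 t in auto)
  moreover have "0 \<le> L' i t - L i t"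
    by (rule impulsive_solution_nonneg[OF diff[OF sol(2,1)] fin]) (use K A0 g0 t in auto)
  ultimately show ?thesis by simp
qed

section \<open>Linear impulsive systems: existence\<close>

definition impulsive_op ::
  "('d::finite \<Rightarrow> 'd \<Rightarrow> real \<Rightarrow> real) \<Rightarrow> ('d \<Rightarrow> real \<Rightarrow> real) \<Rightarrow> real set \<Rightarrow> ('d \<Rightarrow> real) \<Rightarrow>
    ('d \<Rightarrow> real \<Rightarrow> real) \<Rightarrow> 'd \<Rightarrow> real \<Rightarrow> real" where
  "impulsive_op A \<gamma> D p L i t = p i + (LINT s:{0..t}|lborel. \<Sum>j\<in>UNIV. A i j s * L j s)
     + (\<Sum>s\<in>D \<inter> {0<..<t}. \<gamma> i s * L i s)"

definition picard ::
  "('d::finite \<Rightarrow> 'd \<Rightarrow> real \<Rightarrow> real) \<Rightarrow> ('d \<Rightarrow> real \<Rightarrow> real) \<Rightarrow> real set \<Rightarrow> ('d \<Rightarrow> real) \<Rightarrow>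
    nat \<Rightarrow> 'd \<Rightarrow> real \<Rightarrow> real" where
  "picard A \<gamma> D p n = (impulsive_op A \<gamma> D p ^^ n) (\<lambda>_ _. 0)"

definition impulsive_path ::
  "('d::finite \<Rightarrow> 'd \<Rightarrow> real \<Rightarrow> real) \<Rightarrow> ('d \<Rightarrow> real \<Rightarrow> real) \<Rightarrow> real set \<Rightarrow> ('d \<Rightarrow> real) \<Rightarrow>
    'd \<Rightarrow> real \<Rightarrow> real" where
  "impulsive_path A \<gamma> D p i t = lim (\<lambda>n. picard A \<gamma> D p n i t)"

lemma picard_0 [simp]: "picard A \<gamma> D p 0 i t = 0"
  and picard_Suc: "picard A \<gamma> D p (Suc n) = impulsive_op A \<gamma> D p (picard A \<gamma> D p n)"
  by (simp_all add: picard_def)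

text \<open>Causality: an iterate at \<open>t\<close> sees the coefficients up to \<open>t\<close>
  and the impulses strictly before \<open>t\<close>. This is what later makes the method of steps
  consistent.\<close>

lemma picard_cong:
  assumes A: "\<And>i j s. s \<in> {0..T} \<Longrightarrow> A i j s = A' i j s"
    and g: "\<And>i s. s \<in> D \<Longrightarrow> s \<in> {0<..<T} \<Longrightarrow> \<gamma> i s = \<gamma>' i s"
    and "t \<le> T"
  shows "picard A \<gamma> D p n i t = picard A' \<gamma>' D p n i t"
  using \<open>t \<le> T\<close>
proof (induction n arbitrary: i t)
  case (Suc n)
  have "(LINT s:{0..t}|lborel. \<Sum>j\<in>UNIV. A i j s * picard A \<gamma> D p n j s) =
        (LINT s:{0..t}|lborel. \<Sum>j\<in>UNIV. A' i j s * picard A' \<gamma>' D p n j s)"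
    using Suc A by (intro set_lebesgue_integral_cong) (auto intro!: sum.cong)
  moreover have "(\<Sum>s\<in>D \<inter> {0<..<t}. \<gamma> i s * picard A \<gamma> D p n i s) =
      (\<Sum>s\<in>D \<inter> {0<..<t}. \<gamma>' i s * picard A' \<gamma>' D p n i s)"
    using Suc g by (intro sum.cong) auto
  ultimately show ?case unfolding picard_Suc impulsive_op_def by simp
qed simp

lemma impulsive_path_cong:
  assumes "\<And>i j s. s \<in> {0..T} \<Longrightarrow> A i j s = A' i j s"
    and "\<And>i s. s \<in> D \<Longrightarrow> s \<in> {0<..<T} \<Longrightarrow> \<gamma> i s = \<gamma>' i s"
    and "t \<le> T"
  shows "impulsive_path A \<gamma> D p i t = impulsive_path A' \<gamma>' D p i t"
  using picard_cong[of T A A' D \<gamma> \<gamma>' t p, OF assms] unfolding impulsive_path_def by simp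

text \<open>For each \<open>t\<close> the sum is the eventual value of finite sums of multiples of
  indicators of \<open>{s<..}\<close>, which are measurable in \<open>t\<close>.\<close>

lemma borel_measurable_locally_finite_sum:
  fixes c :: "real \<Rightarrow> real"
  assumes fin: "\<And>t. finite (D \<inter> {0<..<t})"
  shows "(\<lambda>t. \<Sum>s\<in>D \<inter> {0<..<t}. c s) \<in> borel_measurable borel"
proof (rule borel_measurable_LIMSEQ_real)
  show "(\<lambda>n. \<Sum>s\<in>D \<inter> {0<..<real n}. c s * indicator {s<..} t) \<longlonglongrightarrow> (\<Sum>s\<in>D \<inter> {0<..<t}. c s)" for t
  proof (rule tendsto_eventually)
    obtain m where m: "t \<le> real m" using real_arch_simple by blast
    show "\<forall>\<^sub>F n in sequentially. (\<Sum>s\<in>D \<inter> {0<..<real n}. c s * indicator {s<..} t) = (\<Sum>s\<in>D \<inter> {0<..<t}. c s)"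
      using eventually_ge_at_top[of m]
    proof eventually_elim
      case (elim n)
      then have "t \<le> real n" using m by simp
      then show ?case by (intro sum.mono_neutral_cong_right fin) (auto simp: indicator_def)
    qed
  qed
qed measurable

lemma borel_measurable_indefinite_integral:
  fixes h :: "real \<Rightarrow> real"
  assumes [measurable]: "h \<in> borel_measurable borel"
  shows "(\<lambda>t. LINT s:{0..t}|lborel. h s) \<in> borel_measurable borel"
proof -
  have "(\<lambda>t. LINT s|lborel. (if 0 \<le> s \<and> s \<le> t then h s else 0)) \<in> borel_measurable borel"
    by (rule lborel.borel_measurable_lebesgue_integral) measurable
  also have "(\<lambda>t. LINT s|lborel. (if 0 \<le> s \<and> s \<le> t then h s else 0)) = (\<lambda>t. LINT s:{0..t}|lborel. h s)"
    unfolding set_lebesgue_integral_def by (intro ext Bochner_Integration.integral_cong) (auto simp: indicator_def)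
  finally show ?thesis .
qed

text \<open>The ranks \<open>card (A \<inter> {..<s})\<close> run once through 0, ...,
  \<open>card A\<close> - 1, so this is the finite geometric series.\<close>

lemma sum_power_card_below:
  fixes q :: real and A :: "'b::linorder set"
  assumes "finite A"
  shows "(q - 1) * (\<Sum>s\<in>A. q ^ card (A \<inter> {..<s})) = q ^ card A - 1"
  using assms
proof (induction A rule: finite_linorder_max_induct)
  case (insert b A)
  have b: "b \<notin> A" using insert by auto
  have "insert b A \<inter> {..<s} = A \<inter> {..<s}" if "s \<in> A" for s using that insert by auto
  moreover have "insert b A \<inter> {..<b} = A" using insert by auto
  ultimately have "(\<Sum>s\<in>insert b A. q ^ card (insert b A \<inter> {..<s})) = q ^ card A + (\<Sum>s\<in>A. q ^ card (A \<inter> {..<s}))"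
    using insert b by simp
  then show ?case using insert b by (simp add: algebra_simps)
qed simp

locale bounded_impulsive =
  fixes A :: "'d::finite \<Rightarrow> 'd \<Rightarrow> real \<Rightarrow> real" and \<gamma> :: "'d \<Rightarrow> real \<Rightarrow> real" and D :: "real set"
    and K :: real
  assumes A_borel [measurable]: "\<And>i j. A i j \<in> borel_measurable borel"
    and A_bound: "\<And>i j s. \<bar>A i j s\<bar> \<le> K" and \<gamma>_bound: "\<And>i s. \<bar>\<gamma> i s\<bar> \<le> K"
    and D_finite: "\<And>t. finite (D \<inter> {0<..<t})"
begin

lemma K_nonneg: "0 \<le> K"
  using A_bound[of undefined undefined 0] by linarith

lemma impulsive_op_borel [measurable]:
  assumes [measurable]: "\<And>j. h j \<in> borel_measurable borel"
  shows "impulsive_op A \<gamma> D p h i \<in> borel_measurable borel"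
  unfolding impulsive_op_def[abs_def]
  by (intro borel_measurable_add borel_measurable_const borel_measurable_indefinite_integral
        borel_measurable_locally_finite_sum D_finite) measurable

lemma picard_borel [measurable]: "picard A \<gamma> D p n i \<in> borel_measurable borel"
proof (induction n arbitrary: i)
  case 0
  have "picard A \<gamma> D p 0 i = (\<lambda>_. 0)" by (rule ext) simp
  then show ?case by simp
next
  case (Suc n)
  then show ?case unfolding picard_Suc by (rule impulsive_op_borel)
qed

text \<open>In the norm weighted by \<open>weight\<close>, the exponential rate makes the integral term a contraction with
  factor \<open>1/4\<close>, and the base \<open>4 * K + 2\<close> does the same for the impulses.\<close>

definition rate :: real where "rate = 4 * (real CARD('d) * K) + 1"

definition weight :: "real \<Rightarrow> real" where
  "weight t = exp (rate * t) * (4 * K + 2) ^ card (D \<inter> {0<..<t})"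

lemma rate_pos: "0 < rate"
proof -
  have "0 \<le> real CARD('d) * K" using K_nonneg by (intro mult_nonneg_nonneg) auto
  then show ?thesis unfolding rate_def by simp
qed

lemma weight_ge_1: "0 \<le> t \<Longrightarrow> 1 \<le> weight t"
proof -
  assume "0 \<le> t"
  then have "1 * 1 \<le> exp (rate * t) * (4 * K + 2) ^ card (D \<inter> {0<..<t})"
    using rate_pos K_nonneg by (intro mult_mono one_le_power) auto
  then show ?thesis unfolding weight_def by simp
qed

lemma weight_le: 
  assumes "s \<le> t"
  shows "weight s \<le> exp (rate * s) * (4 * K + 2) ^ card (D \<inter> {0<..<t})"
  unfolding weight_def using assms K_nonneg
  by (intro mult_left_mono power_increasing card_mono D_finite) auto

lemma weight_mono:
  assumes "s \<le> t"
  shows "weight s \<le> weight t"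
proof -
  have "weight s \<le> exp (rate * s) * (4 * K + 2) ^ card (D \<inter> {0<..<t})" by (rule weight_le[OF assms])
  also have "\<dots> \<le> weight t" unfolding weight_def
    using assms rate_pos K_nonneg by (intro mult_right_mono) auto
  finally show ?thesis .
qed

lemma integrable_drift:
  assumes [measurable]: "\<And>j. h j \<in> borel_measurable borel"
    and b: "\<And>j s. 0 \<le> s \<Longrightarrow> \<bar>h j s\<bar> \<le> B * weight s" and B: "0 \<le> B"
  shows "set_integrable lborel {0..t} (\<lambda>s. \<Sum>j\<in>UNIV. A i j s * h j s)"
proof (rule set_integrable_bounded_interval)
  fix s assume s: "s \<in> {0..t}"
  have "\<bar>\<Sum>j\<in>UNIV. A i j s * h j s\<bar> \<le> (\<Sum>j\<in>(UNIV::'d set). K * (B * weight t))"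
  proof (rule order.trans[OF sum_abs sum_mono])
    fix j
    have "\<bar>h j s\<bar> \<le> B * weight t"
      using b[of s j] weight_mono[of s t] s B by (auto elim!: order.trans intro!: mult_left_mono)
    then show "\<bar>A i j s * h j s\<bar> \<le> K * (B * weight t)"
      unfolding abs_mult using A_bound K_nonneg by (intro mult_mono) auto
  qed
  then show "\<bar>\<Sum>j\<in>UNIV. A i j s * h j s\<bar> \<le> (\<Sum>j\<in>(UNIV::'d set). K * (B * weight t))" .
qed measurable

text \<open>Integral and impulses each contribute a quarter. In the integral the impulse count is
  frozen at its value at \<open>t\<close>, and integrating the exponential gains
  1/\<open>rate\<close>. For the impulses the exponential is frozen at \<open>t\<close>, and the
  count before successive impulses is 0, 1, ..., m - 1, so the powers of \<open>q\<close> sum to at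
  most q^m/(q - 1). The common bound \<open>B\<close> enters through the integrability of both
  drifts.\<close>

lemma impulsive_op_contraction:
  assumes [measurable]: "\<And>j. h j \<in> borel_measurable borel" "\<And>j. h' j \<in> borel_measurable borel"
    and b: "\<And>j s. 0 \<le> s \<Longrightarrow> \<bar>h j s\<bar> \<le> B * weight s" "\<And>j s. 0 \<le> s \<Longrightarrow> \<bar>h' j s\<bar> \<le> B * weight s"
    and B: "0 \<le> B"
    and d: "\<And>j s. 0 \<le> s \<Longrightarrow> \<bar>h j s - h' j s\<bar> \<le> c * weight s" and t: "0 \<le> t"
  shows "\<bar>impulsive_op A \<gamma> D p h i t - impulsive_op A \<gamma> D p h' i t\<bar> \<le> c / 2 * weight t"
proof -
  define q where "q = 4 * K + 2"
  define m where "m = card (D \<inter> {0<..<t})"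
  have q: "2 \<le> q" using K_nonneg unfolding q_def by simp
  have wt: "weight t = exp (rate * t) * q ^ m" unfolding weight_def q_def m_def by simp
  have c: "0 \<le> c" using order.trans[OF abs_ge_zero d[of 0 undefined]] weight_ge_1[of 0]
    by (simp add: zero_le_mult_iff)
  have int: "set_integrable lborel {0..t} (\<lambda>s. \<Sum>j\<in>UNIV. A i j s * h j s)"
     "set_integrable lborel {0..t} (\<lambda>s. \<Sum>j\<in>UNIV. A i j s * h' j s)"
    by (rule integrable_drift[OF _ b(1) B]; measurable) (rule integrable_drift[OF _ b(2) B]; measurable)
  define c1 where "c1 = real CARD('d) * (K * c * q ^ m)"
  have c10: "0 \<le> c1" using K_nonneg c q unfolding c1_def by simp
  have "\<bar>LINT s:{0..t}|lborel. (\<Sum>j\<in>UNIV. A i j s * h j s) - (\<Sum>j\<in>UNIV. A i j s * h' j s)\<bar> \<le>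
      (LINT s:{0..t}|lborel. c1 * exp (rate * s))"
  proof -
    have "norm (LINT s:{0..t}|lborel. (\<Sum>j\<in>UNIV. A i j s * h j s) - (\<Sum>j\<in>UNIV. A i j s * h' j s))
       \<le> (LINT s:{0..t}|lborel. norm ((\<Sum>j\<in>UNIV. A i j s * h j s) - (\<Sum>j\<in>UNIV. A i j s * h' j s)))"
      by (intro set_integral_norm_bound set_integral_diff(1) int)
    also have "\<dots> \<le> (LINT s:{0..t}|lborel. c1 * exp (rate * s))"
    proof (rule set_integral_mono)
      show "set_integrable lborel {0..t} (\<lambda>s. norm ((\<Sum>j\<in>UNIV. A i j s * h j s) - (\<Sum>j\<in>UNIV. A i j s * h' j s)))"
        using set_integrable_abs[OF set_integral_diff(1)[OF int]] by simp
      show "set_integrable lborel {0..t} (\<lambda>s. c1 * exp (rate * s))"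
        by (intro borel_integrable_atLeastAtMost' continuous_intros)
      fix s assume s: "s \<in> {0..t}"
      have "norm ((\<Sum>j\<in>UNIV. A i j s * h j s) - (\<Sum>j\<in>UNIV. A i j s * h' j s)) =
        \<bar>\<Sum>j\<in>UNIV. A i j s * (h j s - h' j s)\<bar>"
        by (simp add: right_diff_distrib sum_subtractf)
      also have "\<dots> \<le> (\<Sum>j\<in>(UNIV::'d set). K * (c * (exp (rate * s) * q ^ m)))"
      proof (rule order.trans[OF sum_abs sum_mono])
        fix j
        have "\<bar>h j s - h' j s\<bar> \<le> c * weight s" using d s by auto
        also have "\<dots> \<le> c * (exp (rate * s) * q ^ m)"
          using weight_le[of s t] s c unfolding q_def m_def by (intro mult_left_mono) auto
        finally show "\<bar>A i j s * (h j s - h' j s)\<bar> \<le> K * (c * (exp (rate * s) * q ^ m))"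
          unfolding abs_mult using A_bound K_nonneg by (intro mult_mono) auto
      qed
      also have "\<dots> = c1 * exp (rate * s)" by (simp add: c1_def)
      finally show "norm ((\<Sum>j\<in>UNIV. A i j s * h j s) - (\<Sum>j\<in>UNIV. A i j s * h' j s)) \<le> c1 * exp (rate * s)" .
    qed
    finally show ?thesis by simp
  qed
  also have "\<dots> = c1 * (LINT s:{0..t}|lborel. exp (rate * s))" by simp
  also have "(LINT s:{0..t}|lborel. exp (rate * s)) = exp (rate * t) / rate - exp (rate * 0) / rate"
    unfolding set_lebesgue_integral_def
  proof (rule integral_FTC_atLeastAtMost)
    show "((\<lambda>s. exp (rate * s) / rate) has_vector_derivative exp (rate * x)) (at x within {0..t})" for x
      unfolding has_real_derivative_iff_has_vector_derivative[symmetric]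
      using rate_pos by (auto intro!: derivative_eq_intros)
  qed (use t in \<open>auto intro!: continuous_intros\<close>)
  also have "c1 * \<dots> \<le> c1 * (exp (rate * t) / rate)"
    using c10 rate_pos by (intro mult_left_mono) auto
  also have "\<dots> = (real CARD('d) * K / rate) * (c * weight t)" by (simp add: c1_def wt)
  also have "\<dots> \<le> (1 / 4) * (c * weight t)"
    using rate_pos c weight_ge_1[OF t] by (intro mult_right_mono) (auto simp: field_simps rate_def)
  finally have 1: "\<bar>LINT s:{0..t}|lborel. (\<Sum>j\<in>UNIV. A i j s * h j s) - (\<Sum>j\<in>UNIV. A i j s * h' j s)\<bar>
     \<le> (1 / 4) * (c * weight t)" .
  have "\<bar>\<Sum>s\<in>D \<inter> {0<..<t}. \<gamma> i s * (h i s - h' i s)\<bar> \<le>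
      (\<Sum>s\<in>D \<inter> {0<..<t}. K * (c * (exp (rate * t) * q ^ card (D \<inter> {0<..<s}))))"
  proof (rule order.trans[OF sum_abs sum_mono])
    fix s assume s: "s \<in> D \<inter> {0<..<t}"
    have "\<bar>h i s - h' i s\<bar> \<le> c * weight s" using d s by auto
    also have "\<dots> \<le> c * (exp (rate * t) * q ^ card (D \<inter> {0<..<s}))"
      using s c rate_pos q unfolding weight_def q_def[symmetric]
      by (intro mult_left_mono mult_right_mono) auto
    finally show "\<bar>\<gamma> i s * (h i s - h' i s)\<bar> \<le> K * (c * (exp (rate * t) * q ^ card (D \<inter> {0<..<s})))"
      unfolding abs_mult using \<gamma>_bound K_nonneg by (intro mult_mono) auto
  qed
  also have "\<dots> = K * c * exp (rate * t) * (\<Sum>s\<in>D \<inter> {0<..<t}. q ^ card (D \<inter> {0<..<s}))"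
    by (simp add: sum_distrib_left mult_ac)
  also have "(\<Sum>s\<in>D \<inter> {0<..<t}. q ^ card (D \<inter> {0<..<s})) =
     (\<Sum>s\<in>D \<inter> {0<..<t}. q ^ card ((D \<inter> {0<..<t}) \<inter> {..<s}))"
    by (intro sum.cong refl arg_cong2[where f=power] arg_cong[where f=card]) auto
  also have "\<dots> \<le> q ^ m / (q - 1)"
    using sum_power_card_below[OF D_finite[of t], of q] q by (simp add: field_simps m_def)
  also have "K * c * exp (rate * t) * (q ^ m / (q - 1)) = (K / (q - 1)) * (c * weight t)"
    by (simp add: wt)
  \<comment> \<open>Here q - 1 = 4K + 1 exceeds 4K and is positive also for \<open>K\<close> =
    0.\<close>
  also have "\<dots> \<le> (1 / 4) * (c * weight t)"
    using K_nonneg c weight_ge_1[OF t] by (intro mult_right_mono) (auto simp: field_simps q_def)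
  finally have 2: "\<bar>\<Sum>s\<in>D \<inter> {0<..<t}. \<gamma> i s * (h i s - h' i s)\<bar> \<le> (1 / 4) * (c * weight t)"
    using K_nonneg c by (simp add: mult_left_mono)
  have "impulsive_op A \<gamma> D p h i t - impulsive_op A \<gamma> D p h' i t =
      (LINT s:{0..t}|lborel. (\<Sum>j\<in>UNIV. A i j s * h j s) - (\<Sum>j\<in>UNIV. A i j s * h' j s))
      + (\<Sum>s\<in>D \<inter> {0<..<t}. \<gamma> i s * (h i s - h' i s))"
    unfolding impulsive_op_def set_integral_diff(2)[OF int]
    by (simp add: right_diff_distrib sum_subtractf)
  also have "\<bar>\<dots>\<bar> \<le> (1 / 4) * (c * weight t) + (1 / 4) * (c * weight t)"
    by (rule order.trans[OF abs_triangle_ineq add_mono[OF 1 2]])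
  finally show ?thesis by simp
qed

text \<open>The operator maps zero to \<open>p\<close>, of weighted size at most \<open>P\<close>,
  and halves distances. Hence the ball of radius 2P is invariant: P + (2P)/2 = 2P.\<close>

lemma picard_bound:
  assumes p: "\<And>i. \<bar>p i\<bar> \<le> P" and "0 \<le> t"
  shows "\<bar>picard A \<gamma> D p n i t\<bar> \<le> 2 * P * weight t"
  using \<open>0 \<le> t\<close>
proof (induction n arbitrary: i t)
  case 0
  have "0 \<le> P" using p[of i] by linarith
  then show ?case using weight_ge_1[OF 0] by simp
next
  case (Suc n)
  have P: "0 \<le> P" using p[of i] by linarith
  have "\<bar>impulsive_op A \<gamma> D p (picard A \<gamma> D p n) i t - impulsive_op A \<gamma> D p (\<lambda>_ _. 0) i t\<bar> \<le> 2 * P / 2 * weight t"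
    by (rule impulsive_op_contraction[where B = "2 * P"])
       (use Suc P weight_ge_1 in \<open>auto intro!: mult_nonneg_nonneg intro: order.trans[OF zero_le_one weight_ge_1]\<close>)
  moreover have "impulsive_op A \<gamma> D p (\<lambda>_ _. 0) i t = p i"
    by (simp add: impulsive_op_def)
  moreover have "P \<le> P * weight t" using P weight_ge_1[OF Suc.prems] by (simp add: mult_le_cancel_left1)
  ultimately show ?case using p[of i] unfolding picard_Suc by (simp add: abs_le_iff)
qed

text \<open>The zeroth iterate is zero, so \<open>picard_bound\<close> starts the induction; every
  further application of the operator to both iterates halves their distance.\<close>

lemma picard_cauchy_bound:
  assumes p: "\<And>i. \<bar>p i\<bar> \<le> P" and "0 \<le> t"
  shows "\<bar>picard A \<gamma> D p (n + k) i t - picard A \<gamma> D p n i t\<bar> \<le> 2 * P * (1/2) ^ n * weight t"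
  using \<open>0 \<le> t\<close>
proof (induction n arbitrary: i t)
  case 0
  then show ?case using picard_bound[where p=p, OF p] by simp
next
  case (Suc n)
  have P: "0 \<le> P" using p[of i] by linarith
  have "\<bar>picard A \<gamma> D p (Suc (n + k)) i t - picard A \<gamma> D p (Suc n) i t\<bar> \<le> 2 * P * (1/2) ^ n / 2 * weight t"
    unfolding picard_Suc
    by (rule impulsive_op_contraction[where B = "2 * P"]) (use Suc P picard_bound[where p=p, OF p] in auto)
  then show ?case by simp
qed

lemma picard_tendsto:
  assumes "0 \<le> t"
  shows "(\<lambda>n. picard A \<gamma> D p n i t) \<longlonglongrightarrow> impulsive_path A \<gamma> D p i t"
proof -
  define P where "P = (\<Sum>i\<in>UNIV. \<bar>p i\<bar>)"
  have p: "\<bar>p i\<bar> \<le> P" for i unfolding P_def by (rule member_le_sum) auto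
  have lim0: "(\<lambda>n. 2 * P * (1/2) ^ n * weight t) \<longlonglongrightarrow> 2 * P * 0 * weight t"
    by (intro tendsto_intros LIMSEQ_power_zero) auto
  have "Cauchy (\<lambda>n. picard A \<gamma> D p n i t)"
  proof (rule CauchyI')
    fix e :: real assume "0 < e"
    with lim0 have "\<forall>\<^sub>F n in sequentially. 2 * P * (1/2) ^ n * weight t < e"
      by (auto dest: order_tendstoD(2))
    then obtain N where N: "\<And>n. n \<ge> N \<Longrightarrow> 2 * P * (1/2) ^ n * weight t < e"
      by (auto simp: eventually_sequentially)
    show "\<exists>M. \<forall>m\<ge>M. \<forall>n>m. dist (picard A \<gamma> D p m i t) (picard A \<gamma> D p n i t) < e"
    proof (intro exI[of _ N] allI impI)
      fix m n :: nat assume "N \<le> m" "m < n"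
      then show "dist (picard A \<gamma> D p m i t) (picard A \<gamma> D p n i t) < e"
        using picard_cauchy_bound[where p=p and t=t and n=m and k="n-m" and i=i, OF p assms] N[of m]
        by (simp add: dist_real_def abs_minus_commute)
    qed
  qed
  then show ?thesis
    unfolding impulsive_path_def by (simp add: Cauchy_convergent_iff convergent_LIMSEQ_iff)
qed

lemma impulsive_path_rate:
  assumes p: "\<And>i. \<bar>p i\<bar> \<le> P" and t: "0 \<le> t"
  shows "\<bar>impulsive_path A \<gamma> D p i t - picard A \<gamma> D p n i t\<bar> \<le> 2 * P * (1/2) ^ n * weight t"
proof (rule tendsto_upperbound)
  have "(\<lambda>k. picard A \<gamma> D p (n + k) i t) \<longlonglongrightarrow> impulsive_path A \<gamma> D p i t"
    using LIMSEQ_ignore_initial_segment[OF picard_tendsto[where p=p and i=i, OF t], of n] by (simp add: add.commute)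
  then show "(\<lambda>k. \<bar>picard A \<gamma> D p (n + k) i t - picard A \<gamma> D p n i t\<bar>) \<longlonglongrightarrow>
     \<bar>impulsive_path A \<gamma> D p i t - picard A \<gamma> D p n i t\<bar>"
    by (intro tendsto_intros)
qed (use picard_cauchy_bound[where p=p, OF p t] in auto)

lemma impulsive_path_borel [measurable]: "impulsive_path A \<gamma> D p i \<in> borel_measurable borel"
  unfolding impulsive_path_def[abs_def] by measurable

lemma impulsive_path_bound:
  assumes p: "\<And>i. \<bar>p i\<bar> \<le> P" and t: "0 \<le> t"
  shows "\<bar>impulsive_path A \<gamma> D p i t\<bar> \<le> 2 * P * weight t"
  using impulsive_path_rate[where p=p and n=0, OF assms] by simp

lemma impulsive_path_locally_bounded:
  obtains B where "\<And>i s. s \<in> {0..t} \<Longrightarrow> \<bar>impulsive_path A \<gamma> D p i s\<bar> \<le> B"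
proof -
  define P where "P = (\<Sum>i\<in>UNIV. \<bar>p i\<bar>)"
  have p: "\<bar>p i\<bar> \<le> P" for i unfolding P_def by (rule member_le_sum) auto
  have "0 \<le> P" unfolding P_def by (simp add: sum_nonneg)
  have "\<bar>impulsive_path A \<gamma> D p i s\<bar> \<le> 2 * P * weight t" if "s \<in> {0..t}" for i s
  proof -
    have "2 * P * weight s \<le> 2 * P * weight t"
      using that \<open>0 \<le> P\<close> by (intro mult_left_mono weight_mono) auto
    then show ?thesis using impulsive_path_bound[where p=p, OF p, of s i] that by auto
  qed
  with that show ?thesis by blast
qed

text \<open>The contraction estimate is applied to the limit and the n-th iterate: their images
  differ by at most half of a distance that tends to zero, so the limit may be taken under the
  operator.\<close>

lemma impulsive_path_fixpoint:
  assumes t: "0 \<le> t"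
  shows "impulsive_path A \<gamma> D p i t = impulsive_op A \<gamma> D p (impulsive_path A \<gamma> D p) i t"
proof -
  define P where "P = (\<Sum>i\<in>UNIV. \<bar>p i\<bar>)"
  have p: "\<bar>p i\<bar> \<le> P" for i unfolding P_def by (rule member_le_sum) auto
  have P: "0 \<le> P" unfolding P_def by (simp add: sum_nonneg)
  let ?L = "impulsive_path A \<gamma> D p"
  have b: "\<bar>picard A \<gamma> D p (Suc n) i t - impulsive_op A \<gamma> D p ?L i t\<bar> \<le> 2 * P * (1/2) ^ n / 2 * weight t" for n
    unfolding picard_Suc
    by (rule impulsive_op_contraction[where B = "2 * P"])
       (use t P picard_bound[where p=p, OF p] impulsive_path_bound[where p=p, OF p]
          impulsive_path_rate[where p=p, OF p] in \<open>auto simp: abs_minus_commute\<close>)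
  have "(\<lambda>n. 2 * P * (1/2) ^ n / 2 * weight t) \<longlonglongrightarrow> 2 * P * 0 / 2 * weight t"
    by (intro tendsto_intros LIMSEQ_power_zero) auto
  then have lim0: "(\<lambda>n. 2 * P * (1/2) ^ n / 2 * weight t) \<longlonglongrightarrow> 0" by simp
  have "(\<lambda>n. picard A \<gamma> D p (Suc n) i t - impulsive_op A \<gamma> D p ?L i t) \<longlonglongrightarrow> 0"
    by (rule Lim_null_comparison[OF _ lim0]) (simp only: real_norm_def b eventually_True)
  then have "(\<lambda>n. picard A \<gamma> D p (Suc n) i t) \<longlonglongrightarrow> impulsive_op A \<gamma> D p ?L i t"
    by (rule LIM_zero_cancel)
  moreover have "(\<lambda>n. picard A \<gamma> D p (Suc n) i t) \<longlonglongrightarrow> ?L i t"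
    by (rule LIMSEQ_Suc) (rule picard_tendsto[OF t])
  ultimately show ?thesis using LIMSEQ_unique by blast
qed

end

section \<open>Step paths and their jump measures\<close>

text \<open>\<open>Q\<close> is any finite set that contains the times of change, possibly with
  further points. The half-open \<open>{u<..v}\<close> builds in right continuity. Expressed through
  equality of values, the property passes at once to functions of the path, such as compound
  sums.\<close>

definition step_on :: "real set \<Rightarrow> real \<Rightarrow> (real \<Rightarrow> 'b) \<Rightarrow> bool" where
  "step_on Q t x \<longleftrightarrow> finite Q \<and>
     (\<forall>u v. 0 \<le> u \<longrightarrow> u \<le> v \<longrightarrow> v \<le> t \<longrightarrow> Q \<inter> {u<..v} = {} \<longrightarrow> x u = x v)"

definition jump_times :: "(real \<Rightarrow> real) \<Rightarrow> real set" where
  "jump_times x = {s. 0 < s \<and> jump x s \<noteq> 0}"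

lemma step_on_eq: "step_on Q t x \<Longrightarrow> 0 \<le> u \<Longrightarrow> u \<le> v \<Longrightarrow> v \<le> t \<Longrightarrow> Q \<inter> {u<..v} = {} \<Longrightarrow> x u = x v"
  unfolding step_on_def by blast

lemma step_on_comp: "step_on Q t x \<Longrightarrow> (\<And>u v. x u = x v \<Longrightarrow> y u = y v) \<Longrightarrow> step_on Q t y"
  unfolding step_on_def by blast

lemma step_on_mono: "step_on Q t x \<Longrightarrow> s \<le> t \<Longrightarrow> step_on Q s x"
  unfolding step_on_def by (meson order.trans)

lemma step_on_left_lim:
  assumes x: "step_on Q t x" and "0 \<le> u" "u < s" "s \<le> t" and Q: "Q \<inter> {u<..<s} = {}"
  shows "left_lim x s = x u"
  unfolding left_lim_def
proof (rule tendsto_Lim)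
  have "\<forall>\<^sub>F v in at_left s. x v = x u"
    using eventually_at_left_real[OF \<open>u < s\<close>]
  proof eventually_elim
    case (elim v)
    then have "Q \<inter> {u<..v} = {}" using Q by force
    then show ?case using step_on_eq[OF x, of u v] assms elim by auto
  qed
  then show "(x \<longlongrightarrow> x u) (at_left s)" by (rule tendsto_eventually)
qed simp

lemma step_on_jump_times:
  assumes x: "step_on Q t x"
  shows "jump_times x \<inter> {0<..t} \<subseteq> Q"
proof
  fix s assume s: "s \<in> jump_times x \<inter> {0<..t}"
  show "s \<in> Q"
  proof (rule ccontr)
    assume "s \<notin> Q"
    have "finite (Q \<inter> {0<..<t + 1})" using x by (auto simp: step_on_def)
    from finite_gap_left[OF this, of s] s obtain e where e: "0 \<le> e" "e < s" "Q \<inter> {e<..<s} = {}" by auto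
    have "left_lim x s = x e" using step_on_left_lim[OF x e(1,2) _ e(3)] s by auto
    moreover have "Q \<inter> {e<..s} = {}"
    proof -
      have "y < s" if "y \<in> Q" "y \<le> s" for y using that \<open>s \<notin> Q\<close> by (cases "y = s") auto
      then show ?thesis using e(3) by auto
    qed
    then have "x e = x s" using step_on_eq[OF x e(1)] e s by auto
    ultimately show False using s by (simp add: jump_times_def jump_def)
  qed
qed

lemma step_on_finite_jump_times:
  assumes "step_on Q t x"
  shows "finite (jump_times x \<inter> {0<..t})"
  by (rule finite_subset[OF step_on_jump_times[OF assms]]) (use assms in \<open>simp add: step_on_def\<close>)

text \<open>\<open>Q\<close> collects the first times \<tau> k at which level \<open>k\<close> is
  reached, for \<open>k\<close> from 1 to \<open>N t\<close>. A change between \<open>u\<close> and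
  \<open>v\<close> crosses the level \<open>N u\<close> + 1, and right continuity on a discrete
  space keeps \<open>N\<close> constant just after \<open>u\<close>, so that level is reached
  strictly after \<open>u\<close>. The cardinality bound later gives finite Levy measures.\<close>

lemma nat_path_step_on:
  fixes N :: "real \<Rightarrow> nat"
  assumes mono: "mono_on {0..} N" and cad: "cadlag N" and t: "0 \<le> t"
  obtains Q where "step_on Q t N" "card Q \<le> N t"
proof -
  define \<tau> where "\<tau> k = Inf {s. 0 \<le> s \<and> k \<le> N s}" for k
  define Q where "Q = \<tau> ` {1..N t}"
  have "card Q \<le> card {1..N t}" unfolding Q_def by (rule card_image_le) simp
  then have "card Q \<le> N t" by simp
  moreover have "step_on Q t N"
    unfolding step_on_def
  proof (intro conjI allI impI)
    show "finite Q" unfolding Q_def by simp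
    fix u v assume uv: "0 \<le> u" "u \<le> v" "v \<le> t" and Q: "Q \<inter> {u<..v} = {}"
    have le: "N u \<le> N v" "N v \<le> N t" using uv by (auto intro: mono_onD[OF mono])
    show "N u = N v"
    proof (rule ccontr)
      assume "N u \<noteq> N v"
      then have lt: "N u < N v" using le by simp
      define k where "k = Suc (N u)"
      let ?S = "{s. 0 \<le> s \<and> k \<le> N s}"
      have bdd: "bdd_below ?S" by (rule bdd_belowI[of _ 0]) auto
      have v: "v \<in> ?S" using lt uv unfolding k_def by auto
      have "(N \<longlongrightarrow> N u) (at_right u)" using cad uv by (simp add: cadlag_def)
      then have "\<forall>\<^sub>F s in at_right u. N s = N u" by (simp add: tendsto_discrete)
      then obtain w where w: "u < w" "\<And>s. u < s \<Longrightarrow> s < w \<Longrightarrow> N s = N u"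
        by (auto simp: eventually_at_right_field)
      have "w \<le> \<tau> k" unfolding \<tau>_def
      proof (rule cInf_greatest)
        fix s assume s: "s \<in> ?S"
        show "w \<le> s"
        proof (rule ccontr)
          assume "\<not> w \<le> s"
          then have "N s \<le> N u" using w(2)[of s] s uv by (cases "u < s") (auto intro: mono_onD[OF mono])
          with s show False by (simp add: k_def)
        qed
      qed (use v in blast)
      moreover have "\<tau> k \<le> v" unfolding \<tau>_def using v bdd by (rule cInf_lower)
      moreover have "\<tau> k \<in> Q" unfolding Q_def using lt le by (auto simp: k_def)
      ultimately show False using Q w(1) by force
    qed
  qed
  ultimately show ?thesis using that by blast
qed

section \<open>Counting jumps on grids and measurability of sums over jump times\<close>

lemma grid_cell_iff:
  fixes c q :: real
  assumes "0 < c" "0 < n"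
  shows "c * real k / real n < q \<and> q \<le> c * real (Suc k) / real n \<longleftrightarrow> \<lceil>q * real n / c\<rceil> = int k + 1"
  unfolding ceiling_eq_iff using assms by (auto simp: field_simps)

lemma finite_separated:
  fixes Q :: "real set"
  assumes "finite Q"
  obtains d where "0 < d" "\<And>p q. p \<in> Q \<Longrightarrow> q \<in> Q \<Longrightarrow> \<bar>p - q\<bar> < d \<Longrightarrow> p = q"
proof -
  let ?X = "insert 1 ((\<lambda>(p, q). \<bar>p - q\<bar>) ` (Q \<times> Q - Id))"
  have f: "finite ?X" using assms by auto
  have "0 < Min ?X" using f by (subst Min_gr_iff) auto
  moreover have "p = q" if "p \<in> Q" "q \<in> Q" "\<bar>p - q\<bar> < Min ?X" for p q
  proof (rule ccontr)
    assume "p \<noteq> q"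
    then have "\<bar>p - q\<bar> \<in> ?X" using that by (auto intro!: image_eqI[of _ _ "(p, q)"])
    then have "Min ?X \<le> \<bar>p - q\<bar>" using f by simp
    with that show False by simp
  qed
  ultimately show ?thesis using that by blast
qed

text \<open>As soon as the grid separates the points of \<open>Q\<close>, every cell sees at most one jump, so counting
  grid increments is exact and not only a limit. This makes the jump counts measurable.\<close>

lemma step_on_count_grid:
  assumes x: "step_on Q c x" and c: "0 < c"
  shows "\<forall>\<^sub>F n in sequentially.
    card {k. k < n \<and> x (c * real (Suc k) / real n) - x (c * real k / real n) \<in> U - {0}} =
    card {s \<in> jump_times x \<inter> {0<..c}. jump x s \<in> U}"
proof -
  have finQ: "finite Q" using x by (simp add: step_on_def)
  obtain d where d: "0 < d" "\<And>p q. p \<in> Q \<Longrightarrow> q \<in> Q \<Longrightarrow> \<bar>p - q\<bar> < d \<Longrightarrow> p = q"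
    by (rule finite_separated[OF finQ]) metis
  obtain m :: nat where m: "c / d < real m" using reals_Archimedean2 by blast
  show ?thesis
    using eventually_ge_at_top[of m]
  proof eventually_elim
    case (elim n)
    then have "c / d < real n" using m by simp
    moreover from this have n: "0 < n" using c d by (cases n) (auto simp: divide_less_0_iff)
    ultimately have cn: "c / real n < d" using d by (simp add: field_simps)
    let ?l = "\<lambda>k. c * real k / real n" and ?r = "\<lambda>k. c * real (Suc k) / real n"
    have len: "?r k - ?l k = c / real n" for k by (simp add: field_simps diff_divide_distrib add_divide_distrib)
    have lr: "0 \<le> ?l k" "?l k < ?r k" for k using c n by (auto simp: field_simps)
    have rc: "?r k \<le> c" if "k < n" for k
    proof -
      have "real (Suc k) \<le> real n" using that by (simp del: of_nat_Suc)
      then show ?thesis using c n by (simp add: divide_le_eq del: of_nat_Suc)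
    qed
    have one: "x (?r k) - x (?l k) = jump x q" if q: "q \<in> Q" "?l k < q" "q \<le> ?r k" "k < n" for k q
    proof -
      have uniq: "p = q" if "p \<in> Q" "?l k < p" "p \<le> ?r k" for p
        using d(2)[of p q] that q len[of k] cn by auto
      have "left_lim x q = x (?l k)"
      proof (rule step_on_left_lim[OF x lr(1) q(2)])
        show "q \<le> c" using q rc[of k] by linarith
        show "Q \<inter> {?l k<..<q} = {}"
        proof (rule ccontr)
          assume "Q \<inter> {?l k<..<q} \<noteq> {}"
          then obtain p where "p \<in> Q" "?l k < p" "p < q" by auto
          with uniq[of p] q show False by auto
        qed
      qed
      moreover have "x q = x (?r k)"
      proof (rule step_on_eq[OF x])
        show "0 \<le> q" using q lr[of k] by linarith
        show "Q \<inter> {q<..?r k} = {}"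
        proof (rule ccontr)
          assume "Q \<inter> {q<..?r k} \<noteq> {}"
          then obtain p where "p \<in> Q" "q < p" "p \<le> ?r k" by auto
          with uniq[of p] q show False by auto
        qed
      qed (use q rc[of k] in auto)
      ultimately show ?thesis by (simp add: jump_def)
    qed
    have cell: "\<exists>q\<in>Q. ?l k < q \<and> q \<le> ?r k" if "k < n" "x (?r k) - x (?l k) \<noteq> 0" for k
    proof (rule ccontr)
      assume "\<not> (\<exists>q\<in>Q. ?l k < q \<and> q \<le> ?r k)"
      then have "Q \<inter> {?l k<..?r k} = {}" by auto
      then have "x (?l k) = x (?r k)" using step_on_eq[OF x] lr[of k] rc[OF that(1)] by auto
      with that show False by simp
    qed
    \<comment> \<open>Cells are open on the left and closed on the right, so time 0 lies in none of
      them and the cell of \<open>q\<close> > 0 has the ceiling minus one as its index.\<close>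
    define kk where "kk q = nat (\<lceil>q * real n / c\<rceil> - 1)" for q
    have kk: "?l (kk q) < q" "q \<le> ?r (kk q)" "kk q < n" if "0 < q" "q \<le> c" for q
    proof -
      have pos: "0 < q * real n / c" using that c n by simp
      have "q * real n / c \<le> of_int (int n)" using that c n by (simp add: field_simps)
      then have "\<lceil>q * real n / c\<rceil> \<le> int n" by (rule ceiling_le)
      moreover have "0 < \<lceil>q * real n / c\<rceil>" using pos by simp
      ultimately have "\<lceil>q * real n / c\<rceil> = int (kk q) + 1" "kk q < n" unfolding kk_def by linarith+
      then show "?l (kk q) < q" "q \<le> ?r (kk q)" "kk q < n" using grid_cell_iff[OF c n, of "kk q" q] by auto
    qed
    have kkI: "kk q = k" if "?l k < q" "q \<le> ?r k" for q k
      using grid_cell_iff[OF c n, of k q] that unfolding kk_def by auto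
    let ?A = "{s \<in> jump_times x \<inter> {0<..c}. jump x s \<in> U}"
    let ?B = "{k. k < n \<and> x (?r k) - x (?l k) \<in> U - {0}}"
    have AQ: "?A \<subseteq> Q" using step_on_jump_times[OF x] by auto
    \<comment> \<open>Jump times correspond to the cells containing them. Points of \<open>Q\<close>
      without a jump give a zero increment and are discarded by \<open>U - {0}\<close>.\<close>
    have "bij_betw kk ?A ?B"
      unfolding bij_betw_def
    proof (intro conjI inj_onI equalityI subsetI)
      fix p q assume pq: "p \<in> ?A" "q \<in> ?A" "kk p = kk q"
      then have "\<bar>p - q\<bar> < d"
        using kk[of p] kk[of q] len[of "kk p"] cn by auto
      moreover have "p \<in> Q" "q \<in> Q" using pq AQ by blast+
      ultimately show "p = q" by (rule d(2)[rotated 2])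
    next
      fix k assume "k \<in> kk ` ?A"
      then obtain s where s: "s \<in> ?A" "k = kk s" by auto
      have "x (?r k) - x (?l k) = jump x s"
        unfolding s(2) using s(1) AQ kk[of s] by (intro one) auto
      then show "k \<in> ?B" using s kk[of s] by (auto simp: jump_times_def)
    next
      fix k assume k: "k \<in> ?B"
      then obtain q where q: "q \<in> Q" "?l k < q" "q \<le> ?r k" using cell[of k] by auto
      have "x (?r k) - x (?l k) = jump x q" using k q by (intro one) auto
      then have "q \<in> ?A" using k q lr[of k] rc[of k] by (auto simp: jump_times_def)
      then show "k \<in> kk ` ?A" using kkI[OF q(2,3)] by blast
    qed
    then show ?case by (rule bij_betw_same_card[symmetric])
  qed
qed

text \<open>Pushing the kernel forward along y \<mapsto> (x, y) moves the parameter from the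
  integrand into the measure; then one fixed function is integrated against a measurable
  kernel.\<close>

lemma integral_measurable_subprob_algebra_param:
  fixes f :: "'a \<Rightarrow> 'c \<Rightarrow> real"
  assumes f [measurable]: "(\<lambda>(x, y). f x y) \<in> borel_measurable (M \<Otimes>\<^sub>M N)"
    and L [measurable]: "L \<in> measurable M (subprob_algebra N)"
  shows "(\<lambda>x. integral\<^sup>L (L x) (f x)) \<in> borel_measurable M"
proof -
  note integral_measurable_subprob_algebra [measurable]
  note measurable_distr2 [measurable]
  have "(\<lambda>x. integral\<^sup>L (distr (L x) (M \<Otimes>\<^sub>M N) (\<lambda>y. (x, y))) (\<lambda>(x, y). f x y)) \<in> borel_measurable M"
    by measurable
  then show ?thesis
    by (rule measurable_cong[THEN iffD1, rotated]) (simp add: integral_distr)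
qed

context
  fixes G :: "'w measure" and X :: "real \<Rightarrow> 'w \<Rightarrow> real" and T :: real
  assumes X [measurable]: "\<And>s. 0 \<le> s \<Longrightarrow> s \<le> T \<Longrightarrow> X s \<in> borel_measurable G"
    and step: "\<And>\<omega>. \<omega> \<in> space G \<Longrightarrow> \<exists>Q. step_on Q T (\<lambda>s. X s \<omega>)"
begin

lemma measurable_jump_count:
  assumes U [measurable]: "U \<in> sets borel" and cT: "c \<le> T"
  shows "(\<lambda>\<omega>. real (card {s \<in> jump_times (\<lambda>s. X s \<omega>) \<inter> {0<..c}. jump (\<lambda>s. X s \<omega>) s \<in> U})) \<in> borel_measurable G"
proof (cases "0 < c")
  case True
  show ?thesis
  proof (rule borel_measurable_LIMSEQ_metric)
    show "(\<lambda>\<omega>. \<Sum>k<n. indicator (U - {0}) (X (c * real (Suc k) / real n) \<omega> - X (c * real k / real n) \<omega>) :: real)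
        \<in> borel_measurable G" for n
    proof (rule borel_measurable_sum)
      fix k assume k: "k \<in> {..<n}"
      have "real (Suc k) \<le> real n" "real k \<le> real n" using k by (auto simp del: of_nat_Suc)
      then have "c * real (Suc k) / real n \<le> c" "c * real k / real n \<le> c" 
        using True k by (auto simp: divide_le_eq simp del: of_nat_Suc)
      then have [measurable]: "X (c * real (Suc k) / real n) \<in> borel_measurable G"
         "X (c * real k / real n) \<in> borel_measurable G"
        using True cT by (auto intro!: X simp del: of_nat_Suc)
      show "(\<lambda>\<omega>. indicator (U - {0}) (X (c * real (Suc k) / real n) \<omega> - X (c * real k / real n) \<omega>) :: real) \<in> borel_measurable G"
        by measurable
    qed
    fix \<omega> assume "\<omega> \<in> space G"
    then obtain Q where Q: "step_on Q T (\<lambda>s. X s \<omega>)" using step by blast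
    show "(\<lambda>n. \<Sum>k<n. indicator (U - {0}) (X (c * real (Suc k) / real n) \<omega> - X (c * real k / real n) \<omega>))
       \<longlonglongrightarrow> real (card {s \<in> jump_times (\<lambda>s. X s \<omega>) \<inter> {0<..c}. jump (\<lambda>s. X s \<omega>) s \<in> U})"
    proof (rule tendsto_eventually)
      show "\<forall>\<^sub>F n in sequentially. (\<Sum>k<n. indicator (U - {0}) (X (c * real (Suc k) / real n) \<omega> - X (c * real k / real n) \<omega>))
        = real (card {s \<in> jump_times (\<lambda>s. X s \<omega>) \<inter> {0<..c}. jump (\<lambda>s. X s \<omega>) s \<in> U})"
        using step_on_count_grid[OF step_on_mono[OF Q cT] True, of U]
      proof eventually_elim
        case (elim n)
        show ?case unfolding elim[symmetric]
          by (simp add: indicator_def of_bool_def sum.If_cases lessThan_def Int_def)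
      qed
    qed
  qed
next
  case False
  then have "{0<..c} = {}" by auto
  then show ?thesis by simp
qed

text \<open>The sum is an integral against the random point measure of pairs (time, jump). Divided
  by 1 + the number of points, which is never zero, this becomes a kernel. Its measurability is
  tested on the intersection-stable generator of sets \<open>{..a} \<times> b\<close>, whose masses
  are ratios of jump counts. Multiplying by the measurable normalization recovers the sum.\<close>

lemma measurable_jump_sum:
  assumes H [measurable]: "(\<lambda>(\<omega>, p). H \<omega> p) \<in> borel_measurable (G \<Otimes>\<^sub>M (borel :: (real \<times> real) measure))"
  shows "(\<lambda>\<omega>. \<Sum>s\<in>jump_times (\<lambda>s. X s \<omega>) \<inter> {0<..T}. H \<omega> (s, jump (\<lambda>s. X s \<omega>) s) :: real) \<in> borel_measurable G"
proof -
  define Q where "Q \<omega> = jump_times (\<lambda>s. X s \<omega>) \<inter> {0<..T}" for \<omega>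
  define J where "J \<omega> s = jump (\<lambda>s. X s \<omega>) s" for \<omega> s
  \<comment> \<open>normalized, because the library's kernels are subprobability measures\<close>
  define \<kappa> where "\<kappa> \<omega> = distr (density (count_space (Q \<omega>)) (\<lambda>_. ennreal (1 / (1 + real (card (Q \<omega>))))))
      (borel :: (real \<times> real) measure) (\<lambda>s. (s, J \<omega> s))" for \<omega>
  have finQ: "finite (Q \<omega>)" if "\<omega> \<in> space G" for \<omega>
    using step[OF that] step_on_finite_jump_times unfolding Q_def by blast
  have card_meas: "(\<lambda>\<omega>. real (card {s \<in> Q \<omega>. s \<le> c \<and> J \<omega> s \<in> U})) \<in> borel_measurable G"
    if U: "U \<in> sets borel" for c U
  proof -
    have "{s \<in> Q \<omega>. s \<le> c \<and> J \<omega> s \<in> U} =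
        {s \<in> jump_times (\<lambda>s. X s \<omega>) \<inter> {0<..min c T}. jump (\<lambda>s. X s \<omega>) s \<in> U}" for \<omega>
      unfolding Q_def J_def by auto
    then show ?thesis using measurable_jump_count[OF U, of "min c T"] by simp
  qed
  have cardQ: "(\<lambda>\<omega>. real (card (Q \<omega>))) \<in> borel_measurable G"
  proof -
    have "{s \<in> Q \<omega>. s \<le> T \<and> J \<omega> s \<in> UNIV} = Q \<omega>" for \<omega> unfolding Q_def by auto
    then show ?thesis using card_meas[of UNIV T] by simp
  qed
  note cardQ [measurable]
  have em: "emeasure (\<kappa> \<omega>) B = ennreal (real (card {s \<in> Q \<omega>. (s, J \<omega> s) \<in> B}) / (1 + real (card (Q \<omega>))))"
    if \<omega>: "\<omega> \<in> space G" and B: "B \<in> sets borel" for \<omega> B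
  proof -
    let ?C = "{s \<in> Q \<omega>. (s, J \<omega> s) \<in> B}"
    have "emeasure (\<kappa> \<omega>) B = emeasure (density (count_space (Q \<omega>)) (\<lambda>_. ennreal (1 / (1 + real (card (Q \<omega>)))))) ?C"
      unfolding \<kappa>_def using B by (subst emeasure_distr) (auto intro!: arg_cong2[where f=emeasure])
    also have "\<dots> = ennreal (1 / (1 + real (card (Q \<omega>)))) * emeasure (count_space (Q \<omega>)) ?C"
      by (subst emeasure_density_const) auto
    also have "emeasure (count_space (Q \<omega>)) ?C = ennreal (real (card ?C))"
      using finQ[OF \<omega>] by (subst emeasure_count_space_finite) (auto simp: ennreal_of_nat_eq_real_of_nat)
    finally show ?thesis by (simp add: ennreal_mult[symmetric])
  qed
  have sets\<kappa>: "sets (\<kappa> \<omega>) = sets borel" "space (\<kappa> \<omega>) = UNIV" for \<omega> unfolding \<kappa>_def by simp_all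
  let ?E = "{a \<times> b |a b. a \<in> range (\<lambda>a. {..a::real}) \<and> b \<in> sets (borel :: real measure)}"
  have "\<kappa> \<in> measurable G (subprob_algebra borel)"
  proof (rule measurable_subprob_algebra_generated[where G = ?E and \<Omega> = UNIV])
    have "sets (borel :: (real \<times> real) measure) = sets ((borel :: real measure) \<Otimes>\<^sub>M (borel :: real measure))"
      unfolding borel_prod ..
    also have "\<dots> = sets (sigma (space borel \<times> space borel) ?E)"
    proof (rule sets_pair_eq)
      show "sets (borel :: real measure) = sigma_sets (space borel) (range (\<lambda>a. {..a}))"
        by (subst borel_eq_atMost) simp
      show "(range (\<lambda>n. {..real n}) :: real set set) \<subseteq> range (\<lambda>a. {..a})" by auto
      show "\<Union> (range (\<lambda>n. {..real n})) = space borel"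
        using real_arch_simple by auto
      show "sets (borel :: real measure) = sigma_sets (space borel) (sets borel)"
        using sets.sigma_sets_eq[of "borel :: real measure"] by simp
      show "countable {UNIV :: real set}" "{UNIV :: real set} \<subseteq> sets borel" "\<Union> {UNIV} = space (borel :: real measure)"
        by auto
    qed (auto simp: sets.space_closed[of "borel :: real measure", simplified])
    finally show "sets (borel :: (real \<times> real) measure) = sigma_sets UNIV ?E"
      by simp
    show "Int_stable ?E"
      unfolding Int_stable_def
    proof (intro ballI)
      fix A B assume "A \<in> ?E" "B \<in> ?E"
      then obtain a b a' b' where ab: "A = {..a} \<times> b" "B = {..a'} \<times> b'" "b \<in> sets borel" "b' \<in> sets borel" by auto
      then have "A \<inter> B = {..min a a'} \<times> (b \<inter> b')" by auto
      then show "A \<inter> B \<in> ?E" using ab by blast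
    qed
    show "subprob_space (\<kappa> \<omega>)" if \<omega>: "\<omega> \<in> space G" for \<omega>
    proof
      have "card {s \<in> Q \<omega>. (s, J \<omega> s) \<in> UNIV} \<le> card (Q \<omega>)" by simp
      then show "emeasure (\<kappa> \<omega>) (space (\<kappa> \<omega>)) \<le> 1"
        unfolding sets\<kappa> using em[OF \<omega>, of UNIV] by simp
    qed (simp add: sets\<kappa>)
    show "(\<lambda>\<omega>. emeasure (\<kappa> \<omega>) B) \<in> borel_measurable G" if "B \<in> ?E" for B
    proof -
      from that obtain a b where B: "B = {..a} \<times> b" "b \<in> sets borel" by auto
      have "B \<in> sets (borel \<Otimes>\<^sub>M borel)" unfolding B(1) using B(2) by (intro pair_measureI) auto
      then have "B \<in> sets borel" unfolding borel_prod .
      note em = em[OF _ this]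
      note card_meas[OF B(2), of a, measurable]
      have "(\<lambda>\<omega>. ennreal (real (card {s \<in> Q \<omega>. s \<le> a \<and> J \<omega> s \<in> b}) / (1 + real (card (Q \<omega>))))) \<in> borel_measurable G"
        by measurable
      then show ?thesis by (subst measurable_cong[OF em]) (simp_all add: B)
    qed
    have "(\<lambda>\<omega>. ennreal (real (card (Q \<omega>)) / (1 + real (card (Q \<omega>))))) \<in> borel_measurable G"
      by measurable
    then show "(\<lambda>\<omega>. emeasure (\<kappa> \<omega>) UNIV) \<in> borel_measurable G"
      by (subst measurable_cong[OF em]) simp_all
  qed (auto simp: sets\<kappa>)
  then have m: "(\<lambda>\<omega>. integral\<^sup>L (\<kappa> \<omega>) (H \<omega>)) \<in> borel_measurable G"
    by (rule integral_measurable_subprob_algebra_param[OF H])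
  have "(\<Sum>s\<in>Q \<omega>. H \<omega> (s, J \<omega> s)) = (1 + real (card (Q \<omega>))) * integral\<^sup>L (\<kappa> \<omega>) (H \<omega>)" if \<omega>: "\<omega> \<in> space G" for \<omega>
  proof -
    have [measurable]: "H \<omega> \<in> borel_measurable borel" using measurable_Pair2[OF H \<omega>] by simp
    have "integral\<^sup>L (\<kappa> \<omega>) (H \<omega>) =
        (\<integral>s. (1 / (1 + real (card (Q \<omega>)))) *\<^sub>R H \<omega> (s, J \<omega> s) \<partial>count_space (Q \<omega>))"
      unfolding \<kappa>_def by (subst integral_distr) (auto simp: integral_density)
    also have "\<dots> = (\<Sum>s\<in>Q \<omega>. (1 / (1 + real (card (Q \<omega>)))) *\<^sub>R H \<omega> (s, J \<omega> s))"
      by (rule lebesgue_integral_count_space_finite) (rule finQ[OF \<omega>])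
    finally have *: "integral\<^sup>L (\<kappa> \<omega>) (H \<omega>) = (1 / (1 + real (card (Q \<omega>)))) * (\<Sum>s\<in>Q \<omega>. H \<omega> (s, J \<omega> s))"
      by (simp add: sum_distrib_left)
    have "1 + real (card (Q \<omega>)) \<noteq> 0" by (smt (verit) of_nat_0_le_iff)
    then show ?thesis unfolding * by simp
  qed
  then have "(\<lambda>\<omega>. \<Sum>s\<in>Q \<omega>. H \<omega> (s, J \<omega> s)) \<in> borel_measurable G \<longleftrightarrow>
     (\<lambda>\<omega>. (1 + real (card (Q \<omega>))) * integral\<^sup>L (\<kappa> \<omega>) (H \<omega>)) \<in> borel_measurable G"
    by (rule measurable_cong)
  also have "\<dots>" using m by measurable
  finally show ?thesis unfolding Q_def J_def .
qed

end

section \<open>Integration against the jump measure of a step path\<close>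

lemma
  assumes x: "step_on Q t x" and h: "h \<in> borel_measurable borel"
    and supp: "\<And>s z. s \<notin> {0<..t} \<Longrightarrow> h (s, z) = 0"
  shows integrable_jump_measure: "integrable (jump_measure x) (h :: real \<times> real \<Rightarrow> real)"
    and integral_jump_measure: "integral\<^sup>L (jump_measure x) h = (\<Sum>s\<in>jump_times x \<inter> {0<..t}. h (s, jump x s))"
proof -
  let ?F = "jump_times x \<inter> {0<..t}"
  have fin: "finite ?F" by (rule step_on_finite_jump_times[OF x])
  have D: "{s. 0 < s \<and> jump x s \<noteq> 0} = jump_times x" by (simp add: jump_times_def)
  \<comment> \<open>The counting measure lives on all jump times, over which nothing is known after
    \<open>t\<close>; the support condition on \<open>h\<close> reduces it to a finite combination
    of point indicators.\<close>
  have eq: "h (s, jump x s) = (\<Sum>a\<in>?F. indicator {a} s *\<^sub>R h (a, jump x a))" if "s \<in> jump_times x" for s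
  proof (cases "s \<in> ?F")
    case True
    have "(\<Sum>a\<in>?F. indicator {a} s *\<^sub>R h (a, jump x a)) = (\<Sum>a\<in>?F. if s = a then h (a, jump x a) else 0)"
      by (intro sum.cong) (auto simp: indicator_def)
    then show ?thesis using fin True by simp
  next
    case False
    then have "s \<notin> {0<..t}" using that by auto
    then have "h (s, jump x s) = 0" by (rule supp)
    moreover have "(\<Sum>a\<in>?F. indicator {a} s *\<^sub>R h (a, jump x a)) = 0" using False by (intro sum.neutral) (auto simp: indicator_def)
    ultimately show ?thesis by simp
  qed
  have "integrable (count_space (jump_times x)) (\<lambda>s. \<Sum>a\<in>?F. indicator {a} s *\<^sub>R h (a, jump x a))"
    by (intro Bochner_Integration.integrable_sum integrable_scaleR_left impI integrable_real_indicator) auto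
  moreover have "integrable (count_space (jump_times x)) (\<lambda>s. h (s, jump x s)) \<longleftrightarrow>
      integrable (count_space (jump_times x)) (\<lambda>s. \<Sum>a\<in>?F. indicator {a} s *\<^sub>R h (a, jump x a))"
    by (rule Bochner_Integration.integrable_cong[OF refl]) (rule eq, simp)
  ultimately have "integrable (count_space (jump_times x)) (\<lambda>s. h (s, jump x s))" by blast
  then show "integrable (jump_measure x) h"
    unfolding jump_measure_def D by (subst integrable_distr_eq) (use h in auto)
  have "s \<in> {0<..t}" if "h (s, z) \<noteq> 0" for s z using supp[of s z] that by blast
  then have sub: "{a \<in> jump_times x. h (a, jump x a) \<noteq> 0} \<subseteq> ?F" by blast
  have "integral\<^sup>L (jump_measure x) h = (\<integral>s. h (s, jump x s) \<partial>count_space (jump_times x))"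
    unfolding jump_measure_def D by (subst integral_distr) (use h in auto)
  also have "\<dots> = (\<Sum>s\<in>?F. h (s, jump x s))"
    by (subst lebesgue_integral_count_space_finite_support[OF finite_subset[OF sub fin]])
       (use sub in \<open>auto intro!: sum.mono_neutral_cong_left fin\<close>)
  finally show "integral\<^sup>L (jump_measure x) h = (\<Sum>s\<in>?F. h (s, jump x s))" .
qed

section \<open>Compound Poisson processes\<close>

text \<open>The crude bound n \<le> 2^n turns the series into the exponential series at 2l.\<close>

lemma poisson_pmf_mean_finite:
  assumes "0 < l"
  shows "(\<integral>\<^sup>+ n. of_nat n \<partial>measure_pmf (poisson_pmf l)) < \<infinity>"
proof -
  have "(\<integral>\<^sup>+ n. of_nat n \<partial>measure_pmf (poisson_pmf l)) =
      (\<Sum>n. ennreal (l ^ n / fact n * exp (- l)) * of_nat n)"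
    using assms by (simp add: nn_integral_measure_pmf nn_integral_count_space_nat)
  also have "\<dots> \<le> (\<Sum>n. ennreal ((2 * l) ^ n /\<^sub>R fact n))"
  proof (intro suminf_le allI)
    fix n :: nat
    have "l ^ n / fact n * exp (- l) * real n \<le> l ^ n / fact n * 1 * 2 ^ n"
      using assms by (intro mult_mono) (auto intro: less_imp_le of_nat_less_two_power)
    also have "\<dots> = (2 * l) ^ n /\<^sub>R fact n"
      by (simp add: field_simps power_mult_distrib)
    finally show "ennreal (l ^ n / fact n * exp (- l)) * of_nat n \<le> ennreal ((2 * l) ^ n /\<^sub>R fact n)"
      using assms by (simp add: ennreal_of_nat_eq_real_of_nat ennreal_mult'[symmetric] ennreal_leI)
  qed auto
  also have "\<dots> = ennreal (exp (2 * l))"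
    using assms by (intro suminf_ennreal_eq exp_converges) auto
  finally show ?thesis by (simp add: le_less_trans)
qed

lemma poisson_process_step_on:
  assumes "poisson_process M r N" "\<omega> \<in> space M" "0 \<le> t"
  obtains Q where "step_on Q t (\<lambda>s. N s \<omega>)" "card Q \<le> N t \<omega>"
  using assms nat_path_step_on[of "\<lambda>s. N s \<omega>" t] unfolding poisson_process_def by blast

lemma compound_step_on:
  "step_on Q t (\<lambda>s. N s \<omega>) \<Longrightarrow> step_on Q t (\<lambda>s. compound N Y s \<omega>)"
  by (erule step_on_comp) (simp add: compound_def)

text \<open>\<open>Z\<close> can jump only where \<open>N\<close> changes, so the expected number of
  jumps up to time 1 is at most the mean of \<open>N 1\<close>, a Poisson variable.\<close>

lemma
  assumes "poisson_process M r N" and Z: "Z = compound N Y"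
  shows finite_measure_levy: "finite_measure (levy_measure M Z)"
    and sets_levy_measure: "sets (levy_measure M Z) = sets borel"
proof -
  note N = assms(1)[unfolded poisson_process_def]
  show "sets (levy_measure M Z) = sets borel" unfolding levy_measure_def
    by (simp add: sets_measure_of_conv sets.sigma_sets_eq[of borel, simplified])
  let ?\<mu> = "\<lambda>U. \<integral>\<^sup>+ \<omega>. emeasure (jump_measure (\<lambda>t. Z t \<omega>)) ({0..1} \<times> U) \<partial>M"
  have r: "0 < r" using N by blast
  have [measurable]: "N 1 \<in> measurable M (count_space UNIV)" using N by simp
  \<comment> \<open>\<open>measure_of\<close> returns the given set function if that is a measure
    and zero otherwise; the inequality holds in both cases.\<close>
  have "emeasure (levy_measure M Z) UNIV \<le> ?\<mu> UNIV"
    unfolding levy_measure_def emeasure_measure_of_conv by simp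
  also have "\<dots> \<le> (\<integral>\<^sup>+ \<omega>. of_nat (N 1 \<omega>) \<partial>M)"
  proof (rule nn_integral_mono)
    fix \<omega> assume \<omega>: "\<omega> \<in> space M"
    obtain Q where Q: "step_on Q 1 (\<lambda>s. N s \<omega>)" "card Q \<le> N 1 \<omega>"
      by (rule poisson_process_step_on[OF assms(1) \<omega>, of 1]) auto
    have Zs: "step_on Q 1 (\<lambda>s. Z s \<omega>)" unfolding Z by (rule compound_step_on[where N=N and \<omega>=\<omega>, OF Q(1)])
    have borel_UNIV: "UNIV \<in> sets (borel :: real measure)" by simp
    let ?F = "jump_times (\<lambda>s. Z s \<omega>) \<inter> {0<..1}"
    have eq: "{s. 0 < s \<and> s \<le> 1 \<and> jump (\<lambda>t. Z t \<omega>) s \<noteq> 0 \<and> jump (\<lambda>t. Z t \<omega>) s \<in> UNIV} = ?F"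
      by (auto simp: jump_times_def)
    have "card ?F \<le> card Q"
      using Zs by (intro card_mono step_on_jump_times) (auto simp: step_on_def)
    then have "of_nat (card ?F) \<le> (of_nat (N 1 \<omega>) :: ennreal)" using Q(2) by (intro of_nat_mono) simp
    moreover have "emeasure (jump_measure (\<lambda>t. Z t \<omega>)) ({0..1} \<times> UNIV) = of_nat (card ?F)"
      unfolding emeasure_jump_measure[OF borel_UNIV] eq
      using step_on_finite_jump_times[OF Zs] by (subst emeasure_count_space_finite) auto
    ultimately show "emeasure (jump_measure (\<lambda>t. Z t \<omega>)) ({0..1} \<times> UNIV) \<le> of_nat (N 1 \<omega>)"
      by simp
  qed
  also have "\<dots> = (\<integral>\<^sup>+ n. of_nat n \<partial>distr M (count_space UNIV) (\<lambda>\<omega>. N 1 \<omega>))"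
    by (subst nn_integral_distr) auto
  also have "distr M (count_space UNIV) (\<lambda>\<omega>. N 1 \<omega>) = distr M (count_space UNIV) (\<lambda>\<omega>. N 1 \<omega> - N 0 \<omega>)"
    using N by (intro distr_cong) auto
  also have "\<dots> = measure_pmf (poisson_pmf (r * (1 - 0)))"
    using N by (metis order_refl zero_less_one)
  also have "(\<integral>\<^sup>+ n. of_nat n \<partial>measure_pmf (poisson_pmf (r * (1 - 0)))) < \<infinity>"
    using r by (intro poisson_pmf_mean_finite) simp
  finally show "finite_measure (levy_measure M Z)"
    by (intro finite_measureI) (simp add: levy_measure_def space_measure_of_conv)
qed

section \<open>Independent Poisson processes do not jump simultaneously\<close>

definition moves_at :: "(real \<Rightarrow> 'b) \<Rightarrow> real \<Rightarrow> bool" where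
  "moves_at x s \<longleftrightarrow> (\<forall>u. 0 \<le> u \<longrightarrow> u < s \<longrightarrow> x u \<noteq> x s)"

text \<open>If \<open>N\<close> had the same value at some earlier \<open>u\<close>, monotonicity
  would make it constant from \<open>u\<close> to \<open>s\<close>, and the compound path with it,
  leaving no jump at \<open>s\<close>. Unlike a jump, \<open>moves_at\<close> is visible on a grid:
  it forces a nonzero increment over the cell containing \<open>s\<close>.\<close>

lemma compound_jump_moves_at:
  assumes "mono_on {0..} (\<lambda>s. N s \<omega>)" and "s \<in> jump_times (\<lambda>s. compound N Y s \<omega>)"
  shows "moves_at (\<lambda>s. N s \<omega>) s"
  unfolding moves_at_def
proof (intro allI impI notI)
  fix u assume u: "0 \<le> u" "u < s" and eq: "N u \<omega> = N s \<omega>"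
  have const: "N v \<omega> = N s \<omega>" if "u \<le> v" "v \<le> s" for v
    using mono_onD[OF assms(1), of u v] mono_onD[OF assms(1), of v s] that u eq by auto
  have *: "\<forall>\<^sub>F v in at_left s. compound N Y v \<omega> = compound N Y s \<omega>"
    using eventually_at_left_real[OF u(2)]
  proof eventually_elim
    case (elim v)
    then have "N v \<omega> = N s \<omega>" by (intro const) auto
    then show ?case by (simp add: compound_def)
  qed
  have "left_lim (\<lambda>s. compound N Y s \<omega>) s = compound N Y s \<omega>"
    unfolding left_lim_def by (intro tendsto_Lim tendsto_eventually *) simp
  with assms(2) show False by (simp add: jump_times_def jump_def)
qed

lemma (in prob_space) poisson_process_prob_increment:
  assumes N: "poisson_process M r N" and st: "0 \<le> s" "s < t"
  shows "prob {\<omega> \<in> space M. N s \<omega> \<noteq> N t \<omega>} \<le> r * (t - s)"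
proof -
  note N' = N[unfolded poisson_process_def]
  have r: "0 < r * (t - s)" using N' st by simp
  have [measurable]: "N s \<in> measurable M (count_space UNIV)" "N t \<in> measurable M (count_space UNIV)"
    using N' st by auto
  \<comment> \<open>Subtraction on \<open>nat\<close> truncates; monotonicity ensures that the
    increment vanishes only when the two values agree.\<close>
  have mono: "N s \<omega> \<le> N t \<omega>" if "\<omega> \<in> space M" for \<omega>
    using N' that st by (auto intro: mono_onD)
  have "{\<omega> \<in> space M. N s \<omega> \<noteq> N t \<omega>} = (\<lambda>\<omega>. N t \<omega> - N s \<omega>) -` (- {0}) \<inter> space M"
    using mono by (force intro: antisym)
  then have "prob {\<omega> \<in> space M. N s \<omega> \<noteq> N t \<omega>} =
      measure (distr M (count_space UNIV) (\<lambda>\<omega>. N t \<omega> - N s \<omega>)) (- {0})"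
    by (subst measure_distr) auto
  also have "\<dots> = measure (measure_pmf (poisson_pmf (r * (t - s)))) (- {0})"
    using N' st by metis
  also have "\<dots> = 1 - pmf (poisson_pmf (r * (t - s))) 0"
    using measure_pmf.prob_compl[of "{0}" "poisson_pmf (r * (t - s))"] 
    by (simp add: measure_pmf_single Compl_eq_Diff_UNIV)
  also have "\<dots> = 1 - exp (- (r * (t - s)))" using r by simp
  also have "\<dots> \<le> r * (t - s)" using exp_ge_add_one_self[of "- (r * (t - s))"] by simp
  finally show ?thesis .
qed

text \<open>Cut the interval up to \<open>T\<close> into n + 1 cells. A common move forces both
  processes to change over one and the same cell. By independence this has probability of order
  (T/(n + 1))^2 per cell, hence at most C/(n + 1) altogether, for every n.\<close>

lemma (in prob_space) no_common_moves:
  fixes N :: "'d \<Rightarrow> real \<Rightarrow> 'a \<Rightarrow> nat"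
  assumes N: "\<And>j. poisson_process M (r j) (N j)" and ind: "independent_processes M N" and ij: "i \<noteq> j"
  shows "AE \<omega> in M. \<forall>s>0. \<not> (moves_at (\<lambda>t. N i t \<omega>) s \<and> moves_at (\<lambda>t. N j t \<omega>) s)"
proof -
  note N' = N[unfolded poisson_process_def]
  have mono: "N k s \<omega> \<le> N k t \<omega>" if "\<omega> \<in> space M" "0 \<le> s" "s \<le> t" for k s t \<omega>
    using N'[of k] that by (auto intro: mono_onD)
  have rpos: "0 < r k" for k using N'[of k] by blast
  define E where "E k s t = {\<omega> \<in> space M. N k s \<omega> \<noteq> N k t \<omega>}" for k s t
  have E: "E k s t \<in> events" if "0 \<le> s" "s < t" for k s t
  proof -
    have [measurable]: "N k s \<in> measurable M (count_space UNIV)" "N k t \<in> measurable M (count_space UNIV)"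
      using N'[of k] that by auto
    have "E k s t = (\<Union>n. (N k s -` {n} \<inter> space M) \<inter> (N k t -` (- {n}) \<inter> space M))"
      unfolding E_def by auto
    also have "\<dots> \<in> events" by (intro sets.countable_UN sets.Int measurable_sets) auto
    finally show ?thesis .
  qed
  have indep: "prob (E i s t \<inter> E j s t) = prob (E i s t) * prob (E j s t)" if st: "0 \<le> s" "s < t" for s t
  proof -
    let ?P = "\<Pi>\<^sub>M t\<in>{0..}. count_space (UNIV :: nat set)"
    let ?X = "\<lambda>k \<omega>. \<lambda>t\<in>{0..}. N k t \<omega>"
    \<comment> \<open>Independence is given for whole paths, so the event of a change is written as
      the preimage of one set of paths in the product \<sigma>-algebra.\<close>
    define B where "B = {p \<in> space ?P. p s \<noteq> p t}"
    have [measurable]: "(\<lambda>p. p s) \<in> measurable ?P (count_space UNIV)" "(\<lambda>p. p t) \<in> measurable ?P (count_space UNIV)"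
      using st by (auto intro!: measurable_component_singleton)
    have "B \<in> sets ?P" unfolding B_def by measurable
    then have "prob (\<Inter>k\<in>{i, j}. ?X k -` B \<inter> space M) = (\<Prod>k\<in>{i, j}. prob (?X k -` B \<inter> space M))"
      using ind[unfolded independent_processes_def] by (intro indep_varsD) auto
    moreover have "?X k -` B \<inter> space M = E k s t" for k
      using st by (auto simp: B_def E_def space_PiM)
    ultimately show ?thesis using ij by simp
  qed
  have fixed: "AE \<omega> in M. \<forall>s\<in>{0<..T}. \<not> (moves_at (\<lambda>t. N i t \<omega>) s \<and> moves_at (\<lambda>t. N j t \<omega>) s)"
    if T: "0 < T" for T :: real
  proof -
    define l where "l n k = T * real k / real (Suc n)" for n k
    have lSuc: "l n (Suc k) = l n k + T / real (Suc n)" for n k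
      unfolding l_def of_nat_Suc[of k] by (simp add: distrib_left add_divide_distrib del: of_nat_Suc)
    have l: "0 \<le> l n k" "l n k < l n (Suc k)" "l n (Suc k) - l n k = T / real (Suc n)" for n k
      unfolding lSuc using T by (auto simp: l_def simp del: of_nat_Suc)
    define A where "A n = (\<Union>k<Suc n. E i (l n k) (l n (Suc k)) \<inter> E j (l n k) (l n (Suc k)))" for n
    have A: "A n \<in> events" for n unfolding A_def using E l by (intro sets.finite_UN sets.Int) auto
    define C where "C = r i * r j * T\<^sup>2"
    have PA: "prob (A n) \<le> C / real (Suc n)" for n
    proof -
      have "prob (A n) \<le> (\<Sum>k<Suc n. prob (E i (l n k) (l n (Suc k)) \<inter> E j (l n k) (l n (Suc k))))"
        unfolding A_def using E l by (intro finite_measure_subadditive_finite) auto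
      also have "\<dots> \<le> (\<Sum>k<Suc n. (r i * (T / real (Suc n))) * (r j * (T / real (Suc n))))"
      proof (rule sum_mono)
        fix k
        have "prob (E m (l n k) (l n (Suc k))) \<le> r m * (T / real (Suc n))" for m
          using poisson_process_prob_increment[OF N l(1,2), of m n k] unfolding l(3) E_def .
        then show "prob (E i (l n k) (l n (Suc k)) \<inter> E j (l n k) (l n (Suc k))) \<le>
            (r i * (T / real (Suc n))) * (r j * (T / real (Suc n)))"
          unfolding indep[OF l(1,2)] using rpos[of i] T by (intro mult_mono) auto
      qed
      also have "\<dots> = C / real (Suc n)"
        by (simp add: C_def power2_eq_square field_simps del: of_nat_Suc)
      finally show ?thesis .
    qed
    have "prob (\<Inter>n. A n) \<le> 0"
    proof (rule LIMSEQ_le_const)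
      show "(\<lambda>n. C / real (Suc n)) \<longlonglongrightarrow> 0"
        by (rule LIMSEQ_Suc) (rule lim_const_over_n)
      show "\<exists>N. \<forall>n\<ge>N. prob (\<Inter>n. A n) \<le> C / real (Suc n)"
        using PA A by (intro exI[of _ 0] allI impI) (meson INF_lower UNIV_I finite_measure_mono order.trans)
    qed
    then have null: "emeasure M (\<Inter>n. A n) = 0"
      by (simp add: emeasure_eq_measure measure_le_0_iff)
    show ?thesis
    proof (rule AE_I[OF _ null])
      show "(\<Inter>n. A n) \<in> events" using A by (intro sets.countable_INT) auto
      show "{\<omega> \<in> space M. \<not> (\<forall>s\<in>{0<..T}. \<not> (moves_at (\<lambda>t. N i t \<omega>) s \<and> moves_at (\<lambda>t. N j t \<omega>) s))} \<subseteq> (\<Inter>n. A n)"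
      proof
        fix \<omega> assume "\<omega> \<in> {\<omega> \<in> space M. \<not> (\<forall>s\<in>{0<..T}. \<not> (moves_at (\<lambda>t. N i t \<omega>) s \<and> moves_at (\<lambda>t. N j t \<omega>) s))}"
        then obtain s where \<omega>: "\<omega> \<in> space M" and s: "0 < s" "s \<le> T"
          and mv: "moves_at (\<lambda>t. N i t \<omega>) s" "moves_at (\<lambda>t. N j t \<omega>) s" by auto
        show "\<omega> \<in> (\<Inter>n. A n)"
        proof
          fix n
          define k where "k = nat (\<lceil>s * real (Suc n) / T\<rceil> - 1)"
          have "0 < s * real (Suc n) / T" using s T by simp
          then have c0: "0 < \<lceil>s * real (Suc n) / T\<rceil>" by simp
          have "s * real (Suc n) / T \<le> T * real (Suc n) / T"
            using s T by (intro divide_right_mono mult_right_mono) auto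
          then have "s * real (Suc n) / T \<le> of_int (int (Suc n))" using T by simp
          then have "\<lceil>s * real (Suc n) / T\<rceil> \<le> int (Suc n)" by (rule ceiling_le)
          then have k: "\<lceil>s * real (Suc n) / T\<rceil> = int k + 1" "k < Suc n"
            unfolding k_def using c0 by linarith+
          then have "l n k < s" "s \<le> l n (Suc k)"
            using grid_cell_iff[of T "Suc n" k s] T unfolding l_def by auto
          have "N m (l n k) \<omega> \<noteq> N m (l n (Suc k)) \<omega>" if "moves_at (\<lambda>t. N m t \<omega>) s" for m
          proof -
            have "N m (l n k) \<omega> \<noteq> N m s \<omega>"
              using that l(1)[of n k] \<open>l n k < s\<close> unfolding moves_at_def by blast
            then show ?thesis
              using mono[OF \<omega> l(1)[of n k], of s m] mono[OF \<omega>, of s "l n (Suc k)" m] s(1)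
                \<open>l n k < s\<close> \<open>s \<le> l n (Suc k)\<close> by auto
          qed
          then show "\<omega> \<in> A n" using \<omega> k(2) mv unfolding A_def E_def by blast
        qed
      qed
    qed
  qed
  have "AE \<omega> in M. \<forall>n. \<forall>s\<in>{0<..real (Suc n)}. \<not> (moves_at (\<lambda>t. N i t \<omega>) s \<and> moves_at (\<lambda>t. N j t \<omega>) s)"
    unfolding AE_all_countable using fixed by simp
  then show ?thesis
  proof eventually_elim
    case (elim \<omega>)
    show ?case
    proof (intro allI impI)
      fix s :: real assume "0 < s"
      obtain n where "s \<le> real n" using real_arch_simple by blast
      then show "\<not> (moves_at (\<lambda>t. N i t \<omega>) s \<and> moves_at (\<lambda>t. N j t \<omega>) s)"
        using elim[rule_format, of s n] \<open>0 < s\<close> by simp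
    qed
  qed
qed

section \<open>The delay system along a path\<close>

lemma finite_gap_both:
  fixes D :: "real set"
  assumes "\<And>t. finite (D \<inter> {0<..t})" "0 < \<tau>"
  obtains e where "0 \<le> e" "e < \<tau>" "D \<inter> {e<..<\<tau>} = {}"
proof -
  have "finite (D \<inter> {0<..<\<tau> + 1})"
    by (rule finite_subset[OF _ assms(1)[of "\<tau> + 1"]]) auto
  from finite_gap_left[OF this assms(2)] show ?thesis using that by auto
qed

lemma at_right_integral_plus_jumps:
  fixes h c :: "real \<Rightarrow> real"
  assumes int: "\<And>t. 0 < t \<Longrightarrow> set_integrable lborel {0..t} h" and fin: "\<And>t. finite (D \<inter> {0<..t})" and t: "0 \<le> t"
  shows "((\<lambda>t. (LINT s:{0..t}|lborel. h s) + (\<Sum>s\<in>D \<inter> {0<..t}. c s)) \<longlongrightarrow>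
    (LINT s:{0..t}|lborel. h s) + (\<Sum>s\<in>D \<inter> {0<..t}. c s)) (at_right t)"
proof (rule tendsto_add)
  have "continuous_on {0..t + 1} (\<lambda>t. LINT s:{0..t}|lborel. h s)"
    using t by (intro continuous_on_indefinite_lborel_integral int) auto
  then have "continuous_on {t..t + 1} (\<lambda>t. LINT s:{0..t}|lborel. h s)"
    by (rule continuous_on_subset) (use t in auto)
  then have "((\<lambda>t. LINT s:{0..t}|lborel. h s) \<longlongrightarrow> (LINT s:{0..t}|lborel. h s)) (at t within {t..t + 1})"
    by (simp add: continuous_on_def)
  then show "((\<lambda>t. LINT s:{0..t}|lborel. h s) \<longlongrightarrow> (LINT s:{0..t}|lborel. h s)) (at_right t)"
    by (simp add: at_within_Icc_at_right)
  have "finite (D \<inter> {0<..<t + 1})"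
    by (rule finite_subset[OF _ fin[of "t + 1"]]) auto
  from finite_gap_right[OF this t] obtain e where e: "t < e" "D \<inter> {t<..<e} = {}" by auto
  have "\<forall>\<^sub>F u in at_right t. (\<Sum>s\<in>D \<inter> {0<..u}. c s) = (\<Sum>s\<in>D \<inter> {0<..t}. c s)"
    using eventually_at_right_real[OF e(1)]
  proof eventually_elim
    case (elim u)
    then have "D \<inter> {0<..u} = D \<inter> {0<..t}" using e(2) t by force
    then show ?case by simp
  qed
  then show "((\<lambda>t. \<Sum>s\<in>D \<inter> {0<..t}. c s) \<longlongrightarrow> (\<Sum>s\<in>D \<inter> {0<..t}. c s)) (at_right t)"
    by (rule tendsto_eventually)
qed

text \<open>As the upper end increases to \<open>t\<close>, the jump sum freezes at the impulses
  strictly before \<open>t\<close>. Thus the equation for the path turns into the strict-sum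
  equation for its left limits.\<close>

lemma at_left_integral_plus_jumps:
  fixes h c :: "real \<Rightarrow> real"
  assumes int: "\<And>t. 0 < t \<Longrightarrow> set_integrable lborel {0..t} h" and fin: "\<And>t. finite (D \<inter> {0<..t})" and t: "0 < t"
  shows "((\<lambda>t. (LINT s:{0..t}|lborel. h s) + (\<Sum>s\<in>D \<inter> {0<..t}. c s)) \<longlongrightarrow>
    (LINT s:{0..t}|lborel. h s) + (\<Sum>s\<in>D \<inter> {0<..<t}. c s)) (at_left t)"
proof (rule tendsto_add)
  have "continuous_on {0..t} (\<lambda>t. LINT s:{0..t}|lborel. h s)"
    using t by (intro continuous_on_indefinite_lborel_integral int) auto
  then have "((\<lambda>t. LINT s:{0..t}|lborel. h s) \<longlongrightarrow> (LINT s:{0..t}|lborel. h s)) (at t within {0..t})"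
    using t by (simp add: continuous_on_def)
  then show "((\<lambda>t. LINT s:{0..t}|lborel. h s) \<longlongrightarrow> (LINT s:{0..t}|lborel. h s)) (at_left t)"
    using t by (simp add: at_within_Icc_at_left)
  from finite_gap_both[of D, OF fin t] obtain e where e: "0 \<le> e" "e < t" "D \<inter> {e<..<t} = {}" by auto
  have "\<forall>\<^sub>F u in at_left t. (\<Sum>s\<in>D \<inter> {0<..u}. c s) = (\<Sum>s\<in>D \<inter> {0<..<t}. c s)"
    using eventually_at_left_real[OF e(2)]
  proof eventually_elim
    case (elim u)
    then have "D \<inter> {0<..u} = D \<inter> {0<..<t}" using e by force
    then show ?case by simp
  qed
  then show "((\<lambda>t. \<Sum>s\<in>D \<inter> {0<..t}. c s) \<longlongrightarrow> (\<Sum>s\<in>D \<inter> {0<..<t}. c s)) (at_left t)"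
    by (rule tendsto_eventually)
qed

lemma sum_insert_right_endpoint:
  fixes c :: "real \<Rightarrow> real"
  assumes "finite (D \<inter> {0<..t})" "0 < t"
  shows "(\<Sum>s\<in>D \<inter> {0<..t}. c s) = (\<Sum>s\<in>D \<inter> {0<..<t}. c s) + (if t \<in> D then c t else 0)"
proof (cases "t \<in> D")
  case True
  have "finite (D \<inter> {0<..<t})" by (rule finite_subset[OF _ assms(1)]) auto
  moreover have "D \<inter> {0<..t} = insert t (D \<inter> {0<..<t})" using True assms by auto
  ultimately show ?thesis using True by simp
next
  case False
  then have "x < t" if "x \<in> D" "x \<le> t" for x using that by (cases "x = t") auto
  then have "D \<inter> {0<..t} = D \<inter> {0<..<t}" by auto
  then show ?thesis using False by simp
qed

text \<open>This permits replacing the path by its left limits under \<open>ds\<close>: they differ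
  only at jump times, finitely many up to \<open>t\<close>. The time 0 is excepted as well, where
  the left limit carries no information.\<close>

lemma
  fixes h h' :: "real \<Rightarrow> real"
  assumes fin: "finite (D \<inter> {0<..t})" and eq: "\<And>s. 0 < s \<Longrightarrow> s \<le> t \<Longrightarrow> s \<notin> D \<Longrightarrow> h s = h' s"
  shows set_integrable_change_finite: "set_integrable lborel {0..t} h \<longleftrightarrow> set_integrable lborel {0..t} h'"
    and set_integral_change_finite: "(LINT s:{0..t}|lborel. h s) = (LINT s:{0..t}|lborel. h' s)"
proof -
  have c: "countable (insert 0 (D \<inter> {0<..t}))" using fin by (intro countable_finite) simp
  have "indicator {0..t} s *\<^sub>R h s = indicator {0..t} s *\<^sub>R h' s" if "s \<notin> insert 0 (D \<inter> {0<..t})" for s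
    using that eq[of s] by (auto simp: indicator_def)
  note * = c _ _ this
  show "set_integrable lborel {0..t} h \<longleftrightarrow> set_integrable lborel {0..t} h'"
    unfolding set_integrable_def by (rule integrable_discrete_difference[OF *]) auto
  show "(LINT s:{0..t}|lborel. h s) = (LINT s:{0..t}|lborel. h' s)"
    unfolding set_lebesgue_integral_def by (rule integral_discrete_difference[OF *]) auto
qed

lemma
  fixes h :: "'i \<Rightarrow> 'a \<Rightarrow> real"
  assumes "\<And>j. set_integrable M A (h j)"
  shows set_integrable_sum: "set_integrable M A (\<lambda>x. \<Sum>j\<in>I. h j x)"
    and set_integral_sum: "(LINT x:A|M. \<Sum>j\<in>I. h j x) = (\<Sum>j\<in>I. LINT x:A|M. h j x)"
proof -
  have i: "integrable M (\<lambda>x. indicator A x *\<^sub>R h j x)" for j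
    using assms[of j] by (simp only: set_integrable_def)
  show "set_integrable M A (\<lambda>x. \<Sum>j\<in>I. h j x)"
    unfolding set_integrable_def scaleR_sum_right by (intro Bochner_Integration.integrable_sum i)
  show "(LINT x:A|M. \<Sum>j\<in>I. h j x) = (\<Sum>j\<in>I. LINT x:A|M. h j x)"
    unfolding set_lebesgue_integral_def scaleR_sum_right by (intro Bochner_Integration.integral_sum i)
qed

definition jumps :: "('d \<Rightarrow> real \<Rightarrow> real) \<Rightarrow> real set" where
  "jumps X = (\<Union>j. jump_times (X j))"

definition step_paths :: "('d \<Rightarrow> real \<Rightarrow> real) \<Rightarrow> bool" where
  "step_paths X \<longleftrightarrow> (\<forall>j. \<forall>t\<ge>0. \<exists>Q. step_on Q t (X j))"

lemma finite_jump_times: "step_paths X \<Longrightarrow> finite (jump_times (X j) \<inter> {0<..t})"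
  by (cases "0 \<le> t") (auto simp: step_paths_def dest!: spec[of _ j] dest: spec[of _ t] intro: step_on_finite_jump_times)

lemma finite_jumps:
  fixes X :: "'d::finite \<Rightarrow> real \<Rightarrow> real"
  assumes "step_paths X"
  shows "finite (jumps X \<inter> {0<..t})"
proof -
  have "jumps X \<inter> {0<..t} = (\<Union>j. jump_times (X j) \<inter> {0<..t})" by (auto simp: jumps_def)
  also have "finite \<dots>" by (intro finite_UN_I finite finite_jump_times assms)
  finally show ?thesis .
qed

text \<open>The linear impulsive system has a single impulse set, so the jumps of all drivers are
  regrouped by time.\<close>

lemma sum_jump_times:
  fixes X :: "'d::finite \<Rightarrow> real \<Rightarrow> real" and c :: "'d \<Rightarrow> real \<Rightarrow> real"
  assumes "step_paths X" and I: "I \<subseteq> {0<..t}"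
  shows "(\<Sum>j\<in>UNIV. \<Sum>s\<in>jump_times (X j) \<inter> I. c j s) =
    (\<Sum>s\<in>jumps X \<inter> I. \<Sum>j\<in>UNIV. if s \<in> jump_times (X j) then c j s else 0)"
proof -
  have fin: "finite (jumps X \<inter> I)"
    by (rule finite_subset[OF _ finite_jumps[OF assms(1), of t]]) (use I in auto)
  have "(\<Sum>s\<in>jump_times (X j) \<inter> I. c j s) = (\<Sum>s\<in>jumps X \<inter> I. if s \<in> jump_times (X j) then c j s else 0)" for j
    using fin by (intro sum.mono_neutral_cong_left) (auto simp: jumps_def)
  then show ?thesis by (simp add: sum.swap[of _ _ "UNIV :: 'd set"])
qed

section \<open>Drift and impulses determined by the delayed values\<close>

locale delay_system =
  fixes f :: "'d::finite \<Rightarrow> 'd \<Rightarrow> real^'d \<Rightarrow> real" and g :: "'d \<Rightarrow> 'd \<Rightarrow> real \<Rightarrow> real^'d \<Rightarrow> real"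
    and \<nu> :: "'d \<Rightarrow> real measure" and J :: "real set" and b C :: real and \<phi> :: "'d \<Rightarrow> real \<Rightarrow> real"
  assumes f_borel [measurable]: "\<And>i j. f i j \<in> borel_measurable borel"
    and f_bound: "\<And>i j x. \<bar>f i j x\<bar> \<le> C"
    and J_borel [measurable]: "J \<in> sets borel"
    and g_borel: "\<And>i j. (\<lambda>(z, x). g i j z x) \<in> borel_measurable (restrict_space borel (J \<times> UNIV))"
    and g_bound: "\<And>i j z x. z \<in> J \<Longrightarrow> \<bar>g i j z x\<bar> \<le> C"
    and \<nu>_finite: "\<And>j. finite_measure (\<nu> j)"
    and \<nu>_sets [measurable_cong]: "\<And>j. sets (\<nu> j) = sets borel"
    and b_pos: "0 < b"
    and \<phi>_borel: "\<And>i. \<phi> i \<in> borel_measurable (restrict_space borel {-b..0})"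
begin

lemma C_nonneg: "0 \<le> C"
  using f_bound[of undefined undefined 0] by linarith

text \<open>\<open>g\<close> is controlled only for marks in \<open>J\<close>. Extension by zero
  gives a bounded Borel function everywhere and absorbs the restriction of the integrals to
  \<open>J\<close>.\<close>

definition gJ :: "'d \<Rightarrow> 'd \<Rightarrow> real \<Rightarrow> real^'d \<Rightarrow> real" where
  "gJ i j z x = indicator J z * g i j z x"

lemma gJ_bound: "\<bar>gJ i j z x\<bar> \<le> C"
  unfolding gJ_def using g_bound C_nonneg by (simp add: indicator_def)

lemma gJ_borel [measurable]: "(\<lambda>(z, x). gJ i j z x) \<in> borel_measurable (borel \<Otimes>\<^sub>M borel)"
proof -
  have "(\<lambda>p. indicator (J \<times> UNIV) p *\<^sub>R (case p of (z, x) \<Rightarrow> g i j z x)) \<in> borel_measurable borel"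
    using g_borel[of i j]
    by (subst (asm) borel_measurable_restrict_space_iff) (auto simp: borel_prod[symmetric])
  also have "(\<lambda>p. indicator (J \<times> UNIV) p *\<^sub>R (case p of (z, x) \<Rightarrow> g i j z x)) = (\<lambda>(z, x). gJ i j z x)"
    by (auto simp: gJ_def indicator_def)
  finally show ?thesis unfolding borel_prod .
qed

lemma \<nu>_space: "space (\<nu> j) = UNIV"
  using sets_eq_imp_space_eq[OF \<nu>_sets] by simp

lemma \<nu>_sigma_finite: "sigma_finite_measure (\<nu> j)"
  using \<nu>_finite[of j] by (simp add: finite_measure_def)

definition compensator :: "'d \<Rightarrow> 'd \<Rightarrow> real^'d \<Rightarrow> real" where
  "compensator i j x = (\<integral>z. gJ i j z x \<partial>\<nu> j)"

lemma compensator_borel [measurable]: "compensator i j \<in> borel_measurable borel"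
proof -
  interpret sigma_finite_measure "\<nu> j" by (rule \<nu>_sigma_finite)
  show ?thesis unfolding compensator_def[abs_def] by (rule borel_measurable_lebesgue_integral) measurable
qed

lemma compensator_bound: "\<bar>compensator i j x\<bar> \<le> C * measure (\<nu> j) UNIV"
proof -
  interpret finite_measure "\<nu> j" by (rule \<nu>_finite)
  have [measurable]: "(\<lambda>z. gJ i j z x) \<in> borel_measurable (\<nu> j)" by measurable
  have "integrable (\<nu> j) (\<lambda>z. gJ i j z x)"
    by (rule integrable_const_bound[where B = C]) (auto simp: gJ_bound)
  then have "\<bar>compensator i j x\<bar> \<le> (\<integral>z. \<bar>gJ i j z x\<bar> \<partial>\<nu> j)"
    unfolding compensator_def using integral_abs_bound by blast
  also have "\<dots> \<le> (\<integral>z. C \<partial>\<nu> j)"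
    using \<open>integrable (\<nu> j) (\<lambda>z. gJ i j z x)\<close> by (intro integral_mono) (auto simp: gJ_bound)
  also have "\<dots> = C * measure (\<nu> j) UNIV" by (simp add: \<nu>_space mult.commute)
  finally show ?thesis .
qed

text \<open>Integrating out the mark, the compensator contributes a multiple of the i-th component
  to the i-th equation. It therefore changes the diagonal only, and the off-diagonal entries keep
  the sign of \<open>f\<close>.\<close>

definition drift :: "(real \<Rightarrow> real^'d) \<Rightarrow> 'd \<Rightarrow> 'd \<Rightarrow> real \<Rightarrow> real" where
  "drift u i j s = f i j (u (s - b)) - (if i = j then \<Sum>k\<in>UNIV. compensator i k (u (s - b)) else 0)"

definition impulse :: "('d \<Rightarrow> real \<Rightarrow> real) \<Rightarrow> (real \<Rightarrow> real^'d) \<Rightarrow> 'd \<Rightarrow> real \<Rightarrow> real" where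
  "impulse X u i s = (\<Sum>j\<in>UNIV. if s \<in> jump_times (X j) then gJ i j (jump (X j) s) (u (s - b)) else 0)"

text \<open>The summands bound \<open>f\<close>, the compensators and the impulses in turn; their
  total serves as the one constant that \<open>bounded_impulsive\<close> uses for drift and impulses
  alike.\<close>

definition bound :: real where
  "bound = C + (\<Sum>k\<in>UNIV. C * measure (\<nu> k) UNIV) + real CARD('d) * C"

lemma bound_parts: "0 \<le> (\<Sum>k\<in>UNIV. C * measure (\<nu> k) UNIV)" "0 \<le> real CARD('d) * C"
  using C_nonneg by (auto intro!: sum_nonneg mult_nonneg_nonneg)

lemma drift_bound: "\<bar>drift u i j s\<bar> \<le> bound"
proof -
  have "\<bar>\<Sum>k\<in>UNIV. compensator i k (u (s - b))\<bar> \<le> (\<Sum>k\<in>UNIV. C * measure (\<nu> k) UNIV)"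
    by (rule order.trans[OF sum_abs sum_mono]) (rule compensator_bound)
  moreover note f_bound[of i j "u (s - b)"] bound_parts
  ultimately show ?thesis unfolding drift_def bound_def by (cases "i = j"; simp only: simp_thms if_True if_False; linarith)
qed

lemma impulse_bound: "\<bar>impulse X u i s\<bar> \<le> bound"
proof -
  have "\<bar>impulse X u i s\<bar> \<le> (\<Sum>j\<in>(UNIV::'d set). C)"
    unfolding impulse_def by (rule order.trans[OF sum_abs sum_mono]) (auto simp: gJ_bound C_nonneg)
  then show ?thesis using bound_parts C_nonneg unfolding bound_def by simp
qed

lemma drift_borel [measurable]:
  assumes [measurable]: "u \<in> borel_measurable borel"
  shows "drift u i j \<in> borel_measurable borel"
  unfolding drift_def[abs_def] by measurable

lemma bounded_impulsive:
  assumes "u \<in> borel_measurable borel" "step_paths X"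
  shows "bounded_impulsive (drift u) (impulse X u) (jumps X) bound"
proof
  show "finite (jumps X \<inter> {0<..<t})" for t
    by (rule finite_subset[OF _ finite_jumps[OF assms(2), of t]]) auto
qed (use assms in \<open>auto intro: drift_bound impulse_bound drift_borel\<close>)

definition left_path :: "('d \<Rightarrow> real \<Rightarrow> real) \<Rightarrow> (real \<Rightarrow> real^'d) \<Rightarrow> 'd \<Rightarrow> real \<Rightarrow> real" where
  "left_path X u = impulsive_path (drift u) (impulse X u) (jumps X) (\<lambda>i. \<phi> i 0)"

text \<open>\<open>\<phi>\<close> is Borel only on the initial interval; the value zero elsewhere
  makes a Borel function on the whole line.\<close>

definition init :: "real \<Rightarrow> real^'d" where
  "init t = (\<chi> i. indicator {-b..0} t * \<phi> i t)"

text \<open>With \<open>u\<close> as delayed data, \<open>left_path X u\<close> is the path of left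
  limits, and including the impulse at \<open>t\<close> in \<open>{0<..t}\<close> produces the
  right-continuous path. A fixed point of \<open>stage X\<close> solves the delay equation.\<close>

definition stage :: "('d \<Rightarrow> real \<Rightarrow> real) \<Rightarrow> (real \<Rightarrow> real^'d) \<Rightarrow> real \<Rightarrow> real^'d" where
  "stage X u t = (if t \<le> 0 then init t else \<chi> i. \<phi> i 0
     + (LINT s:{0..t}|lborel. \<Sum>j\<in>UNIV. drift u i j s * left_path X u j s)
     + (\<Sum>s\<in>jumps X \<inter> {0<..t}. impulse X u i s * left_path X u i s))"

text \<open>Up to time \<open>t\<close> the coefficients involve \<open>u\<close> only up to
  \<open>t - b\<close>, so each application of \<open>stage\<close> settles the path on one further
  interval of length \<open>b\<close>.\<close>

lemma stage_cong:
  assumes "\<And>s. s \<le> t - b \<Longrightarrow> u s = u' s"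
  shows "stage X u t = stage X u' t"
proof (cases "t \<le> 0")
  case False
  have d: "drift u i j s = drift u' i j s" if "s \<le> t" for i j s
    using assms[of "s - b"] that by (simp add: drift_def)
  have m: "impulse X u i s = impulse X u' i s" if "s \<le> t" for i s
    using assms[of "s - b"] that by (simp add: impulse_def cong: if_cong)
  have L: "left_path X u i s = left_path X u' i s" if "s \<le> t" for i s
    unfolding left_path_def using d m that by (intro impulsive_path_cong[where T = t]) auto
  have "(LINT s:{0..t}|lborel. \<Sum>j\<in>UNIV. drift u i j s * left_path X u j s) =
     (LINT s:{0..t}|lborel. \<Sum>j\<in>UNIV. drift u' i j s * left_path X u' j s)" for i
    using d L by (intro set_lebesgue_integral_cong) (auto intro!: sum.cong)
  moreover have "(\<Sum>s\<in>jumps X \<inter> {0<..t}. impulse X u i s * left_path X u i s) =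
      (\<Sum>s\<in>jumps X \<inter> {0<..t}. impulse X u' i s * left_path X u' i s)" for i
    using m L by (intro sum.cong) auto
  ultimately show ?thesis by (simp add: stage_def)
qed (simp add: stage_def)

section \<open>Method of steps\<close>

primrec stages :: "('d \<Rightarrow> real \<Rightarrow> real) \<Rightarrow> nat \<Rightarrow> real \<Rightarrow> real^'d" where
  "stages X 0 = init"
| "stages X (Suc n) = stage X (stages X n)"

definition steps_sol :: "('d \<Rightarrow> real \<Rightarrow> real) \<Rightarrow> real \<Rightarrow> real^'d" where
  "steps_sol X t = stages X (nat \<lceil>t / b\<rceil>) t"

text \<open>After \<open>k\<close> stages the values up to \<open>k * b\<close> are final. Hence
  \<open>steps_sol\<close> may read the value at \<open>t\<close> from the first stage that reaches
  \<open>t\<close> and is still one path.\<close>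

lemma stages_eq:
  assumes "t \<le> real k * b"
  shows "stages X (k + m) t = stages X k t"
  using assms
proof (induction k arbitrary: t)
  case 0
  then show ?case by (cases m) (simp_all add: stage_def)
next
  case (Suc k)
  have "stage X (stages X (k + m)) t = stage X (stages X k) t"
    using Suc.prems by (intro stage_cong Suc.IH) (auto simp: algebra_simps)
  then show ?case by simp
qed

lemma le_nat_ceiling_mult: "t \<le> real (nat \<lceil>t / b\<rceil>) * b"
proof -
  have "t / b \<le> real (nat \<lceil>t / b\<rceil>)" by (rule real_nat_ceiling_ge)
  then show ?thesis using b_pos by (simp add: field_simps)
qed

lemma steps_sol_eq_stages:
  assumes "t \<le> real k * b"
  shows "steps_sol X t = stages X k t"
proof -
  have "t / b \<le> of_int (int k)" using assms b_pos by (simp add: field_simps)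
  then have "\<lceil>t / b\<rceil> \<le> int k" by (rule ceiling_le)
  then have "nat \<lceil>t / b\<rceil> + (k - nat \<lceil>t / b\<rceil>) = k" by simp
  then show ?thesis
    unfolding steps_sol_def using stages_eq[OF le_nat_ceiling_mult, of X t "k - nat \<lceil>t / b\<rceil>"] by simp
qed

lemma steps_sol_fixpoint: "steps_sol X t = stage X (steps_sol X) t"
proof -
  define k where "k = nat \<lceil>t / b\<rceil>"
  have t: "t \<le> real k * b" unfolding k_def by (rule le_nat_ceiling_mult)
  then have "steps_sol X t = stages X (Suc k) t"
    using b_pos by (intro steps_sol_eq_stages) (simp add: algebra_simps)
  also have "\<dots> = stage X (steps_sol X) t"
    using t b_pos unfolding stages.simps
    by (intro stage_cong steps_sol_eq_stages[symmetric]) auto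
  finally show ?thesis .
qed

text \<open>The jump part is a finite sum over jump times. In the compensating part Fubini
  integrates the mark first and leaves \<open>compensator\<close> times the left limit; closing the
  interval at 0 changes a null set only.\<close>

lemma comp_integral_eq:
  assumes X: "step_paths X"
    and int: "comp_integrable (X j) (\<nu> j) ({0<..t} \<times> J) (jump_coeff b (g i j) u i)"
    and L: "\<And>s. 0 < s \<Longrightarrow> s \<le> t \<Longrightarrow> left_lim u s $ i = L s" and t: "0 < t"
  shows "comp_integral (X j) (\<nu> j) ({0<..t} \<times> J) (jump_coeff b (g i j) u i) =
      (\<Sum>s\<in>jump_times (X j) \<inter> {0<..t}. gJ i j (jump (X j) s) (u (s - b)) * L s)
      - (LINT s:{0..t}|lborel. compensator i j (u (s - b)) * L s)"
    and "set_integrable lborel {0..t} (\<lambda>s. compensator i j (u (s - b)) * L s)"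
proof -
  define h where "h = (\<lambda>p. indicator ({0<..t} \<times> J) p *\<^sub>R jump_coeff b (g i j) u i p)"
  have h: "h (s, z) = indicator {0<..t} s * L s * gJ i j z (u (s - b))" for s z
    by (cases "0 < s \<and> s \<le> t") (use L[of s] in \<open>auto simp: h_def jump_coeff_def gJ_def indicator_def\<close>)
  have i1: "integrable (jump_measure (X j)) h" and i2: "integrable (lborel \<Otimes>\<^sub>M \<nu> j) h"
    using int by (simp_all add: comp_integrable_def set_integrable_def h_def)
  \<comment> \<open>Measurability of the integrand along \<open>u\<close> is extracted from its
    integrability, which is part of being a solution.\<close>
  have "h \<in> borel_measurable borel"
    using borel_measurable_integrable[OF i1] by (simp add: jump_measure_def)
  moreover obtain Q where "step_on Q t (X j)" using X t unfolding step_paths_def by (meson less_imp_le)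
  ultimately have "integral\<^sup>L (jump_measure (X j)) h = (\<Sum>s\<in>jump_times (X j) \<inter> {0<..t}. h (s, jump (X j) s))"
    by (intro integral_jump_measure) (auto simp: h)
  also have "\<dots> = (\<Sum>s\<in>jump_times (X j) \<inter> {0<..t}. gJ i j (jump (X j) s) (u (s - b)) * L s)"
    by (intro sum.cong) (auto simp: h)
  finally have 1: "integral\<^sup>L (jump_measure (X j)) h = (\<Sum>s\<in>jump_times (X j) \<inter> {0<..t}. gJ i j (jump (X j) s) (u (s - b)) * L s)" .
  interpret pair_sigma_finite lborel "\<nu> j"
    unfolding pair_sigma_finite_def using \<nu>_sigma_finite lborel.sigma_finite_measure_axioms by simp
  have inner: "(\<integral>z. h (s, z) \<partial>\<nu> j) = indicator {0<..t} s *\<^sub>R (compensator i j (u (s - b)) * L s)" for s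
    unfolding h compensator_def by (simp add: mult_ac)
  have zero: "indicator {0<..t} s *\<^sub>R (compensator i j (u (s - b)) * L s) = indicator {0..t} s *\<^sub>R (compensator i j (u (s - b)) * L s)"
    if "s \<notin> {0}" for s using that by (auto simp: indicator_def)
  have "integrable lborel (\<lambda>s. \<integral>z. h (s, z) \<partial>\<nu> j)" by (rule integrable_fst'[OF i2])
  then have "integrable lborel (\<lambda>s. indicator {0<..t} s *\<^sub>R (compensator i j (u (s - b)) * L s))" unfolding inner .
  then show "set_integrable lborel {0..t} (\<lambda>s. compensator i j (u (s - b)) * L s)"
    unfolding set_integrable_def
    by (rule integrable_discrete_difference[where X = "{0}", THEN iffD1, rotated 4]) (use zero in auto)
  have "integral\<^sup>L (lborel \<Otimes>\<^sub>M \<nu> j) h = (\<integral>s. (\<integral>z. h (s, z) \<partial>\<nu> j) \<partial>lborel)"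
    by (rule integral_fst'[OF i2, symmetric])
  also have "\<dots> = (LINT s:{0..t}|lborel. compensator i j (u (s - b)) * L s)"
    unfolding inner set_lebesgue_integral_def by (rule integral_discrete_difference[where X = "{0}"]) (use zero in auto)
  finally have 2: "integral\<^sup>L (lborel \<Otimes>\<^sub>M \<nu> j) h = (LINT s:{0..t}|lborel. compensator i j (u (s - b)) * L s)" .
  have "comp_integral (X j) (\<nu> j) ({0<..t} \<times> J) (jump_coeff b (g i j) u i) =
      integral\<^sup>L (jump_measure (X j)) h - integral\<^sup>L (lborel \<Otimes>\<^sub>M \<nu> j) h"
    unfolding comp_integral_def set_lebesgue_integral_def h_def ..
  also note 1
  also note 2
  finally show "comp_integral (X j) (\<nu> j) ({0<..t} \<times> J) (jump_coeff b (g i j) u i) =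
      (\<Sum>s\<in>jump_times (X j) \<inter> {0<..t}. gJ i j (jump (X j) s) (u (s - b)) * L s)
      - (LINT s:{0..t}|lborel. compensator i j (u (s - b)) * L s)" .
qed

text \<open>The integrand still mixes the path (in the \<open>f\<close> terms) with its left limits
  (in the compensator terms). Both users of the lemma then combine \<open>drift_sum\<close> with
  \<open>set_integral_change_finite\<close> to reach the linear system for the left limits.\<close>

lemma equation_rhs_eq:
  assumes X: "step_paths X" and t: "0 < t"
    and int1: "\<And>j. set_integrable lborel {0..t} (\<lambda>s. f i j (u (s - b)) * u s $ j)"
    and int2: "\<And>j. comp_integrable (X j) (\<nu> j) ({0<..t} \<times> J) (jump_coeff b (g i j) u i)"
    and L: "\<And>s. 0 < s \<Longrightarrow> s \<le> t \<Longrightarrow> left_lim u s $ i = L s"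
  shows "(\<Sum>j\<in>UNIV. LINT s:{0..t}|lborel. f i j (u (s - b)) * u s $ j)
      + (\<Sum>j\<in>UNIV. comp_integral (X j) (\<nu> j) ({0<..t} \<times> J) (jump_coeff b (g i j) u i)) =
      (LINT s:{0..t}|lborel. (\<Sum>j\<in>UNIV. f i j (u (s - b)) * u s $ j) - (\<Sum>j\<in>UNIV. compensator i j (u (s - b)) * L s))
      + (\<Sum>s\<in>jumps X \<inter> {0<..t}. impulse X u i s * L s)"
    and "set_integrable lborel {0..t} (\<lambda>s. (\<Sum>j\<in>UNIV. f i j (u (s - b)) * u s $ j) - (\<Sum>j\<in>UNIV. compensator i j (u (s - b)) * L s))"
proof -
  have c: "comp_integral (X j) (\<nu> j) ({0<..t} \<times> J) (jump_coeff b (g i j) u i) =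
      (\<Sum>s\<in>jump_times (X j) \<inter> {0<..t}. gJ i j (jump (X j) s) (u (s - b)) * L s)
      - (LINT s:{0..t}|lborel. compensator i j (u (s - b)) * L s)"
    "set_integrable lborel {0..t} (\<lambda>s. compensator i j (u (s - b)) * L s)" for j
    using comp_integral_eq[where u=u and L=L and i=i, OF X int2 _ t] L by blast+
  have s1: "set_integrable lborel {0..t} (\<lambda>s. \<Sum>j\<in>UNIV. f i j (u (s - b)) * u s $ j)"
    "(LINT s:{0..t}|lborel. \<Sum>j\<in>UNIV. f i j (u (s - b)) * u s $ j) = (\<Sum>j\<in>UNIV. LINT s:{0..t}|lborel. f i j (u (s - b)) * u s $ j)"
    by (rule set_integrable_sum set_integral_sum, rule int1)+
  have s2: "set_integrable lborel {0..t} (\<lambda>s. \<Sum>j\<in>UNIV. compensator i j (u (s - b)) * L s)"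
    "(LINT s:{0..t}|lborel. \<Sum>j\<in>UNIV. compensator i j (u (s - b)) * L s) = (\<Sum>j\<in>UNIV. LINT s:{0..t}|lborel. compensator i j (u (s - b)) * L s)"
    by (rule set_integrable_sum set_integral_sum, rule c(2))+
  show "set_integrable lborel {0..t} (\<lambda>s. (\<Sum>j\<in>UNIV. f i j (u (s - b)) * u s $ j) - (\<Sum>j\<in>UNIV. compensator i j (u (s - b)) * L s))"
    by (intro set_integral_diff s1 s2)
  have "(\<Sum>j\<in>UNIV. \<Sum>s\<in>jump_times (X j) \<inter> {0<..t}. gJ i j (jump (X j) s) (u (s - b)) * L s) =
     (\<Sum>s\<in>jumps X \<inter> {0<..t}. impulse X u i s * L s)"
    unfolding sum_jump_times[OF X order_refl] impulse_def sum_distrib_right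
    by (intro sum.cong refl) auto
  then show "(\<Sum>j\<in>UNIV. LINT s:{0..t}|lborel. f i j (u (s - b)) * u s $ j)
      + (\<Sum>j\<in>UNIV. comp_integral (X j) (\<nu> j) ({0<..t} \<times> J) (jump_coeff b (g i j) u i)) =
      (LINT s:{0..t}|lborel. (\<Sum>j\<in>UNIV. f i j (u (s - b)) * u s $ j) - (\<Sum>j\<in>UNIV. compensator i j (u (s - b)) * L s))
      + (\<Sum>s\<in>jumps X \<inter> {0<..t}. impulse X u i s * L s)"
    unfolding set_integral_diff(2)[OF s1(1) s2(1)] s1(2) s2(2) c(1) sum_subtractf by simp
qed

lemma drift_sum:
  "(\<Sum>j\<in>UNIV. drift u i j s * L j) = (\<Sum>j\<in>UNIV. f i j (u (s - b)) * L j) - (\<Sum>j\<in>UNIV. compensator i j (u (s - b)) * L i)"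
proof -
  have "(\<Sum>j\<in>UNIV. drift u i j s * L j) = (\<Sum>j\<in>UNIV. f i j (u (s - b)) * L j)
     - (\<Sum>j\<in>UNIV. if i = j then (\<Sum>k\<in>UNIV. compensator i k (u (s - b))) * L j else 0)"
    unfolding drift_def sum_subtractf[symmetric] by (intro sum.cong) (auto simp: left_diff_distrib)
  then show ?thesis by (simp add: sum_distrib_right)
qed

text \<open>The almost sure clause of \<open>sdde_solution\<close> for one fixed \<omega>, with
  \<open>X\<close> as the driving path; the analysis from here on is deterministic.\<close>

definition path_solution :: "('d \<Rightarrow> real \<Rightarrow> real) \<Rightarrow> (real \<Rightarrow> real^'d) \<Rightarrow> bool" where
  "path_solution X u \<longleftrightarrow>
     cadlag u \<and> (\<forall>t\<in>{-b..0}. \<forall>i. u t $ i = \<phi> i t) \<and>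
     (\<forall>t>0. \<forall>i.
       (\<forall>j. set_integrable lborel {0..t} (\<lambda>s. f i j (u (s - b)) * u s $ j)) \<and>
       (\<forall>j. comp_integrable (X j) (\<nu> j) ({0<..t} \<times> J) (jump_coeff b (g i j) u i)) \<and>
       u t $ i = \<phi> i 0
         + (\<Sum>j\<in>UNIV. LINT s:{0..t}|lborel. f i j (u (s - b)) * u s $ j)
         + (\<Sum>j\<in>UNIV. comp_integral (X j) (\<nu> j) ({0<..t} \<times> J) (jump_coeff b (g i j) u i)))"

end

lemma impulsive_solution_cong:
  assumes A: "\<And>i j s. s \<in> {0..T} \<Longrightarrow> A i j s = A' i j s" and g: "\<And>i s. s \<in> {0<..<T} \<Longrightarrow> \<gamma> i s = \<gamma>' i s"
    and sol: "impulsive_solution A \<gamma> D p T L"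
  shows "impulsive_solution A' \<gamma>' D p T L"
  unfolding impulsive_solution_def
proof (intro allI conjI ballI)
  fix i
  have i: "set_integrable lborel {0..T} (\<lambda>s. \<Sum>j\<in>UNIV. A i j s * L j s)"
    using sol unfolding impulsive_solution_def by blast
  show "set_integrable lborel {0..T} (\<lambda>s. \<Sum>j\<in>UNIV. A' i j s * L j s)"
    by (rule set_integrable_cong[THEN iffD1, OF refl refl _ i]) (use A in auto)
  fix t assume t: "t \<in> {0..T}"
  have "(LINT s:{0..t}|lborel. \<Sum>j\<in>UNIV. A i j s * L j s) = (LINT s:{0..t}|lborel. \<Sum>j\<in>UNIV. A' i j s * L j s)"
    using A t by (intro set_lebesgue_integral_cong) auto
  moreover have "(\<Sum>s\<in>D \<inter> {0<..<t}. \<gamma> i s * L i s) = (\<Sum>s\<in>D \<inter> {0<..<t}. \<gamma>' i s * L i s)"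
    using g t by (intro sum.cong) auto
  moreover have "L i t = p i + (LINT s:{0..t}|lborel. \<Sum>j\<in>UNIV. A i j s * L j s) + (\<Sum>s\<in>D \<inter> {0<..<t}. \<gamma> i s * L i s)"
    using sol t unfolding impulsive_solution_def by blast
  ultimately show "L i t = p i + (LINT s:{0..t}|lborel. \<Sum>j\<in>UNIV. A' i j s * L j s) + (\<Sum>s\<in>D \<inter> {0<..<t}. \<gamma>' i s * L i s)"
    by simp
qed

lemma cadlag_left_lim:
  fixes u :: "real \<Rightarrow> 'b::t2_space"
  assumes "cadlag u" "0 < t"
  shows "(u \<longlongrightarrow> left_lim u t) (at_left t)"
proof -
  obtain l where l: "(u \<longlongrightarrow> l) (at_left t)" using assms unfolding cadlag_def by blast
  then have "left_lim u t = l" unfolding left_lim_def by (intro tendsto_Lim) simp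
  with l show ?thesis by simp
qed

section \<open>Solutions along a path and the linear system of their left limits\<close>

context delay_system
begin

text \<open>The fixed-point equation displays \<open>u\<close> as integral plus jump sum, so its
  left limits can be computed and turn out to be \<open>left_path X u\<close>. These are locally
  bounded, which together with finite \<open>\<nu> j\<close> gives all integrability claims; then
  \<open>equation_rhs_eq\<close> is read backwards.\<close>

lemma stage_fixpoint_is_solution:
  assumes X: "step_paths X" and u [measurable]: "u \<in> borel_measurable borel" and fix': "\<And>t. u t = stage X u t"
  shows "path_solution X u"
proof -
  interpret BI: bounded_impulsive "drift u" "impulse X u" "jumps X" bound
    by (rule bounded_impulsive[OF u X])
  define L where "L = left_path X u"
  have L_borel [measurable]: "L i \<in> borel_measurable borel" for i
    unfolding L_def left_path_def by measurable
  define H where "H = (\<lambda>i s. \<Sum>j\<in>UNIV. drift u i j s * L j s)"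
  define S where "S = (\<lambda>i t. \<Sum>s\<in>jumps X \<inter> {0<..t}. impulse X u i s * L i s)"
  note fin = finite_jumps[OF X]
  have intH: "set_integrable lborel {0..t} (H i)" for i t
  proof -
    define P where "P = (\<Sum>i\<in>UNIV. \<bar>\<phi> i 0\<bar>)"
    have p: "\<bar>\<phi> i 0\<bar> \<le> P" for i unfolding P_def by (rule member_le_sum) auto
    have "0 \<le> P" unfolding P_def by (simp add: sum_nonneg)
    show ?thesis unfolding H_def
      by (rule BI.integrable_drift[OF L_borel, where B = "2 * P"])
         (use \<open>0 \<le> P\<close> BI.impulsive_path_bound[where p = "\<lambda>i. \<phi> i 0", OF p] in \<open>auto simp: L_def left_path_def\<close>)
  qed
  \<comment> \<open>The formula is also needed at \<open>t\<close> = 0, where \<open>stage\<close>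
    takes its value from \<open>init\<close>, for right continuity at 0.\<close>
  have u_eq: "u t $ i = \<phi> i 0 + ((LINT s:{0..t}|lborel. H i s) + S i t)" if "0 \<le> t" for i t
  proof (cases "t = 0")
    case True
    then show ?thesis using b_pos fix'[of 0] by (simp add: stage_def init_def S_def)
  next
    case False
    then show ?thesis using that fix'[of t] by (simp add: stage_def H_def L_def S_def)
  qed
  have L_eq: "L i t = \<phi> i 0 + ((LINT s:{0..t}|lborel. H i s) + (\<Sum>s\<in>jumps X \<inter> {0<..<t}. impulse X u i s * L i s))"
    if "0 \<le> t" for i t
    using BI.impulsive_path_fixpoint[OF that, of "\<lambda>i. \<phi> i 0" i]
    unfolding L_def left_path_def impulsive_op_def H_def by simp
  have uL: "u t $ i = L i t + (if t \<in> jumps X then impulse X u i t * L i t else 0)" if "0 < t" for i t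
    using u_eq[of t i] L_eq[of t i] sum_insert_right_endpoint[OF fin that, of "\<lambda>s. impulse X u i s * L i s"] that
    by (simp add: S_def)
  have right: "(u \<longlongrightarrow> u t) (at_right t)" if t: "0 \<le> t" for t
  proof (rule vec_tendstoI)
    fix i
    have "((\<lambda>t. \<phi> i 0 + ((LINT s:{0..t}|lborel. H i s) + S i t)) \<longlongrightarrow> u t $ i) (at_right t)"
      unfolding u_eq[OF t] S_def by (intro tendsto_add tendsto_const at_right_integral_plus_jumps[of "H i"] intH fin t)
    moreover have "\<forall>\<^sub>F s in at_right t. \<phi> i 0 + ((LINT s:{0..s}|lborel. H i s) + S i s) = u s $ i"
      using eventually_at_right_real[of t "t + 1", simplified]
      by eventually_elim (use t u_eq in auto)
    ultimately show "((\<lambda>s. u s $ i) \<longlongrightarrow> u t $ i) (at_right t)" by (rule Lim_transform_eventually)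
  qed
  have left: "(u \<longlongrightarrow> (\<chi> i. L i t)) (at_left t)" if t: "0 < t" for t
  proof (rule vec_tendstoI)
    fix i
    have "((\<lambda>t. \<phi> i 0 + ((LINT s:{0..t}|lborel. H i s) + S i t)) \<longlongrightarrow> L i t) (at_left t)"
      unfolding L_eq[OF less_imp_le[OF t]] S_def
      by (intro tendsto_add[of "\<lambda>_. \<phi> i 0"] tendsto_const at_left_integral_plus_jumps[of "H i"] intH fin t)
    moreover have "\<forall>\<^sub>F s in at_left t. \<phi> i 0 + ((LINT s:{0..s}|lborel. H i s) + S i s) = u s $ i"
      using eventually_at_left_real[OF t] by eventually_elim (use u_eq in auto)
    ultimately show "((\<lambda>s. u s $ i) \<longlongrightarrow> (\<chi> i. L i t) $ i) (at_left t)"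
      by (simp add: Lim_transform_eventually)
  qed
  have ll: "left_lim u t $ i = L i t" if "0 < t" for t i
    using tendsto_Lim[OF _ left[OF that]] by (simp add: left_lim_def)
  have init: "u t $ i = \<phi> i t" if "t \<in> {-b..0}" for t i
    using that fix'[of t] by (simp add: stage_def init_def)
  have int1: "set_integrable lborel {0..t} (\<lambda>s. f i j (u (s - b)) * u s $ j)" for t i j
  proof -
    obtain B where B: "\<And>i s. s \<in> {0..t} \<Longrightarrow> \<bar>L i s\<bar> \<le> B"
      using BI.impulsive_path_locally_bounded[of t "\<lambda>i. \<phi> i 0"] unfolding L_def left_path_def by blast
    have "set_integrable lborel {0..t} (\<lambda>s. f i j (u (s - b)) * L j s)"
    proof (rule set_integrable_bounded_interval)
      show "\<bar>f i j (u (s - b)) * L j s\<bar> \<le> C * B" if "s \<in> {0..t}" for s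
        unfolding abs_mult using f_bound B[OF that] C_nonneg by (intro mult_mono) auto
    qed measurable
    then show ?thesis
      by (rule set_integrable_change_finite[OF fin, THEN iffD1, rotated]) (simp add: uL)
  qed
  have int2: "comp_integrable (X j) (\<nu> j) ({0<..t} \<times> J) (jump_coeff b (g i j) u i)" if t: "0 < t" for t i j
  proof -
    obtain B where B: "\<And>i s. s \<in> {0..t} \<Longrightarrow> \<bar>L i s\<bar> \<le> B"
      using BI.impulsive_path_locally_bounded[of t "\<lambda>i. \<phi> i 0"] unfolding L_def left_path_def by blast
    define h where "h = (\<lambda>(s, z). indicator {0<..t} s * L i s * gJ i j z (u (s - b)))"
    have h: "indicator ({0<..t} \<times> J) p *\<^sub>R jump_coeff b (g i j) u i p = h p" for p
      by (cases p) (auto simp: h_def jump_coeff_def ll gJ_def indicator_def)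
    have hm [measurable]: "h \<in> borel_measurable (borel \<Otimes>\<^sub>M borel)" unfolding h_def by measurable
    obtain Q where Q: "step_on Q t (X j)" using X t unfolding step_paths_def by (meson less_imp_le)
    have 1: "integrable (jump_measure (X j)) h"
      by (rule integrable_jump_measure[OF Q]) (use hm in \<open>auto simp: h_def borel_prod\<close>)
    interpret finite_measure "\<nu> j" by (rule \<nu>_finite)
    have 2: "integrable (lborel \<Otimes>\<^sub>M \<nu> j) h"
    proof (rule integrableI_bounded_set[where A = "{0<..t} \<times> UNIV" and B = "B * C"])
      show "{0<..t} \<times> UNIV \<in> sets (lborel \<Otimes>\<^sub>M \<nu> j)"
        by (intro pair_measureI) (auto simp: \<nu>_sets)
      show "h \<in> borel_measurable (lborel \<Otimes>\<^sub>M \<nu> j)" by measurable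
      have "emeasure (lborel \<Otimes>\<^sub>M \<nu> j) ({0<..t} \<times> UNIV) = emeasure lborel {0<..t} * emeasure (\<nu> j) UNIV"
        by (intro emeasure_pair_measure_Times) (auto simp: \<nu>_sets)
      also have "emeasure (\<nu> j) UNIV < \<infinity>" unfolding infinity_ennreal_def less_top[symmetric] by simp
      then have "emeasure lborel {0<..t} * emeasure (\<nu> j) UNIV < \<infinity>"
        using t by (simp add: ennreal_mult_less_top)
      finally show "emeasure (lborel \<Otimes>\<^sub>M \<nu> j) ({0<..t} \<times> UNIV) < \<infinity>" .
      have "norm (h p) \<le> B * C" if "p \<in> {0<..t} \<times> UNIV" for p
      proof -
        obtain s z where p: "p = (s, z)" "0 < s" "s \<le> t" using \<open>p \<in> _\<close> by auto
        have Bs: "\<bar>L i s\<bar> \<le> B" using B[of s i] p by auto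
        have "norm (h p) = \<bar>L i s\<bar> * \<bar>gJ i j z (u (s - b))\<bar>" using p by (simp add: h_def abs_mult)
        also have "\<dots> \<le> B * C" using Bs by (intro mult_mono gJ_bound) auto
        finally show ?thesis .
      qed
      then show "AE p in lborel \<Otimes>\<^sub>M \<nu> j. p \<in> {0<..t} \<times> UNIV \<longrightarrow> norm (h p) \<le> B * C" by simp
      show "AE p in lborel \<Otimes>\<^sub>M \<nu> j. p \<notin> {0<..t} \<times> UNIV \<longrightarrow> h p = 0"
        by (intro AE_I2) (auto simp: h_def indicator_def split: if_splits)
    qed
    show ?thesis unfolding comp_integrable_def set_integrable_def h using 1 2 by simp
  qed
  have eq: "u t $ i = \<phi> i 0 + (\<Sum>j\<in>UNIV. LINT s:{0..t}|lborel. f i j (u (s - b)) * u s $ j)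
      + (\<Sum>j\<in>UNIV. comp_integral (X j) (\<nu> j) ({0<..t} \<times> J) (jump_coeff b (g i j) u i))" if t: "0 < t" for t i
  proof -
    have "(LINT s:{0..t}|lborel. (\<Sum>j\<in>UNIV. f i j (u (s - b)) * u s $ j) - (\<Sum>j\<in>UNIV. compensator i j (u (s - b)) * L i s))
       = (LINT s:{0..t}|lborel. H i s)"
      by (rule set_integral_change_finite[OF fin]) (simp add: H_def drift_sum uL)
    then show ?thesis
      using equation_rhs_eq(1)[OF X t int1 int2[OF t], of i "L i"] ll u_eq[of t i] t by (simp add: S_def)
  qed
  show ?thesis unfolding path_solution_def cadlag_def
    using right left init int1 int2 eq by blast
qed

text \<open>\<open>left_lim u 0\<close> would look at times before \<open>0\<close>; the convention here is \<open>u(0-) = u(0)\<close>.\<close>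

definition left_values :: "(real \<Rightarrow> real^'d) \<Rightarrow> 'd \<Rightarrow> real \<Rightarrow> real" where
  "left_values u i t = (if t \<le> 0 then \<phi> i 0 else left_lim u t $ i)"

text \<open>The converse reduction, for an arbitrary solution: letting the time tend to
  \<open>t\<close> from the left in the equation yields the system for the left limits, and
  subtracting it from the equation at \<open>t\<close> leaves just the impulse at
  \<open>t\<close>.\<close>

lemma
  assumes X: "step_paths X" and sol: "path_solution X u"
  shows path_solution_jump: "\<And>i t. 0 < t \<Longrightarrow>
      u t $ i = (1 + (if t \<in> jumps X then impulse X u i t else 0)) * left_values u i t"
    and path_solution_left_values: "\<And>T. 0 \<le> T \<Longrightarrow>
      impulsive_solution (drift u) (impulse X u) (jumps X) (\<lambda>i. \<phi> i 0) T (left_values u)"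
proof -
  define L where "L = left_values u"
  define H where "H = (\<lambda>i s. (\<Sum>j\<in>UNIV. f i j (u (s - b)) * u s $ j) - (\<Sum>j\<in>UNIV. compensator i j (u (s - b)) * L i s))"
  define S where "S = (\<lambda>i t. \<Sum>s\<in>jumps X \<inter> {0<..t}. impulse X u i s * L i s)"
  note fin = finite_jumps[OF X]
  have cad: "cadlag u" using sol by (simp add: path_solution_def)
  have int1: "set_integrable lborel {0..t} (\<lambda>s. f i j (u (s - b)) * u s $ j)"
    and int2: "comp_integrable (X j) (\<nu> j) ({0<..t} \<times> J) (jump_coeff b (g i j) u i)"
    and eq: "u t $ i = \<phi> i 0 + (\<Sum>j\<in>UNIV. LINT s:{0..t}|lborel. f i j (u (s - b)) * u s $ j)
      + (\<Sum>j\<in>UNIV. comp_integral (X j) (\<nu> j) ({0<..t} \<times> J) (jump_coeff b (g i j) u i))" if "0 < t" for i j t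
    using sol that unfolding path_solution_def by blast+
  have ll: "left_lim u s $ i = L i s" if "0 < s" for s i
    using that by (simp add: L_def left_values_def)
  have intH: "set_integrable lborel {0..t} (H i)" if "0 < t" for i t
    unfolding H_def by (rule equation_rhs_eq(2)[OF X that int1[OF that] int2[OF that] ll])
  have u_eq: "u t $ i = \<phi> i 0 + ((LINT s:{0..t}|lborel. H i s) + S i t)" if "0 < t" for i t
    using eq[OF that, of i] equation_rhs_eq(1)[where i = i and L = "L i", OF X that int1[OF that] int2[OF that] ll]
    by (simp add: H_def S_def)
  have L_eq: "L i t = \<phi> i 0 + ((LINT s:{0..t}|lborel. H i s) + (\<Sum>s\<in>jumps X \<inter> {0<..<t}. impulse X u i s * L i s))"
    if t: "0 < t" for i t
  proof (rule tendsto_unique)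
    show "at_left t \<noteq> bot" by simp
    have "((\<lambda>s. u s $ i) \<longlongrightarrow> left_lim u t $ i) (at_left t)"
      by (intro tendsto_vec_nth cadlag_left_lim cad t)
    then show "((\<lambda>s. u s $ i) \<longlongrightarrow> L i t) (at_left t)" by (simp add: ll[OF t])
    have "((\<lambda>t. \<phi> i 0 + ((LINT s:{0..t}|lborel. H i s) + S i t)) \<longlongrightarrow>
       \<phi> i 0 + ((LINT s:{0..t}|lborel. H i s) + (\<Sum>s\<in>jumps X \<inter> {0<..<t}. impulse X u i s * L i s))) (at_left t)"
      unfolding S_def
      by (intro tendsto_add[of "\<lambda>_. \<phi> i 0"] tendsto_const at_left_integral_plus_jumps[of "H i"] intH fin t)
    moreover have "\<forall>\<^sub>F s in at_left t. \<phi> i 0 + ((LINT s:{0..s}|lborel. H i s) + S i s) = u s $ i"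
      using eventually_at_left_real[OF t] by eventually_elim (use u_eq in auto)
    ultimately show "((\<lambda>s. u s $ i) \<longlongrightarrow> \<phi> i 0 + ((LINT s:{0..t}|lborel. H i s)
       + (\<Sum>s\<in>jumps X \<inter> {0<..<t}. impulse X u i s * L i s))) (at_left t)"
      by (rule Lim_transform_eventually)
  qed
  have uL: "u t $ i = L i t + (if t \<in> jumps X then impulse X u i t * L i t else 0)" if "0 < t" for i t
    using u_eq[OF that, of i] L_eq[OF that, of i] sum_insert_right_endpoint[OF fin that, of "\<lambda>s. impulse X u i s * L i s"]
    by (simp add: S_def)
  then show "u t $ i = (1 + (if t \<in> jumps X then impulse X u i t else 0)) * left_values u i t" if "0 < t" for i t
    using that by (simp add: L_def algebra_simps)
  have H_eq: "H i s = (\<Sum>j\<in>UNIV. drift u i j s * L j s)" if "0 < s" "s \<notin> jumps X" for i s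
    using that by (simp add: H_def drift_sum uL)
  have int: "set_integrable lborel {0..T} (\<lambda>s. \<Sum>j\<in>UNIV. drift u i j s * L j s)" if "0 < T" for i T
    by (rule set_integrable_change_finite[OF fin, THEN iffD1, rotated, OF intH[OF that]]) (rule H_eq)
  have LINT: "(LINT s:{0..t}|lborel. H i s) = (LINT s:{0..t}|lborel. \<Sum>j\<in>UNIV. drift u i j s * L j s)" for i t
    by (rule set_integral_change_finite[OF fin]) (rule H_eq)
  show "impulsive_solution (drift u) (impulse X u) (jumps X) (\<lambda>i. \<phi> i 0) T (left_values u)" if T: "0 \<le> T" for T
    unfolding impulsive_solution_def L_def[symmetric]
  proof (intro allI conjI ballI)
    fix i
    show "set_integrable lborel {0..T} (\<lambda>s. \<Sum>j\<in>UNIV. drift u i j s * L j s)"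
      \<comment> \<open>The equation speaks about positive times only; the larger interval covers
        the case \<open>T\<close> = 0.\<close>
      by (rule set_integrable_subset[OF int[of "T + 1" i]]) (use T in auto)
    fix t assume "t \<in> {0..T}"
    then show "L i t = \<phi> i 0 + (LINT s:{0..t}|lborel. \<Sum>j\<in>UNIV. drift u i j s * L j s)
       + (\<Sum>s\<in>jumps X \<inter> {0<..<t}. impulse X u i s * L i s)"
      using L_eq[of t i] LINT[of t i] by (cases "t = 0") (simp_all add: L_def left_values_def)
  qed
qed

context
  fixes X :: "'d \<Rightarrow> real \<Rightarrow> real"
  assumes X: "step_paths X"
    and no_common: "\<And>i j s. i \<noteq> j \<Longrightarrow> s \<in> jump_times (X i) \<Longrightarrow> s \<notin> jump_times (X j)"
    and g_ge: "\<And>i j z x. z \<in> J \<Longrightarrow> -1 \<le> g i j z x"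
    and f_nonneg: "\<And>i j x. i \<noteq> j \<Longrightarrow> 0 \<le> f i j x"
begin

text \<open>With at most one driver jumping at \<open>s\<close>, the sum has a single term, bounded
  below by -1. Two simultaneous jumps could add two values close to -1 and make the factor
  negative.\<close>

lemma impulse_ge: "0 \<le> 1 + impulse X u i s"
proof (cases "s \<in> jumps X")
  case True
  then obtain k where k: "s \<in> jump_times (X k)" by (auto simp: jumps_def)
  have "impulse X u i s = (\<Sum>j\<in>UNIV. if k = j then gJ i j (jump (X j) s) (u (s - b)) else 0)"
    unfolding impulse_def using no_common k by (intro sum.cong) auto
  then have "impulse X u i s = gJ i k (jump (X k) s) (u (s - b))" by simp
  then show ?thesis using g_ge[of "jump (X k) s" i k "u (s - b)"] by (auto simp: gJ_def indicator_def)
next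
  case False
  then have "impulse X u i s = 0" unfolding impulse_def by (intro sum.neutral) (auto simp: jumps_def)
  then show ?thesis by simp
qed

lemma finite_jumps_open: "finite (jumps X \<inter> {0<..<t})"
  by (rule finite_subset[OF _ finite_jumps[OF X, of t]]) auto

lemma drift_nonneg: "i \<noteq> j \<Longrightarrow> 0 \<le> drift u i j s"
  unfolding drift_def using f_nonneg by simp

lemma path_solution_nonneg:
  assumes sol: "path_solution X u" and \<phi>: "\<And>i. 0 \<le> \<phi> i 0" and t: "0 < t"
  shows "0 \<le> u t $ i"
proof -
  have "0 \<le> left_values u i t"
    by (rule impulsive_solution_nonneg[OF path_solution_left_values[OF X sol less_imp_le[OF t]] finite_jumps_open])
       (use t \<phi> drift_bound drift_nonneg impulse_ge in auto)
  then show ?thesis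
    unfolding path_solution_jump[OF X sol t] using impulse_ge by (intro mult_nonneg_nonneg) auto
qed

text \<open>Induction over delay intervals. Agreement up to \<open>n * b\<close> gives both
  solutions the same drift and impulses up to (n + 1)b, so their left limits solve one linear
  system; the jump relation then transfers equality to the values.\<close>

lemma path_solution_unique:
  assumes sol: "path_solution X u" "path_solution X u'" and "-b \<le> t"
  shows "u t = u' t"
proof -
  have "u t = u' t" if "-b \<le> t" "t \<le> real n * b" for n t
    using that
  proof (induction n arbitrary: t)
    case 0
    then show ?case using sol unfolding path_solution_def vec_eq_iff by simp
  next
    case (Suc n)
    show ?case
    proof (cases "t \<le> 0")
      case True
      then show ?thesis using Suc sol unfolding path_solution_def vec_eq_iff by simp
    next
      case False
      then have t: "0 < t" by simp
      have prev: "u (s - b) = u' (s - b)" if "0 \<le> s" "s \<le> t" for s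
        using that Suc.prems by (intro Suc.IH) (auto simp: algebra_simps)
      have d: "drift u' i j s = drift u i j s" if "s \<in> {0..t}" for i j s
        using prev[of s] that by (simp add: drift_def)
      have m: "impulse X u' i s = impulse X u i s" if "0 \<le> s" "s \<le> t" for i s
        using prev[of s] that by (simp add: impulse_def cong: if_cong)
      have "impulsive_solution (drift u) (impulse X u) (jumps X) (\<lambda>i. \<phi> i 0) t (left_values u')"
        by (rule impulsive_solution_cong[OF _ _ path_solution_left_values[OF X sol(2) less_imp_le[OF t]]]) (use d m t in auto)
      then have "left_values u i t = left_values u' i t" for i
        by (rule impulsive_solution_unique[OF path_solution_left_values[OF X sol(1) less_imp_le[OF t]] _ finite_jumps_open])
           (use t drift_bound drift_nonneg impulse_ge in auto)
      then show ?thesis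
        unfolding vec_eq_iff path_solution_jump[OF X sol(1) t] path_solution_jump[OF X sol(2) t]
        using m[of t] t by simp
    qed
  qed
  moreover obtain n where "t / b \<le> real n" using real_arch_simple by blast
  then have "t \<le> real n * b" using b_pos by (simp add: field_simps)
  ultimately show ?thesis using assms(3) by blast
qed

end

end

section \<open>Progressive measurability\<close>

lemma borel_measurable_vec_iff:
  fixes h :: "'x \<Rightarrow> real^'n"
  shows "h \<in> borel_measurable M \<longleftrightarrow> (\<forall>i. (\<lambda>x. h x $ i) \<in> borel_measurable M)"
proof -
  have "(\<forall>v\<in>Basis. (\<lambda>x. h x \<bullet> v) \<in> borel_measurable M) \<longleftrightarrow> (\<forall>i. (\<lambda>x. h x $ i) \<in> borel_measurable M)"
    by (auto simp: Basis_vec_def inner_axis)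
  then show ?thesis by (subst borel_measurable_euclidean_space)
qed

context delay_system
begin

lemma init_borel [measurable]: "(\<lambda>t. init t $ i) \<in> borel_measurable borel"
proof -
  have "(\<lambda>t. indicator {-b..0} t *\<^sub>R \<phi> i t) \<in> borel_measurable borel"
    using \<phi>_borel[of i] by (subst (asm) borel_measurable_restrict_space_iff) auto
  then show ?thesis by (simp add: init_def)
qed

context
  fixes G :: "'w measure" and Z :: "'d \<Rightarrow> real \<Rightarrow> 'w \<Rightarrow> real" and T :: real
  assumes Z [measurable]: "\<And>j s. 0 \<le> s \<Longrightarrow> s \<le> T \<Longrightarrow> Z j s \<in> borel_measurable G"
    and steps: "\<And>\<omega>. \<omega> \<in> space G \<Longrightarrow> step_paths (\<lambda>j s. Z j s \<omega>)"
    and T: "0 \<le> T"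
begin

text \<open>Progressive measurability up to the horizon \<open>T\<close>, with \<open>G\<close>
  later taken from the filtration at \<open>T\<close>. The factor \<open>indicator {..T}\<close>
  avoids a restricted time space. Joint measurability is what integrals over time and evaluation at
  random jump times require.\<close>

definition progressive :: "(real \<Rightarrow> 'w \<Rightarrow> 'x::real_normed_vector) \<Rightarrow> bool" where
  "progressive U \<longleftrightarrow> (\<lambda>(s, \<omega>). indicator {..T} s *\<^sub>R U s \<omega>) \<in> borel_measurable (borel \<Otimes>\<^sub>M G)"

abbreviation "drift' U i j s \<omega> \<equiv> drift (\<lambda>s. U s \<omega>) i j s"
abbreviation "impulse' U i s \<omega> \<equiv> impulse (\<lambda>j s. Z j s \<omega>) (\<lambda>s. U s \<omega>) i s"
abbreviation "jumps' \<omega> \<equiv> jumps (\<lambda>j s. Z j s \<omega>)"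

text \<open>\<open>measurable_jump_sum\<close> is applied on the product space, with drivers that
  ignore the time coordinate. The sum extends over all jumps up to \<open>T\<close>, and
  \<open>P\<close> selects those strictly before \<open>s\<close> (for left limits) or up to
  \<open>s\<close> (for the path). The cut-off versions \<open>W\<close> and \<open>V\<close> agree
  with \<open>U\<close> and \<open>L\<close> at the selected times, as \<open>v\<close> and
  \<open>v - b\<close> do not exceed \<open>T\<close>.\<close>

lemma progressive_jump_sum:
  assumes U: "progressive U" and L: "progressive L"
    and P: "{p. P (fst p) (snd p)} \<in> sets (borel \<Otimes>\<^sub>M (borel :: real measure))"
    and sub: "\<And>s v. P s v \<Longrightarrow> v \<le> s"
  shows "progressive (\<lambda>s \<omega>. \<Sum>v\<in>jumps' \<omega> \<inter> {v. 0 < v \<and> P s v}. impulse' U i v \<omega> * L v \<omega> :: real)"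
proof -
  define W where "W = (\<lambda>(s, \<omega>). indicator {..T} s *\<^sub>R U s \<omega>)"
  define V where "V = (\<lambda>(s, \<omega>). indicator {..T} s *\<^sub>R L s \<omega>)"
  have W [measurable]: "W \<in> borel_measurable (borel \<Otimes>\<^sub>M G)" using U by (simp add: progressive_def W_def)
  have V [measurable]: "V \<in> borel_measurable (borel \<Otimes>\<^sub>M G)" using L by (simp add: progressive_def V_def)
  define H where "H j = (\<lambda>(x :: real \<times> 'w) p :: real \<times> real.
      indicator {p. P (fst p) (snd p)} (fst x, fst p) * (gJ i j (snd p) (W (fst p - b, snd x)) * V (fst p, snd x)))" for j
  note P [measurable]
  have Hm: "(\<lambda>(x, p). H j x p) \<in> borel_measurable ((borel \<Otimes>\<^sub>M G) \<Otimes>\<^sub>M borel)" for j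
    unfolding H_def borel_prod[symmetric] by measurable
  have "(\<lambda>x. \<Sum>v\<in>jump_times (\<lambda>s. Z j s (snd x)) \<inter> {0<..T}. H j x (v, jump (\<lambda>s. Z j s (snd x)) v))
      \<in> borel_measurable ((borel :: real measure) \<Otimes>\<^sub>M G)" for j
  proof (rule measurable_jump_sum[where X = "\<lambda>s x. Z j s (snd x)"])
    show "(\<lambda>x. Z j s (snd x)) \<in> borel_measurable ((borel :: real measure) \<Otimes>\<^sub>M G)" if "0 \<le> s" "s \<le> T" for s
    proof -
      have [measurable]: "Z j s \<in> borel_measurable G" using Z that by blast
      show ?thesis by measurable
    qed
    show "\<exists>Q. step_on Q T (\<lambda>s. Z j s (snd x))" if "x \<in> space ((borel :: real measure) \<Otimes>\<^sub>M G)" for x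
      using steps[of "snd x"] that T unfolding step_paths_def by (auto simp: space_pair_measure)
  qed (rule Hm)
  then have "(\<lambda>x. \<Sum>j\<in>UNIV. \<Sum>v\<in>jump_times (\<lambda>s. Z j s (snd x)) \<inter> {0<..T}. H j x (v, jump (\<lambda>s. Z j s (snd x)) v))
      \<in> borel_measurable ((borel :: real measure) \<Otimes>\<^sub>M G)"
    by (rule borel_measurable_sum)
  then have *: "(\<lambda>x. indicator {..T} (fst x) * (\<Sum>j\<in>UNIV. \<Sum>v\<in>jump_times (\<lambda>s. Z j s (snd x)) \<inter> {0<..T}. H j x (v, jump (\<lambda>s. Z j s (snd x)) v)))
      \<in> borel_measurable ((borel :: real measure) \<Otimes>\<^sub>M G)"
    by measurable
  show ?thesis unfolding progressive_def
  proof (rule measurable_cong[THEN iffD1, OF _ *])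
    fix x assume "x \<in> space ((borel :: real measure) \<Otimes>\<^sub>M G)"
    then obtain s \<omega> where x: "x = (s, \<omega>)" "\<omega> \<in> space G" by (auto simp: space_pair_measure)
    show "indicator {..T} (fst x) * (\<Sum>j\<in>UNIV. \<Sum>v\<in>jump_times (\<lambda>s. Z j s (snd x)) \<inter> {0<..T}. H j x (v, jump (\<lambda>s. Z j s (snd x)) v))
      = (case x of (s, \<omega>) \<Rightarrow> indicator {..T} s *\<^sub>R (\<Sum>v\<in>jumps' \<omega> \<inter> {v. 0 < v \<and> P s v}. impulse' U i v \<omega> * L v \<omega>))"
    proof (cases "s \<le> T")
      case True
      let ?X = "\<lambda>j s. Z j s \<omega>"
      let ?I = "{v. 0 < v \<and> P s v}"
      have I: "?I \<subseteq> {0<..T}" using sub True by force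
      have "(\<Sum>v\<in>jump_times (?X j) \<inter> {0<..T}. H j x (v, jump (?X j) v)) =
          (\<Sum>v\<in>jump_times (?X j) \<inter> ?I. gJ i j (jump (?X j) v) (U (v - b) \<omega>) * L v \<omega>)" for j
      proof (rule sum.mono_neutral_cong_right)
        show "finite (jump_times (?X j) \<inter> {0<..T})" by (rule finite_jump_times[OF steps[OF x(2)]])
        show "\<forall>v\<in>jump_times (?X j) \<inter> {0<..T} - jump_times (?X j) \<inter> ?I. H j x (v, jump (?X j) v) = 0"
          by (auto simp: H_def x)
        fix v assume v: "v \<in> jump_times (?X j) \<inter> ?I"
        then have "v \<le> T" "v - b \<le> T" using I b_pos by auto
        then show "H j x (v, jump (?X j) v) = gJ i j (jump (?X j) v) (U (v - b) \<omega>) * L v \<omega>"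
          using v by (simp add: H_def x W_def V_def)
      qed (use I in auto)
      then have "(\<Sum>j\<in>UNIV. \<Sum>v\<in>jump_times (?X j) \<inter> {0<..T}. H j x (v, jump (?X j) v)) =
         (\<Sum>v\<in>jumps' \<omega> \<inter> ?I. impulse' U i v \<omega> * L v \<omega>)"
        unfolding impulse_def sum_distrib_right
        by (simp add: sum_jump_times[OF steps[OF x(2)] I] if_distrib[of "\<lambda>c. c * _"] cong: if_cong)
      then show ?thesis using x by simp
    qed (simp add: x)
  qed
qed

lemma progressive_drift_integral:
  assumes U: "progressive U" and L: "\<And>j. progressive (L j)"
  shows "progressive (\<lambda>s \<omega>. LINT v:{0..s}|lborel. \<Sum>j\<in>UNIV. drift' U i j v \<omega> * L j v \<omega> :: real)"
proof -
  define W where "W = (\<lambda>(s, \<omega>). indicator {..T} s *\<^sub>R U s \<omega>)"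
  define V where "V j = (\<lambda>(s, \<omega>). indicator {..T} s *\<^sub>R L j s \<omega>)" for j
  have W [measurable]: "W \<in> borel_measurable (borel \<Otimes>\<^sub>M G)" using U by (simp add: progressive_def W_def)
  have V [measurable]: "V j \<in> borel_measurable (borel \<Otimes>\<^sub>M G)" for j using L by (simp add: progressive_def V_def)
  define h where "h = (\<lambda>(v, \<omega>). \<Sum>j\<in>UNIV. (f i j (W (v - b, \<omega>)) -
      (if i = j then \<Sum>k\<in>UNIV. compensator i k (W (v - b, \<omega>)) else 0)) * V j (v, \<omega>))"
  have [measurable]: "h \<in> borel_measurable (borel \<Otimes>\<^sub>M G)" unfolding h_def by measurable
  have "(\<lambda>x. LINT v|lborel. (if 0 \<le> v \<and> v \<le> fst x then h (v, snd x) else 0)) \<in> borel_measurable (borel \<Otimes>\<^sub>M G)"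
    by (rule lborel.borel_measurable_lebesgue_integral) measurable
  then have *: "(\<lambda>x. indicator {..T} (fst x) * (LINT v|lborel. (if 0 \<le> v \<and> v \<le> fst x then h (v, snd x) else 0)))
      \<in> borel_measurable (borel \<Otimes>\<^sub>M G)"
    by measurable
  show ?thesis unfolding progressive_def
  proof (rule measurable_cong[THEN iffD1, OF _ *])
    fix x :: "real \<times> 'w"
    obtain s \<omega> where x: "x = (s, \<omega>)" by (cases x)
    show "indicator {..T} (fst x) * (LINT v|lborel. (if 0 \<le> v \<and> v \<le> fst x then h (v, snd x) else 0)) =
      (case x of (s, \<omega>) \<Rightarrow> indicator {..T} s *\<^sub>R (LINT v:{0..s}|lborel. \<Sum>j\<in>UNIV. drift' U i j v \<omega> * L j v \<omega>))"
    proof (cases "s \<le> T")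
      case True
      have "(if 0 \<le> v \<and> v \<le> s then h (v, \<omega>) else 0) = indicator {0..s} v *\<^sub>R (\<Sum>j\<in>UNIV. drift' U i j v \<omega> * L j v \<omega>)" for v
      proof (cases "0 \<le> v \<and> v \<le> s")
        case v: True
        then have "v \<le> T" "v - b \<le> T" using True b_pos by auto
        then show ?thesis using v by (simp add: h_def drift_def W_def V_def cong: if_cong)
      qed (auto simp: indicator_def)
      then show ?thesis unfolding x set_lebesgue_integral_def snd_conv fst_conv prod.case by simp
    qed (simp add: x)
  qed
qed

lemma progressive_add:
  assumes "progressive K" "progressive L"
  shows "progressive (\<lambda>s \<omega>. c + K s \<omega> + L s \<omega> :: real)"
proof -
  have [measurable]: "(\<lambda>x. indicator {..T} (fst x) * K (fst x) (snd x)) \<in> borel_measurable (borel \<Otimes>\<^sub>M G)"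
    "(\<lambda>x. indicator {..T} (fst x) * L (fst x) (snd x)) \<in> borel_measurable (borel \<Otimes>\<^sub>M G)"
    using assms by (simp_all add: progressive_def case_prod_unfold)
  have "(\<lambda>x. indicator {..T} (fst x) * c + indicator {..T} (fst x) * K (fst x) (snd x)
     + indicator {..T} (fst x) * L (fst x) (snd x)) \<in> borel_measurable (borel \<Otimes>\<^sub>M G)"
    by measurable
  then show ?thesis by (simp add: progressive_def case_prod_unfold distrib_left)
qed

lemma progressive_picard:
  assumes U: "progressive U"
  shows "progressive (\<lambda>s \<omega>. picard (drift (\<lambda>s. U s \<omega>)) (impulse (\<lambda>j s. Z j s \<omega>) (\<lambda>s. U s \<omega>)) (jumps' \<omega>) p n i s)"
proof (induction n arbitrary: i)
  case 0
  show ?case by (simp add: progressive_def)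
next
  case (Suc n)
  let ?P = "\<lambda>n i s \<omega>. picard (drift (\<lambda>s. U s \<omega>)) (impulse (\<lambda>j s. Z j s \<omega>) (\<lambda>s. U s \<omega>)) (jumps' \<omega>) p n i s"
  have "Measurable.pred (borel \<Otimes>\<^sub>M borel) (\<lambda>p. snd p < (fst p :: real))" by measurable
  then have "{p. snd p < (fst p :: real)} \<in> sets (borel \<Otimes>\<^sub>M borel)"
    by (simp add: pred_def space_pair_measure)
  then have "progressive (\<lambda>s \<omega>. \<Sum>v\<in>jumps' \<omega> \<inter> {v. 0 < v \<and> v < s}. impulse' U i v \<omega> * ?P n i v \<omega>)"
    by (intro progressive_jump_sum U Suc.IH) auto
  moreover have "{v. 0 < v \<and> v < s} = {0<..<s}" for s :: real by auto
  ultimately have "progressive (\<lambda>s \<omega>. \<Sum>v\<in>jumps' \<omega> \<inter> {0<..<s}. impulse' U i v \<omega> * ?P n i v \<omega>)" by simp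
  then show ?case unfolding picard_Suc impulsive_op_def
    by (intro progressive_add progressive_drift_integral U Suc.IH)
qed

lemma progressive_left_path:
  assumes U: "progressive U"
  shows "progressive (\<lambda>s \<omega>. left_path (\<lambda>j s. Z j s \<omega>) (\<lambda>s. U s \<omega>) i s)"
proof -
  let ?P = "\<lambda>n s \<omega>. picard (drift (\<lambda>s. U s \<omega>)) (impulse (\<lambda>j s. Z j s \<omega>) (\<lambda>s. U s \<omega>)) (jumps' \<omega>) (\<lambda>i. \<phi> i 0) n i s"
  have [measurable]: "(\<lambda>x. indicator {..T} (fst x) * ?P n (fst x) (snd x)) \<in> borel_measurable (borel \<Otimes>\<^sub>M G)" for n
    using progressive_picard[OF U, of "\<lambda>i. \<phi> i 0" n i] by (simp add: progressive_def case_prod_unfold)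
  \<comment> \<open>The cut-off also appears under \<open>lim\<close>, because measurability is
    available for the cut-off iterates only.\<close>
  have *: "(\<lambda>x. indicator {..T} (fst x) * lim (\<lambda>n. indicator {..T} (fst x) * ?P n (fst x) (snd x))) \<in> borel_measurable (borel \<Otimes>\<^sub>M G)"
    by measurable
  show ?thesis unfolding progressive_def
    by (rule measurable_cong[THEN iffD1, OF _ *])
       (auto simp: left_path_def impulsive_path_def indicator_def)
qed

lemma progressive_stage:
  assumes U: "progressive U"
  shows "progressive (\<lambda>s \<omega>. stage (\<lambda>j s. Z j s \<omega>) (\<lambda>s. U s \<omega>) s)"
  unfolding progressive_def
proof (subst borel_measurable_vec_iff, intro allI)
  fix i
  let ?L = "\<lambda>i s \<omega>. left_path (\<lambda>j s. Z j s \<omega>) (\<lambda>s. U s \<omega>) i s"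
  have "Measurable.pred (borel \<Otimes>\<^sub>M borel) (\<lambda>p. snd p \<le> (fst p :: real))" by measurable
  then have "{p. snd p \<le> (fst p :: real)} \<in> sets (borel \<Otimes>\<^sub>M borel)"
    by (simp add: pred_def space_pair_measure)
  then have "progressive (\<lambda>s \<omega>. \<Sum>v\<in>jumps' \<omega> \<inter> {v. 0 < v \<and> v \<le> s}. impulse' U i v \<omega> * ?L i v \<omega>)"
    by (intro progressive_jump_sum U progressive_left_path) auto
  moreover have "{v. 0 < v \<and> v \<le> s} = {0<..s}" for s :: real by auto
  ultimately have "progressive (\<lambda>s \<omega>. \<Sum>v\<in>jumps' \<omega> \<inter> {0<..s}. impulse' U i v \<omega> * ?L i v \<omega>)" by simp
  then have "progressive (\<lambda>s \<omega>. \<phi> i 0 + (LINT v:{0..s}|lborel. \<Sum>j\<in>UNIV. drift' U i j v \<omega> * ?L j v \<omega>)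
      + (\<Sum>v\<in>jumps' \<omega> \<inter> {0<..s}. impulse' U i v \<omega> * ?L i v \<omega>))" (is "progressive ?R")
    by (intro progressive_add progressive_drift_integral U progressive_left_path)
  then have [measurable]: "(\<lambda>x. indicator {..T} (fst x) * ?R (fst x) (snd x)) \<in> borel_measurable (borel \<Otimes>\<^sub>M G)"
    by (simp add: progressive_def case_prod_unfold)
  have *: "(\<lambda>x. if fst x \<le> 0 then indicator {..T} (fst x) * init (fst x) $ i
       else indicator {..T} (fst x) * ?R (fst x) (snd x)) \<in> borel_measurable (borel \<Otimes>\<^sub>M G)"
    by measurable
  show "(\<lambda>x. (case x of (s, \<omega>) \<Rightarrow> indicator {..T} s *\<^sub>R stage (\<lambda>j s. Z j s \<omega>) (\<lambda>s. U s \<omega>) s) $ i)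
     \<in> borel_measurable (borel \<Otimes>\<^sub>M G)"
    by (rule measurable_cong[THEN iffD1, OF _ *]) (auto simp: stage_def split: prod.splits)
qed

lemma progressive_stages: "progressive (\<lambda>s \<omega>. stages (\<lambda>j s. Z j s \<omega>) n s)"
proof (induction n)
  case 0
  have *: "(\<lambda>x. indicator {..T} (fst x) * init (fst x) $ i) \<in> borel_measurable (borel \<Otimes>\<^sub>M G)" for i
    by measurable
  show ?case unfolding progressive_def
    by (subst borel_measurable_vec_iff) (use * in \<open>simp add: case_prod_unfold\<close>)
next
  case (Suc n)
  then show ?case using progressive_stage by simp
qed

text \<open>The stage used by \<open>steps_sol\<close> varies with time, but up to \<open>T\<close>
  the whole path coincides with one fixed stage.\<close>

lemma progressive_steps_sol: "progressive (\<lambda>s \<omega>. steps_sol (\<lambda>j s. Z j s \<omega>) s)"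
proof -
  define k where "k = nat \<lceil>T / b\<rceil>"
  have "steps_sol (\<lambda>j s. Z j s \<omega>) s = stages (\<lambda>j s. Z j s \<omega>) k s" if "s \<le> T" for s \<omega>
    using that le_nat_ceiling_mult[of T] by (intro steps_sol_eq_stages) (simp add: k_def)
  then have "(\<lambda>(s, \<omega>). indicator {..T} s *\<^sub>R steps_sol (\<lambda>j s. Z j s \<omega>) s) =
     (\<lambda>(s, \<omega>). indicator {..T} s *\<^sub>R stages (\<lambda>j s. Z j s \<omega>) k s)"
    by (intro ext) (auto split: split_indicator)
  then show ?thesis using progressive_stages[of k] by (simp add: progressive_def)
qed

lemma steps_sol_section:
  assumes "s \<le> T"
  shows "(\<lambda>\<omega>. steps_sol (\<lambda>j s. Z j s \<omega>) s) \<in> borel_measurable G"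
  using measurable_Pair2[OF progressive_steps_sol[unfolded progressive_def], of s] assms by simp

lemma steps_sol_path_section:
  assumes "\<omega> \<in> space G"
  shows "(\<lambda>s. indicator {..T} s *\<^sub>R steps_sol (\<lambda>j s. Z j s \<omega>) s) \<in> borel_measurable borel"
  using measurable_Pair1[OF progressive_steps_sol[unfolded progressive_def] assms] by simp

end

end

theorem theorem2p1:
  fixes M :: "'a measure" and F :: "real \<Rightarrow> 'a measure"
    and N :: "'d::finite \<Rightarrow> real \<Rightarrow> 'a \<Rightarrow> nat" and Y :: "'d \<Rightarrow> nat \<Rightarrow> 'a \<Rightarrow> real"
    and Z :: "'d \<Rightarrow> real \<Rightarrow> 'a \<Rightarrow> real"
    and r :: "'d \<Rightarrow> real" and b R \<alpha>\<^sub>0 :: real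
    and f :: "'d \<Rightarrow> 'd \<Rightarrow> real^'d \<Rightarrow> real" and g :: "'d \<Rightarrow> 'd \<Rightarrow> real \<Rightarrow> real^'d \<Rightarrow> real"
    and \<phi> :: "'d \<Rightarrow> real \<Rightarrow> real"
  assumes "prob_space M"
    and "\<And>j. poisson_process M (r j) (N j)"
    and "independent_processes M N"
    and "\<And>j. iid M (Y j)"
    and "independent_of_marks M N Y"
    and "\<And>j. Z j = compound (N j) (Y j)"
    and "AE \<omega> in M. \<forall>j. \<forall>s>0. jump (\<lambda>t. Z j t \<omega>) s \<in> {-R..}"
    and "filtration (space M) F" and "\<And>t. subalgebra M (F t)"
    and "\<And>j t. 0 \<le> t \<Longrightarrow> Z j t \<in> borel_measurable (F t)"
    and "0 < b" and "0 < R"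
    and "\<And>i j. f i j \<in> borel_measurable borel" and "\<And>i j. bounded (range (f i j))"
    and "\<And>i j. (\<lambda>(z, x). g i j z x) \<in> borel_measurable (restrict_space borel ({-R..} \<times> UNIV))"
    and "\<And>i j. bounded ((\<lambda>(z, x). g i j z x) ` ({-R..} \<times> UNIV))"
    and "\<alpha>\<^sub>0 > -1" and "\<And>i j z x. z \<in> {-R..} \<Longrightarrow> g i j z x \<ge> \<alpha>\<^sub>0"
    and "\<And>i j x. i \<noteq> j \<Longrightarrow> f i j x \<ge> 0"
    and "\<And>i. \<phi> i \<in> borel_measurable (restrict_space borel {-b..0})"
    and "\<And>i. \<phi> i 0 \<ge> 0"
  shows "(\<exists>S. sdde_solution M F Z {-R..} b f g \<phi> S) \<and>
    (\<forall>S S'. sdde_solution M F Z {-R..} b f g \<phi> S \<and> sdde_solution M F Z {-R..} b f g \<phi> S' \<longrightarrow>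
       (AE \<omega> in M. \<forall>t\<ge>-b. S t \<omega> = S' t \<omega>)) \<and>
    (\<forall>S. sdde_solution M F Z {-R..} b f g \<phi> S \<longrightarrow>
       (AE \<omega> in M. \<forall>t>0. \<forall>i. S t \<omega> $ i \<ge> 0))"
proof -
  interpret prob_space M by fact
  interpret filtration "space M" F by fact
  note N = assms(2) and Zdef = assms(6)
  have "\<exists>B. \<forall>x. \<bar>f i j x\<bar> \<le> B" for i j
    using assms(14)[of i j] by (auto simp: bounded_iff)
  then obtain Bf where Bf: "\<And>i j x. \<bar>f i j x\<bar> \<le> Bf i j" by metis
  have "\<exists>B. \<forall>z\<in>{-R..}. \<forall>x. \<bar>g i j z x\<bar> \<le> B" for i j
    using assms(16)[of i j] by (auto simp: bounded_iff)
  then obtain Bg where Bg: "\<And>i j z x. z \<in> {-R..} \<Longrightarrow> \<bar>g i j z x\<bar> \<le> Bg i j" by metis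
  define C where "C = (\<Sum>i\<in>UNIV. \<Sum>j\<in>UNIV. \<bar>Bf i j\<bar> + \<bar>Bg i j\<bar>)"
  have "\<bar>Bf i j\<bar> + \<bar>Bg i j\<bar> \<le> C" for i j
  proof -
    have "\<bar>Bf i j\<bar> + \<bar>Bg i j\<bar> \<le> (\<Sum>j\<in>UNIV. \<bar>Bf i j\<bar> + \<bar>Bg i j\<bar>)" by (rule member_le_sum) auto
    also have "\<dots> \<le> C" unfolding C_def
      by (rule member_le_sum[where f = "\<lambda>i. \<Sum>j\<in>UNIV. \<bar>Bf i j\<bar> + \<bar>Bg i j\<bar>"]) (auto intro!: sum_nonneg)
    finally show ?thesis .
  qed
  then have BC: "Bf i j \<le> C" "Bg i j \<le> C" for i j by (smt (verit))+
  interpret D: delay_system f g "\<lambda>j. levy_measure M (Z j)" "{-R..}" b C \<phi>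
  proof (rule delay_system.intro)
    show "\<bar>f i j x\<bar> \<le> C" for i j x using Bf BC by (meson order.trans)
    show "\<bar>g i j z x\<bar> \<le> C" if "z \<in> {-R..}" for i j z x using Bg[OF that] BC by (meson order.trans)
    show "finite_measure (levy_measure M (Z j))" "sets (levy_measure M (Z j)) = sets borel" for j
      by (rule finite_measure_levy sets_levy_measure, rule N, rule Zdef)+
  qed (use assms in auto)
  have steps: "step_paths (\<lambda>j s. Z j s \<omega>)" if \<omega>: "\<omega> \<in> space M" for \<omega>
    unfolding step_paths_def
  proof (intro allI impI)
    fix j and t :: real assume t: "0 \<le> t"
    obtain Q where "step_on Q t (\<lambda>s. N j s \<omega>)" by (rule poisson_process_step_on[OF N \<omega> t])
    then show "\<exists>Q. step_on Q t (\<lambda>s. Z j s \<omega>)" unfolding Zdef by (intro exI compound_step_on[where N = "N j" and \<omega> = \<omega>])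
  qed
  have iff: "sdde_solution M F Z {-R..} b f g \<phi> S \<longleftrightarrow>
     (\<forall>t\<ge>0. S t \<in> borel_measurable (F t)) \<and> (AE \<omega> in M. D.path_solution (\<lambda>j s. Z j s \<omega>) (\<lambda>s. S s \<omega>))" for S
    unfolding sdde_solution_def D.path_solution_def ..
  \<comment> \<open>Jumps of the compound processes occur at moves of the counting processes, so
    \<open>no_common_moves\<close> for each of the finitely many pairs suffices.\<close>
  have good: "AE \<omega> in M. \<forall>i j s. i \<noteq> j \<longrightarrow> s \<in> jump_times (\<lambda>s. Z i s \<omega>) \<longrightarrow> s \<notin> jump_times (\<lambda>s. Z j s \<omega>)"
  proof -
    have "AE \<omega> in M. \<forall>i\<in>UNIV. \<forall>j\<in>UNIV. i \<noteq> j \<longrightarrow> (\<forall>s>0. \<not> (moves_at (\<lambda>t. N i t \<omega>) s \<and> moves_at (\<lambda>t. N j t \<omega>) s))"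
    proof (intro AE_finite_allI finite)
      fix i j
      show "AE \<omega> in M. i \<noteq> j \<longrightarrow> (\<forall>s>0. \<not> (moves_at (\<lambda>t. N i t \<omega>) s \<and> moves_at (\<lambda>t. N j t \<omega>) s))"
        using no_common_moves[where N = N and r = r, OF N assms(3), of i j] by (cases "i = j") auto
    qed
    with AE_space show ?thesis
    proof eventually_elim
      case (elim \<omega>)
      have mv: "moves_at (\<lambda>s. N j s \<omega>) s" if "s \<in> jump_times (\<lambda>s. Z j s \<omega>)" for j s
        using N[of j] elim(1) that unfolding Zdef poisson_process_def by (intro compound_jump_moves_at) auto
      show ?case
      proof (intro allI impI notI)
        fix i j s assume "i \<noteq> j" "s \<in> jump_times (\<lambda>s. Z i s \<omega>)" "s \<in> jump_times (\<lambda>s. Z j s \<omega>)"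
        then show False using elim(2) mv[of s i] mv[of s j] unfolding jump_times_def by blast
      qed
    qed
  qed
  have g_ge: "-1 \<le> g i j z x" if "z \<in> {-R..}" for i j z x
    using assms(17) assms(18)[OF that, of i j x] by linarith
  define S where "S = (\<lambda>t \<omega>. D.steps_sol (\<lambda>j s. Z j s \<omega>) t)"
  have ZF: "Z j s \<in> borel_measurable (F T)" if "0 \<le> s" "s \<le> T" for j s T
    using assms(10)[OF that(1), of j] sets_F_mono[OF that(2)] space_F unfolding measurable_def by auto
  \<comment> \<open>Horizon and \<sigma>-algebra are chosen together, \<open>T = t\<close> and
    \<open>G = F t\<close>: the drivers up to time \<open>t\<close> are measurable with respect to
    \<open>F t\<close>, and \<open>S t\<close> depends on nothing later.\<close>
  have S_meas: "S t \<in> borel_measurable (F t)" if t: "0 \<le> t" for t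
    unfolding S_def by (rule D.steps_sol_section[where T = t]) (use ZF steps t space_F in auto)
  have S_path: "(\<lambda>s. S s \<omega>) \<in> borel_measurable borel" if \<omega>: "\<omega> \<in> space M" for \<omega>
  proof (rule borel_measurable_LIMSEQ_metric)
    show "(\<lambda>s. indicator {..real n} s *\<^sub>R S s \<omega>) \<in> borel_measurable borel" for n
      unfolding S_def
      by (rule D.steps_sol_path_section[where T = "real n" and G = "F (real n)"]) (use ZF steps \<omega> space_F in auto)
    show "(\<lambda>n. indicator {..real n} s *\<^sub>R S s \<omega>) \<longlonglongrightarrow> S s \<omega>" for s
    proof (rule tendsto_eventually)
      obtain m where "s \<le> real m" using real_arch_simple by blast
      then show "\<forall>\<^sub>F n in sequentially. indicator {..real n} s *\<^sub>R S s \<omega> = S s \<omega>"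
        unfolding eventually_sequentially by (intro exI[of _ m]) auto
    qed
  qed
  \<comment> \<open>This holds for every \<omega>, since all paths of \<open>Z\<close> are step
    paths; no exceptional set can disturb adaptedness.\<close>
  have "D.path_solution (\<lambda>j s. Z j s \<omega>) (\<lambda>s. S s \<omega>)" if \<omega>: "\<omega> \<in> space M" for \<omega>
    by (rule D.stage_fixpoint_is_solution[OF steps[OF \<omega>] S_path[OF \<omega>]])
       (unfold S_def, rule D.steps_sol_fixpoint)
  then have ex: "sdde_solution M F Z {-R..} b f g \<phi> S"
    unfolding iff using S_meas by (auto intro: AE_I2)
  have uniq: "AE \<omega> in M. \<forall>t\<ge>-b. U t \<omega> = U' t \<omega>"
    if "sdde_solution M F Z {-R..} b f g \<phi> U" "sdde_solution M F Z {-R..} b f g \<phi> U'" for U U'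
  proof -
    from that have "AE \<omega> in M. D.path_solution (\<lambda>j s. Z j s \<omega>) (\<lambda>s. U s \<omega>)"
      "AE \<omega> in M. D.path_solution (\<lambda>j s. Z j s \<omega>) (\<lambda>s. U' s \<omega>)" unfolding iff by auto
    with good AE_space show ?thesis
    proof eventually_elim
      case (elim \<omega>)
      then show ?case
        using D.path_solution_unique[OF steps[OF elim(2)] _ g_ge assms(19) elim(3,4)] by blast
    qed
  qed
  have nonneg: "AE \<omega> in M. \<forall>t>0. \<forall>i. 0 \<le> U t \<omega> $ i" if "sdde_solution M F Z {-R..} b f g \<phi> U" for U
  proof -
    from that have "AE \<omega> in M. D.path_solution (\<lambda>j s. Z j s \<omega>) (\<lambda>s. U s \<omega>)" unfolding iff by auto
    with good AE_space show ?thesis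
    proof eventually_elim
      case (elim \<omega>)
      then show ?case
        using D.path_solution_nonneg[OF steps[OF elim(2)] _ g_ge assms(19) elim(3) assms(21)] by blast
    qed
  qed
  show ?thesis using ex uniq nonneg by blast
qed

end
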